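(* Assume $N>6s$, $\xi_1,\xi_2>0$, $\alpha,\beta>1$ with $\alpha+\beta=2^*_s$. Let $A=\begin{pmatrix} a & b\\ b& c\end{pmatrix}$ be a real symmetric matrix with eigenvalues $\mu_1\le\mu_2$ satisfying $$\lambda_{k,s}=\mu_1\le\mu_2<\lambda_{k+1,s}\quad\text{for some integer }k>1.$$ Let $f_1,g_1\in L^q(\Omega)$ for some $q>\frac{N}{2s}$ with $\int_\Omega f_1\varphi_{1,s}\,dx=\int_\Omega g_1\varphi_{1,s}\,dx=0$, and assume in addition that $$F_1=(f_1,g_1)\in\left(\mathrm{Ker}\big((-\overrightarrow{\Delta})^s-\lambda_{k,s}I\big)\right)^{\perp}.$$ Let $\eta,\vartheta<0$ be (sufficiently negative) constants such that for every $T=(t,r)$ in the set $$\mathbf{R}=\left\{(t,r)\in\mathbb{R}^2:\ br+(\lambda_{1,s}-c)t<\eta\det(\lambda_{1,s}I-A)\ \text{ and }\ (\lambda_{1,s}-a)r+bt<\vartheta\det(\lambda_{1,s}I-A)\right\}$$ the system $$\begin{cases}(-\Delta)^s u=au+bv+\frac{\alpha}{\alpha+\beta}u_+^{\alpha-1}v_+^{\beta}+\xi_1u_+^{\alpha+\beta-1}+t\varphi_{1,s}+f_1 & \text{in }\Omega,\\ (-\Delta)^s v=bu+cv+\frac{\beta}{\alpha+\beta}u_+^{\alpha}v_+^{\beta-1}+\xi_2v_+^{\alpha+\beta-1}+r\varphi_{1,s}+g_1 & \text{in }\Omega,\\ u=v=0 & \text{in }\mathbb{R}^N\setminus\Omega\end{cases}$$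 has a solution $U_T=(u_T,v_T)$ with $u_T<0$ and $v_T<0$ in $\Omega$. Then for every $T=(t,r)\in\mathbf{R}$ this system has a second solution, different from $U_T$.
   Context: Setting: $s\in(0,1)$, $\Omega\subset\mathbb{R}^N$ is a bounded smooth domain, $2^*_s:=\frac{2N}{N-2s}$. For a function $w$, $w_+=\max\{w,0\}$. The fractional Laplacian is $(-\Delta)^su(x)=C(N,s)\lim_{\varepsilon\searrow0}\int_{\mathbb{R}^N\setminus B_\varepsilon(x)}\frac{u(x)-u(y)}{|x-y|^{N+2s}}\,dy$, with $C(N,s)=\left(\int_{\mathbb{R}^N}\frac{1-\cos\zeta_1}{|\zeta|^{N+2s}}\,d\zeta\right)^{-1}$. Let $X_0^s(\Omega)=\{u\in H^s(\mathbb{R}^N): u=0\text{ a.e. in }\mathbb{R}^N\setminus\Omega\}$. Solutions are understood in the weak sense: $(u,v)\in X_0^s(\Omega)\times X_0^s(\Omega)$, and each equation $(-\Delta)^s u=h$ means $\int_{\mathbb{R}^N}(-\Delta)^{s/2}u\,(-\Delta)^{s/2}\phi\,dx=\int_\Omega h\phi\,dx$ for all $\phi\in X_0^s(\Omega)$. $0<\lambda_{1,s}<\lambda_{2,s}\le\lambda_{3,s}\le\cdots\to\infty$ are the eigenvalues of $(-\Delta)^s$ in $X_0^s(\Omega)$, and $\varphi_{1,s}>0$ is a positive eigenfunction associated with $\lambda_{1,s}$. The operator $(-\overrightarrow{\Delta})^s$ acts componentwise, $(-\overrightarrow{\Delta})^s(u,v)=((-\Delta)^su,(-\Delta)^sv)$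 on $X_0^s(\Omega)\times X_0^s(\Omega)$; the kernel above is therefore the set of pairs $(\phi,\psi)$ with $\phi,\psi$ both solving $(-\Delta)^sw=\lambda_{k,s}w$ in $X_0^s(\Omega)$, and $F_1$ orthogonal to it means $\int_\Omega(f_1\phi+g_1\psi)\,dx=0$ for all such pairs. *)

theory Defs
  imports "HOL-Analysis.Analysis"
begin

text \<open>The ambient space \<open>\<real>\<^sup>N\<close> is a type of class \<open>euclidean_space\<close>, with \<open>N = DIM('a)\<close>.
  Elements of \<open>L\<^sup>2\<close> and \<open>H\<^sup>s\<close> are represented by Lebesgue measurable functions; identification of
  functions that agree almost everywhere is always written out.\<close>

section \<open>Bounded smooth domains\<close>

primrec C_k :: "nat \<Rightarrow> ('a::euclidean_space \<Rightarrow> real) \<Rightarrow> bool" where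
  "C_k 0 f \<longleftrightarrow> continuous_on UNIV f"
| "C_k (Suc k) f \<longleftrightarrow>
     (\<forall>x. f differentiable (at x)) \<and> (\<forall>v. C_k k (\<lambda>x. frechet_derivative f (at x) v))"

definition C_infinity :: "('a::euclidean_space \<Rightarrow> real) \<Rightarrow> bool" where
  "C_infinity f \<longleftrightarrow> (\<forall>k. C_k k f)"

text \<open>Near each boundary point the domain is, after a rotation, the part above the graph of a smooth
  function of \<open>N - 1\<close> variables. The unit vector \<open>\<nu>\<close> is the vertical direction; \<open>\<gamma>\<close> is only evaluated at
  the orthogonal projection of \<open>x\<close> to the hyperplane orthogonal to \<open>\<nu>\<close>.\<close>

definition smooth_boundary :: "'a::euclidean_space set \<Rightarrow> bool" where
  "smooth_boundary \<Omega> \<longleftrightarrow>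
     (\<forall>x0 \<in> frontier \<Omega>. \<exists>r>0. \<exists>\<nu> \<gamma>. norm \<nu> = 1 \<and> C_infinity \<gamma> \<and>
        \<Omega> \<inter> ball x0 r = {x \<in> ball x0 r. \<gamma> (x - (x \<bullet> \<nu>) *\<^sub>R \<nu>) < x \<bullet> \<nu>})"

definition bounded_smooth_domain :: "'a::euclidean_space set \<Rightarrow> bool" where
  "bounded_smooth_domain \<Omega> \<longleftrightarrow>
     open \<Omega> \<and> connected \<Omega> \<and> \<Omega> \<noteq> {} \<and> bounded \<Omega> \<and> smooth_boundary \<Omega>"

section \<open>The fractional Laplacian and its weak form\<close>

text \<open>By rotation invariance the value of the integral does not depend on which basis vector
  plays the role of the first coordinate direction.\<close>

definition frac_const :: "'a::euclidean_space itself \<Rightarrow> real \<Rightarrow> real" where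
  "frac_const _ s =
     inverse (LINT \<zeta>|(lebesgue :: 'a measure).
        (1 - cos (\<zeta> \<bullet> (SOME b. b \<in> Basis))) / norm \<zeta> powr (real DIM('a) + 2 * s))"

definition frac_laplacian :: "real \<Rightarrow> ('a::euclidean_space \<Rightarrow> real) \<Rightarrow> 'a \<Rightarrow> real" where
  "frac_laplacian s u x =
     frac_const TYPE('a) s *
     Lim (at_right 0) (\<lambda>\<epsilon>. LINT y:(- ball x \<epsilon>)|lebesgue.
        (u x - u y) / norm (x - y) powr (real DIM('a) + 2 * s))"

definition H_s :: "real \<Rightarrow> ('a::euclidean_space \<Rightarrow> real) set" where
  "H_s s = {u. u \<in> borel_measurable lebesgue \<and> integrable lebesgue (\<lambda>x. (u x)\<^sup>2) \<and>
     (\<integral>\<^sup>+ x. (\<integral>\<^sup>+ y. ennreal ((u x - u y)\<^sup>2 / norm (x - y) powr (real DIM('a) + 2 * s))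
        \<partial>lebesgue) \<partial>lebesgue) < \<infinity>}"

definition X0_s :: "real \<Rightarrow> 'a::euclidean_space set \<Rightarrow> ('a \<Rightarrow> real) set" where
  "X0_s s \<Omega> = {u \<in> H_s s. AE x in lebesgue. x \<notin> \<Omega> \<longrightarrow> u x = 0}"

text \<open>\<open>u\<close> solves \<open>(-\<Delta>)\<^sup>s u = h\<close> weakly in \<open>\<Omega>\<close>. For \<open>u \<in> H\<^sup>s\<close> and \<open>0 < s < 1\<close> the limit in
  \<open>frac_laplacian (s/2) u x\<close> exists for almost every \<open>x\<close> and defines a square integrable
  function, so the left-hand integral is a genuine one.\<close>

definition weak_solution :: "real \<Rightarrow> 'a::euclidean_space set \<Rightarrow> ('a \<Rightarrow> real) \<Rightarrow> ('a \<Rightarrow> real) \<Rightarrow> bool" where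
  "weak_solution s \<Omega> h u \<longleftrightarrow> u \<in> X0_s s \<Omega> \<and>
     (\<forall>\<phi> \<in> X0_s s \<Omega>.
        (LINT x|lebesgue. frac_laplacian (s/2) u x * frac_laplacian (s/2) \<phi> x)
          = (LINT x:\<Omega>|lebesgue. h x * \<phi> x))"

section \<open>Eigenvalues\<close>

definition eigenspace :: "real \<Rightarrow> 'a::euclidean_space set \<Rightarrow> real \<Rightarrow> ('a \<Rightarrow> real) set" where
  "eigenspace s \<Omega> \<Lambda> = {w. weak_solution s \<Omega> (\<lambda>x. \<Lambda> * w x) w}"

definition ae_independent :: "nat \<Rightarrow> (nat \<Rightarrow> 'a::euclidean_space \<Rightarrow> real) \<Rightarrow> bool" where
  "ae_independent n e \<longleftrightarrow>
     (\<forall>c. (AE x in lebesgue. (\<Sum>i<n. c i * e i x) = 0) \<longrightarrow> (\<forall>i<n. c i = 0))"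

text \<open>\<open>lam 1 \<le> lam 2 \<le> \<dots>\<close> lists the eigenvalues of \<open>(-\<Delta>)\<^sup>s\<close> in \<open>X\<^sub>0\<^sup>s(\<Omega>)\<close>, each repeated according to
  the dimension (modulo null functions) of its eigenspace; \<open>lam 0\<close> is irrelevant. That
  \<open>0 < lam 1 < lam 2\<close> is a consequence, not part of the definition.\<close>

definition eigenvalue_sequence :: "real \<Rightarrow> 'a::euclidean_space set \<Rightarrow> (nat \<Rightarrow> real) \<Rightarrow> bool" where
  "eigenvalue_sequence s \<Omega> lam \<longleftrightarrow>
     mono_on {1..} lam \<and> filterlim lam at_top sequentially \<and>
     (\<forall>\<Lambda> n. (\<exists>e. (\<forall>i<n. e i \<in> eigenspace s \<Omega> \<Lambda>) \<and> ae_independent n e)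
              \<longleftrightarrow> n \<le> card {k. 1 \<le> k \<and> lam k = \<Lambda>})"

definition positive_first_eigenfunction ::
  "real \<Rightarrow> 'a::euclidean_space set \<Rightarrow> (nat \<Rightarrow> real) \<Rightarrow> ('a \<Rightarrow> real) \<Rightarrow> bool" where
  "positive_first_eigenfunction s \<Omega> lam \<phi> \<longleftrightarrow>
     \<phi> \<in> eigenspace s \<Omega> (lam 1) \<and> (AE x in lebesgue. x \<in> \<Omega> \<longrightarrow> \<phi> x > 0)"

text \<open>Componentwise, \<open>F \<in> Ker((-\<Delta>)\<^sup>s - \<Lambda> I)\<^sup>\<bottom>\<close> for \<open>F = (f, g)\<close>.\<close>

definition orthogonal_to_kernel ::
  "real \<Rightarrow> 'a::euclidean_space set \<Rightarrow> real \<Rightarrow> ('a \<Rightarrow> real) \<Rightarrow> ('a \<Rightarrow> real) \<Rightarrow> bool" where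
  "orthogonal_to_kernel s \<Omega> \<Lambda> f g \<longleftrightarrow>
     (\<forall>\<phi> \<in> eigenspace s \<Omega> \<Lambda>. \<forall>\<psi> \<in> eigenspace s \<Omega> \<Lambda>.
        (LINT x:\<Omega>|lebesgue. f x * \<phi> x + g x * \<psi> x) = 0)"

definition matrix_eigenvalue :: "real^'n^'n \<Rightarrow> real \<Rightarrow> bool" where
  "matrix_eigenvalue A \<mu> \<longleftrightarrow> (\<exists>v. v \<noteq> 0 \<and> A *v v = \<mu> *\<^sub>R v)"

definition sym_mat2 :: "real \<Rightarrow> real \<Rightarrow> real \<Rightarrow> real^2^2" where
  "sym_mat2 a b c = vector [vector [a, b], vector [b, c]]"

section \<open>The system\<close>

definition in_L :: "real \<Rightarrow> 'a::euclidean_space set \<Rightarrow> ('a \<Rightarrow> real) \<Rightarrow> bool" where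
  "in_L q \<Omega> f \<longleftrightarrow> set_borel_measurable lebesgue \<Omega> f \<and>
     set_integrable lebesgue \<Omega> (\<lambda>x. \<bar>f x\<bar> powr q)"

definition pos_part :: "real \<Rightarrow> real" where
  "pos_part w = max w 0"

definition system_solution ::
  "real \<Rightarrow> 'a::euclidean_space set \<Rightarrow> real \<Rightarrow> real \<Rightarrow> real \<Rightarrow> real \<Rightarrow> real \<Rightarrow> real \<Rightarrow> real \<Rightarrow>
    ('a \<Rightarrow> real) \<Rightarrow> ('a \<Rightarrow> real) \<Rightarrow> ('a \<Rightarrow> real) \<Rightarrow> real \<Rightarrow> real \<Rightarrow>
    ('a \<Rightarrow> real) \<Rightarrow> ('a \<Rightarrow> real) \<Rightarrow> bool" where
  "system_solution s \<Omega> a b c \<alpha> \<beta> \<xi>1 \<xi>2 \<phi>1 f1 g1 t r u v \<longleftrightarrow>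
     weak_solution s \<Omega>
       (\<lambda>x. a * u x + b * v x
          + \<alpha> / (\<alpha> + \<beta>) * pos_part (u x) powr (\<alpha> - 1) * pos_part (v x) powr \<beta>
          + \<xi>1 * pos_part (u x) powr (\<alpha> + \<beta> - 1) + t * \<phi>1 x + f1 x) u \<and>
     weak_solution s \<Omega>
       (\<lambda>x. b * u x + c * v x
          + \<beta> / (\<alpha> + \<beta>) * pos_part (u x) powr \<alpha> * pos_part (v x) powr (\<beta> - 1)
          + \<xi>2 * pos_part (v x) powr (\<alpha> + \<beta> - 1) + r * \<phi>1 x + g1 x) v"

definition parameter_region ::
  "real \<Rightarrow> real \<Rightarrow> real \<Rightarrow> real \<Rightarrow> real \<Rightarrow> real \<Rightarrow> (real \<times> real) set" where
  "parameter_region lam1 a b c \<eta> \<theta> =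
     {(t, r). b * r + (lam1 - c) * t < \<eta> * det (mat lam1 - sym_mat2 a b c) \<and>
              (lam1 - a) * r + b * t < \<theta> * det (mat lam1 - sym_mat2 a b c)}"

end

theory Submission
  imports Defs
begin

text \<open>The second solution comes from resonance. Where both components are negative the superlinear
  terms vanish and the system is linear, \<open>(-\<Delta>)\<^sup>s U = A U + T \<phi>\<^sub>1 + F\<^sub>1\<close>. Let \<open>p\<close> be an eigenvector of \<open>A\<close> for
  \<open>\<mu>\<^sub>1 = \<lambda>\<^sub>k\<close> and \<open>\<psi> \<noteq> 0\<close> an eigenfunction for \<open>\<lambda>\<^sub>k\<close>: then \<open>\<psi> p\<close> solves the homogeneous linear system, and
  \<open>U + \<epsilon> \<psi> p\<close> solves the full one as long as it stays negative. To have room for this, start at a nearby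
  parameter. The region is open, so it contains \<open>T' = T + \<delta> (\<lambda>\<^sub>1 I - A) (1, 1)\<close> for small \<open>\<delta> > 0\<close>, and
  \<open>U\<^sub>T\<^sub>' - \<delta> \<phi>\<^sub>1 (1, 1)\<close> is a solution for \<open>T\<close> that lies below the negative function \<open>U\<^sub>T\<^sub>'\<close> by the amount
  \<open>\<delta> \<phi>\<^sub>1\<close>. If \<open>|\<psi>| \<le> M \<phi>\<^sub>1\<close>, then \<open>U\<^sub>T\<^sub>' - \<delta> \<phi>\<^sub>1 (1, 1) + \<epsilon> \<psi> p\<close> is a negative solution for \<open>T\<close> for every
  sufficiently small \<open>\<epsilon> \<ge> 0\<close>; two values of \<open>\<epsilon>\<close> give two solutions, and at most one of them is \<open>U\<^sub>T\<close>.

  Two facts carry this argument. The first is the comparison \<open>|\<psi>| \<le> M \<phi>\<^sub>1\<close>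
  (\<open>form_eigenfunction_abs_le_first\<close>). Both the boundedness of \<open>\<psi>\<close> and the comparison with \<open>\<phi>\<^sub>1\<close>
  follow from one truncation each, because for a nonlocal form the positive part of a function interacts
  with its negative part at a distance.

  The second is that the left-hand side of the weak formulation is a multiple of the Gagliardo form
  (\<open>frac_laplacian_half_form\<close>); already its linearity in \<open>u\<close> requires the principal values that
  define \<open>(-\<Delta>)\<^sup>s\<^sup>/\<^sup>2 u\<close> to converge almost everywhere for every \<open>u \<in> H\<^sup>s\<close>. This is done in real space. If
  the kernel \<open>|z|\<^sup>-\<^sup>N\<^sup>-\<^sup>s\<close> is capped near the origin, the operator becomes convolution with a measure of total mass zero,
  and its energy is a quadratic form whose kernel is a convolution square (\<open>difference_op_energy\<close>).
  That kernel is bounded by \<open>|z|\<^sup>-\<^sup>N\<^sup>-\<^sup>2\<^sup>s\<close> uniformly in the cap and tends to a multiple of it, so the capped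
  operators converge in the mean to some \<open>g\<close> with energy proportional to the Gagliardo seminorm
  (\<open>difference_op_mean_square_limit\<close>). The sharp truncation at radius \<open>e\<close> differs from the average of
  \<open>g\<close> over a ball of radius \<open>e\<close> by an integral that is small wherever the Gagliardo integral at the point
  is finite (\<open>truncated_minus_tent_mean\<close>), and the averages converge at the Lebesgue points of \<open>g\<close>.\<close>

section \<open>Changes of variables\<close>

lemma lborel_distr_minus: "distr lborel borel (\<lambda>x. - x) = (lborel :: 'a::euclidean_space measure)"
  by (subst (2) lborel_affine[of "-1" 0]) (auto simp: density_1)

lemma
  fixes f :: "'a::euclidean_space \<Rightarrow> ennreal"
  assumes [measurable]: "f \<in> borel_measurable borel"
  shows nn_integral_translate: "(\<integral>\<^sup>+x. f (c + x) \<partial>lborel) = (\<integral>\<^sup>+x. f x \<partial>lborel)"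
    and nn_integral_translate': "(\<integral>\<^sup>+x. f (x + c) \<partial>lborel) = (\<integral>\<^sup>+x. f x \<partial>lborel)"
    and nn_integral_reflect: "(\<integral>\<^sup>+x. f (- x) \<partial>lborel) = (\<integral>\<^sup>+x. f x \<partial>lborel)"
proof -
  show *: "(\<integral>\<^sup>+x. f (c + x) \<partial>lborel) = (\<integral>\<^sup>+x. f x \<partial>lborel)"
    by (subst (2) lborel_distr_plus[of c, symmetric]) (simp add: nn_integral_distr)
  then show "(\<integral>\<^sup>+x. f (x + c) \<partial>lborel) = (\<integral>\<^sup>+x. f x \<partial>lborel)" by (simp add: add.commute)
  show "(\<integral>\<^sup>+x. f (- x) \<partial>lborel) = (\<integral>\<^sup>+x. f x \<partial>lborel)"
    by (subst (2) lborel_distr_minus[symmetric]) (simp add: nn_integral_distr)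
qed

lemma nn_integral_reflect_translate:
  fixes f :: "'a::euclidean_space \<Rightarrow> ennreal"
  assumes [measurable]: "f \<in> borel_measurable borel"
  shows "(\<integral>\<^sup>+x. f (c - x) \<partial>lborel) = (\<integral>\<^sup>+x. f x \<partial>lborel)"
  using nn_integral_reflect[of "\<lambda>x. f (c + x)"] nn_integral_translate[of f c] by simp

lemma
  fixes f :: "'a::euclidean_space \<Rightarrow> real"
  assumes [measurable]: "f \<in> borel_measurable borel"
  shows integral_lborel_translate: "(\<integral>x. f (c + x) \<partial>lborel) = (\<integral>x. f x \<partial>lborel)"
    and integral_lborel_translate': "(\<integral>x. f (x + c) \<partial>lborel) = (\<integral>x. f x \<partial>lborel)"
    and integral_lborel_reflect: "(\<integral>x. f (- x) \<partial>lborel) = (\<integral>x. f x \<partial>lborel)"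
    and integrable_lborel_translate: "integrable lborel (\<lambda>x. f (c + x)) \<longleftrightarrow> integrable lborel f"
    and integrable_lborel_reflect: "integrable lborel (\<lambda>x. f (- x)) \<longleftrightarrow> integrable lborel f"
proof -
  show *: "(\<integral>x. f (c + x) \<partial>lborel) = (\<integral>x. f x \<partial>lborel)"
    by (subst (2) lborel_distr_plus[of c, symmetric]) (simp add: integral_distr)
  then show "(\<integral>x. f (x + c) \<partial>lborel) = (\<integral>x. f x \<partial>lborel)" by (simp add: add.commute)
  show "(\<integral>x. f (- x) \<partial>lborel) = (\<integral>x. f x \<partial>lborel)"
    by (subst (2) lborel_distr_minus[symmetric]) (simp add: integral_distr)
  show "integrable lborel (\<lambda>x. f (c + x)) \<longleftrightarrow> integrable lborel f"
    by (subst (2) lborel_distr_plus[of c, symmetric]) (simp add: integrable_distr_eq)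
  show "integrable lborel (\<lambda>x. f (- x)) \<longleftrightarrow> integrable lborel f"
    by (subst (2) lborel_distr_minus[symmetric]) (simp add: integrable_distr_eq)
qed

lemma integral_lborel_reflect_translate:
  fixes f :: "'a::euclidean_space \<Rightarrow> real"
  assumes [measurable]: "f \<in> borel_measurable borel"
  shows "(\<integral>x. f (c - x) \<partial>lborel) = (\<integral>x. f x \<partial>lborel)"
    and "integrable lborel (\<lambda>x. f (c - x)) \<longleftrightarrow> integrable lborel f"
  using integral_lborel_reflect[of "\<lambda>x. f (c + x)"] integral_lborel_translate[of f c]
    integrable_lborel_reflect[of "\<lambda>x. f (c + x)"] integrable_lborel_translate[of f c] by simp_all

lemma integral_lborel_scale:
  fixes f :: "'a::euclidean_space \<Rightarrow> real"
  assumes [measurable]: "f \<in> borel_measurable borel" and "t > 0"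
  shows "(\<integral>x. f x \<partial>lborel) = t ^ DIM('a) * (\<integral>x. f (t *\<^sub>R x) \<partial>lborel)"
proof -
  have "(\<integral>x. f x \<partial>lborel)
      = (\<integral>x. f x \<partial>density (distr lborel borel (\<lambda>x. 0 + t *\<^sub>R x)) (\<lambda>_. ennreal (\<bar>t\<bar>^DIM('a))))"
    using \<open>t > 0\<close> by (subst lborel_affine[of t "0::'a"]) (auto simp: ennreal_power)
  also have "\<dots> = t ^ DIM('a) * (\<integral>x. f (t *\<^sub>R x) \<partial>lborel)"
    using \<open>t > 0\<close> by (subst integral_density) (auto simp: integral_distr)
  finally show ?thesis .
qed

text \<open>Uniqueness of translation invariant measures in its shortest form: Tonelli's theorem computes
  the product of the volume of \<open>T -` A\<close> with that of the unit ball in two ways. Reflections, which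
  move any vector to any other of the same length, are involutions, hence the assumption \<open>inv\<close>.\<close>

lemma lborel_distr_isometry:
  fixes T :: "'a::euclidean_space \<Rightarrow> 'a"
  assumes T: "linear T" and iso: "\<And>x. norm (T x) = norm x" and inv: "\<And>x. T (T x) = x"
  shows "distr lborel borel T = lborel"
proof (rule measure_eqI)
  have [measurable]: "T \<in> borel_measurable borel"
    by (intro borel_measurable_continuous_onI linear_continuous_on linear_conv_bounded_linear[THEN iffD1] T)
  show "sets (distr lborel borel T) = sets lborel" by simp
  fix A :: "'a set" assume "A \<in> sets (distr lborel borel T)"
  then have [measurable]: "A \<in> sets borel" by simp
  define B where "B = ball (0::'a) 1"
  have [measurable]: "B \<in> sets borel" by (simp add: B_def)
  let ?a = "indicator A :: 'a \<Rightarrow> ennreal" and ?b = "indicator B :: 'a \<Rightarrow> ennreal"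
  have TB: "?b (T x) = ?b x" for x using iso[of x] by (auto simp: indicator_def B_def)
  have e1: "(\<integral>\<^sup>+x. ?a (T x) \<partial>lborel) = emeasure (distr lborel borel T) A"
    using nn_integral_distr[of T lborel borel "indicator A"] by simp
  have "emeasure (distr lborel borel T) A * emeasure lborel B
      = (\<integral>\<^sup>+x. ?a (T x) * (\<integral>\<^sup>+y. ?b y \<partial>lborel) \<partial>lborel)"
    by (subst nn_integral_multc) (auto simp: e1)
  also have "\<dots> = (\<integral>\<^sup>+x. (\<integral>\<^sup>+y. ?a (T x) * ?b (T x + y) \<partial>lborel) \<partial>lborel)"
    using nn_integral_translate[of ?b] by (subst nn_integral_cmult) auto
  also have "\<dots> = (\<integral>\<^sup>+y. (\<integral>\<^sup>+x. ?a (T x) * ?b (T x + y) \<partial>lborel) \<partial>lborel)"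
    by (rule lborel_pair.Fubini') measurable
  also have "\<dots> = (\<integral>\<^sup>+y. (\<integral>\<^sup>+x. ?a (T x - y) * ?b (T x) \<partial>lborel) \<partial>lborel)"
  proof (rule nn_integral_cong)
    fix y
    have "(\<integral>\<^sup>+x. ?a (T x) * ?b (T x + y) \<partial>lborel)
        = (\<integral>\<^sup>+x. ?a (T (- T y + x)) * ?b (T (- T y + x) + y) \<partial>lborel)"
      by (rule nn_integral_translate[symmetric]) measurable
    then show "(\<integral>\<^sup>+x. ?a (T x) * ?b (T x + y) \<partial>lborel) = (\<integral>\<^sup>+x. ?a (T x - y) * ?b (T x) \<partial>lborel)"
      using inv by (simp add: linear_add[OF T] linear_neg[OF T] linear_diff[OF T])
  qed
  also have "\<dots> = (\<integral>\<^sup>+x. (\<integral>\<^sup>+y. ?a (T x - y) * ?b (T x) \<partial>lborel) \<partial>lborel)"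
    by (rule lborel_pair.Fubini'[symmetric]) measurable
  also have "\<dots> = (\<integral>\<^sup>+x. emeasure lborel A * ?b x \<partial>lborel)"
    using nn_integral_reflect_translate[of ?a] by (subst nn_integral_multc) (auto simp: TB)
  also have "\<dots> = emeasure lborel A * emeasure lborel B"
    by (subst nn_integral_cmult) auto
  finally have *: "emeasure (distr lborel borel T) A * emeasure lborel B
      = emeasure lborel A * emeasure lborel B" .
  have "emeasure lborel B \<noteq> 0"
    using content_ball_pos[of 1 "0::'a"] by (auto simp: B_def measure_def)
  moreover have "emeasure lborel B \<noteq> \<infinity>"
    using emeasure_bounded_finite[of B] by (auto simp: B_def)
  ultimately show "emeasure (distr lborel borel T) A = emeasure lborel A"
    using * by (metis ennreal_mult_divide_eq infinity_ennreal_def)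
qed

text \<open>An integral that depends on a vector through an isometry invariant integrand depends only on
  the length of the vector: the reflection in the hyperplane orthogonal to \<open>z - z'\<close> exchanges the two.\<close>

lemma integral_radial_eq:
  fixes F :: "'a::euclidean_space \<Rightarrow> 'a \<Rightarrow> real"
  assumes F[measurable]: "\<And>z. F z \<in> borel_measurable borel"
    and inv: "\<And>T z y. linear T \<Longrightarrow> (\<And>x. norm (T x) = norm x) \<Longrightarrow> F (T z) (T y) = F z y"
    and z: "norm z = norm z'"
  shows "(\<integral>y. F z y \<partial>lborel) = (\<integral>y. F z' y \<partial>lborel)"
proof (cases "z = z'")
  case False
  define n where "n = z - z'"
  have n0: "n \<bullet> n \<noteq> 0" using False by (simp add: n_def)
  define T where "T x = x - (2 * (x \<bullet> n) / (n \<bullet> n)) *\<^sub>R n" for x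
  have lin: "linear T"
    by (rule linearI) (simp_all add: T_def inner_add_left algebra_simps add_divide_distrib)
  have iso: "norm (T x) = norm x" for x
    unfolding norm_eq using n0
    by (simp add: T_def inner_diff_left inner_diff_right inner_commute power2_eq_square)
  have TT: "T (T x) = x" for x
    using n0 by (simp add: T_def inner_diff_left algebra_simps)
  have "2 * (z \<bullet> n) = n \<bullet> n"
    using z by (simp add: n_def norm_eq inner_diff_left inner_diff_right inner_commute)
  then have Tz: "T z = z'" using n0 by (simp add: T_def n_def)
  have [measurable]: "T \<in> borel_measurable borel"
    by (intro borel_measurable_continuous_onI linear_continuous_on linear_conv_bounded_linear[THEN iffD1] lin)
  have "(\<integral>y. F z' y \<partial>lborel) = (\<integral>y. F z' y \<partial>distr lborel borel T)"
    by (simp add: lborel_distr_isometry[OF lin iso TT])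
  also have "\<dots> = (\<integral>y. F (T z) (T y) \<partial>lborel)"
    by (subst integral_distr) (auto simp: Tz)
  also have "\<dots> = (\<integral>y. F z y \<partial>lborel)" using inv[OF lin iso] by simp
  finally show ?thesis by simp
qed simp

section \<open>Power weights\<close>

lemma emeasure_ball_powr:
  "R \<ge> 0 \<Longrightarrow> emeasure lborel (ball (x::'a::euclidean_space) R)
     = ennreal (measure lborel (ball (0::'a) 1) * R powr real DIM('a))"
proof -
  assume "R \<ge> 0"
  have "emeasure lborel (ball x R) = ennreal (measure lborel (ball x R))"
    using emeasure_bounded_finite[of "ball x R"] by (intro emeasure_eq_ennreal_measure) auto
  also have "measure lborel (ball x R) = R ^ DIM('a) * measure lborel (ball (0::'a) 1)"
    using content_ball_conv_unit_ball[of R x] \<open>R \<ge> 0\<close> by simp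
  also have "R ^ DIM('a) = R powr real DIM('a)" using \<open>R \<ge> 0\<close> by (simp add: powr_realpow')
  finally show ?thesis by (simp add: mult.commute)
qed

lemma ennreal_le_suminf: "f n \<le> (\<Sum>n. f n :: ennreal)"
  using sum_le_suminf[of f "{n}"] by simp

lemma suminf_geometric_ennreal:
  assumes "0 \<le> c" "0 \<le> q" "q < 1"
  shows "(\<Sum>n. ennreal (c * q ^ n)) = ennreal (c / (1 - q))"
proof (subst suminf_ennreal2)
  show "summable (\<lambda>n. c * q ^ n)" using assms by (intro summable_mult summable_geometric) auto
  have "(\<lambda>n. c * q ^ n) sums (c * (1 / (1 - q)))"
    using assms by (intro sums_mult geometric_sums) auto
  then show "ennreal (\<Sum>n. c * q ^ n) = ennreal (c / (1 - q))" by (simp add: sums_iff)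
qed (use assms in auto)

lemma measure_ball_powr:
  "R \<ge> 0 \<Longrightarrow> measure lborel (ball (x::'a::euclidean_space) R) = measure lborel (ball (0::'a) 1) * R powr real DIM('a)"
  using emeasure_ball_powr[of R x] by (simp add: measure_def)

lemma integrable_indicator_ball: "integrable lborel (indicator (ball (x::'a::euclidean_space) r) :: 'a \<Rightarrow> real)"
  using emeasure_bounded_finite[of "ball x r"] by (intro integrable_real_indicator) auto

lemma integrable_of_nn_integral_le:
  fixes f :: "'b \<Rightarrow> real"
  assumes [measurable]: "f \<in> borel_measurable M" and f: "\<And>x. f x \<ge> 0"
    and le: "(\<integral>\<^sup>+x. ennreal (f x) \<partial>M) \<le> ennreal K" and K: "K \<ge> 0"
  shows "integrable M f" and "(\<integral>x. f x \<partial>M) \<le> K"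
proof -
  show i: "integrable M f" using le f by (intro integrableI_bounded) (auto simp: le_less_trans)
  show "(\<integral>x. f x \<partial>M) \<le> K" using le i f K by (subst (asm) nn_integral_eq_integral) (auto simp: ennreal_le_iff)
qed

text \<open>On an annulus \<open>r \<le> |y| < 2 r\<close> the weight \<open>|y|\<^sup>\<tau>\<^sup>-\<^sup>N\<close> is comparable to \<open>r\<^sup>\<tau>\<^sup>-\<^sup>N\<close>, and the volume of
  the annulus to \<open>r\<^sup>N\<close>. For dyadic radii the sum is geometric.\<close>

lemma nn_integral_power_annuli:
  fixes S :: "'a::euclidean_space set" and \<tau> :: real
  defines "N \<equiv> real DIM('a)"
  defines "C \<equiv> measure lborel (ball (0::'a) 1) * 2 powr N * max 1 (2 powr (\<tau> - N))"
  assumes r: "\<And>n::nat. r n > 0" and cov: "\<And>y. y \<in> S \<Longrightarrow> y \<noteq> 0 \<Longrightarrow> \<exists>n. r n \<le> norm y \<and> norm y < 2 * r n"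
  shows "(\<integral>\<^sup>+y. ennreal (norm y powr (\<tau> - N) * indicator S y) \<partial>lborel) \<le> (\<Sum>n. ennreal (C * r n powr \<tau>))"
proof -
  define B where "B = measure lborel (ball (0::'a) 1)"
  define D where "D = max 1 (2 powr (\<tau> - N))"
  have BD: "B \<ge> 0" "D \<ge> 0" by (auto simp: B_def D_def)
  define A where "A n = {y::'a. r n \<le> norm y \<and> norm y < 2 * r n}" for n
  have [measurable]: "A n \<in> sets borel" for n unfolding A_def by measurable
  have "(\<integral>\<^sup>+y. ennreal (norm y powr (\<tau> - N) * indicator S y) \<partial>lborel)
      \<le> (\<integral>\<^sup>+y. (\<Sum>n. ennreal (D * r n powr (\<tau> - N)) * indicator (A n) y) \<partial>lborel)"
  proof (rule nn_integral_mono)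
    fix y :: 'a
    show "ennreal (norm y powr (\<tau> - N) * indicator S y) \<le> (\<Sum>n. ennreal (D * r n powr (\<tau> - N)) * indicator (A n) y)"
    proof (cases "y \<in> S \<and> y \<noteq> 0")
      case True
      then obtain n where n: "y \<in> A n" using cov by (auto simp: A_def)
      have "norm y powr (\<tau> - N) \<le> D * r n powr (\<tau> - N)"
      proof (cases "\<tau> \<ge> N")
        case True
        have "norm y powr (\<tau> - N) \<le> (2 * r n) powr (\<tau> - N)" using n True by (intro powr_mono2) (auto simp: A_def)
        also have "\<dots> \<le> D * r n powr (\<tau> - N)"
          unfolding powr_mult by (intro mult_right_mono) (auto simp: D_def)
        finally show ?thesis .
      next
        case False
        have "norm y powr (\<tau> - N) \<le> 1 * r n powr (\<tau> - N)" using n r[of n] False by (auto simp: A_def intro: powr_mono2')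
        also have "\<dots> \<le> D * r n powr (\<tau> - N)" by (intro mult_right_mono) (auto simp: D_def)
        finally show ?thesis .
      qed
      then have "ennreal (norm y powr (\<tau> - N) * indicator S y) \<le> ennreal (D * r n powr (\<tau> - N)) * indicator (A n) y"
        using n by (auto simp: indicator_def intro: ennreal_leI)
      also have "\<dots> \<le> (\<Sum>n. ennreal (D * r n powr (\<tau> - N)) * indicator (A n) y)" by (rule ennreal_le_suminf)
      finally show ?thesis .
    qed auto
  qed
  also have "\<dots> = (\<Sum>n. ennreal (D * r n powr (\<tau> - N)) * emeasure lborel (A n))"
    by (subst nn_integral_suminf) (auto simp: nn_integral_cmult_indicator)
  also have "\<dots> \<le> (\<Sum>n. ennreal (C * r n powr \<tau>))"
  proof (rule suminf_le)
    fix n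
    have "emeasure lborel (A n) \<le> emeasure lborel (ball (0::'a) (2 * r n))"
      by (rule emeasure_mono) (auto simp: A_def)
    also have "\<dots> = ennreal (B * (2 * r n) powr N)"
      using r[of n] by (subst emeasure_ball_powr) (auto simp: B_def N_def)
    finally have "ennreal (D * r n powr (\<tau> - N)) * emeasure lborel (A n)
        \<le> ennreal (D * r n powr (\<tau> - N)) * ennreal (B * (2 * r n) powr N)" by (rule mult_left_mono) auto
    also have "\<dots> = ennreal (B * 2 powr N * D * (r n powr (\<tau> - N) * r n powr N))"
      using BD r[of n] by (subst ennreal_mult[symmetric]) (auto simp: powr_mult ac_simps)
    also have "r n powr (\<tau> - N) * r n powr N = r n powr \<tau>" by (simp add: powr_add[symmetric])
    finally show "ennreal (D * r n powr (\<tau> - N)) * emeasure lborel (A n) \<le> ennreal (C * r n powr \<tau>)"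
      by (simp add: C_def B_def D_def)
  qed auto
  finally show ?thesis .
qed

lemma dyadic_scale:
  fixes t :: real assumes "t \<ge> 1"
  shows "\<exists>n. 2 ^ n \<le> t \<and> t < 2 * 2 ^ n"
proof -
  obtain n where n: "t < 2 ^ n" using real_arch_pow[of 2 t] by auto
  define m where "m = (LEAST n. t < 2 ^ n)"
  have m: "t < 2 ^ m" unfolding m_def by (rule LeastI, rule n)
  have "m \<noteq> 0" using m assms by (cases m) auto
  then obtain j where j: "m = Suc j" by (cases m) auto
  have "\<not> t < 2 ^ j" using not_less_Least[of j "\<lambda>n. t < 2 ^ n"] j m_def by auto
  then show ?thesis using m j by (intro exI[of _ j]) auto
qed

lemma power_integral_outside:
  fixes \<sigma> :: real assumes \<sigma>: "\<sigma> > 0"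
  shows "\<exists>C\<ge>0. \<forall>R>0. integrable lborel (\<lambda>y::'a::euclidean_space. norm y powr (-(real DIM('a) + \<sigma>)) * indicator (- ball 0 R) y)
     \<and> (LINT y|lborel. norm (y::'a) powr (-(real DIM('a) + \<sigma>)) * indicator (- ball 0 R) y) \<le> C * R powr (-\<sigma>)"
proof -
  define N where "N = real DIM('a)"
  define q where "q = 2 powr (-\<sigma>)"
  have q: "0 \<le> q" "q < 1" using \<sigma> by (auto simp: q_def powr_less_one)
  define C where "C = measure lborel (ball (0::'a) 1) * 2 powr N * max 1 (2 powr (-\<sigma> - N))"
  have C: "C \<ge> 0" by (simp add: C_def)
  have [measurable]: "ball (0::'a) R \<in> sets borel" for R by auto
  show ?thesis unfolding N_def[symmetric]
  proof (intro exI[of _ "C / (1 - q)"] conjI allI impI)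
    show "C / (1 - q) \<ge> 0" using C q by simp
    fix R :: real assume R: "R > 0"
    have pw: "(2 ^ n * R) powr (-\<sigma>) = R powr (-\<sigma>) * q ^ n" for n
      using R by (simp add: powr_mult q_def powr_realpow[symmetric] powr_powr mult.commute)
    have "(\<integral>\<^sup>+y. ennreal (norm (y::'a) powr (-\<sigma> - N) * indicator (- ball 0 R) y) \<partial>lborel) \<le> (\<Sum>n. ennreal (C * (2 ^ n * R) powr (-\<sigma>)))"
      unfolding C_def N_def
    proof (rule nn_integral_power_annuli)
      fix y :: 'a assume "y \<in> - ball 0 R"
      then show "\<exists>n. 2 ^ n * R \<le> norm y \<and> norm y < 2 * (2 ^ n * R)"
        using dyadic_scale[of "norm y / R"] R by (auto simp: field_simps)
    qed (use R in auto)
    also have "\<dots> = ennreal (C / (1 - q) * R powr (-\<sigma>))"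
      unfolding pw mult.assoc[symmetric] using C q by (subst suminf_geometric_ennreal) auto
    also have "-\<sigma> - N = -(N + \<sigma>)" by simp
    finally have le: "(\<integral>\<^sup>+y. ennreal (norm (y::'a) powr (-(N + \<sigma>)) * indicator (- ball 0 R) y) \<partial>lborel) \<le> ennreal (C / (1 - q) * R powr (-\<sigma>))" .
    show "integrable lborel (\<lambda>y::'a. norm y powr (-(N + \<sigma>)) * indicator (- ball 0 R) y)"
      by (rule integrable_of_nn_integral_le(1)[OF _ _ le]) (use C q in auto)
    show "(LINT y|lborel. norm (y::'a) powr (-(N + \<sigma>)) * indicator (- ball 0 R) y) \<le> C / (1 - q) * R powr (-\<sigma>)"
      by (rule integrable_of_nn_integral_le(2)[OF _ _ le]) (use C q in auto)
  qed
qed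

lemma power_integral_inside:
  fixes \<sigma> :: real assumes \<sigma>: "\<sigma> > 0"
  shows "\<exists>C\<ge>0. \<forall>R>0. integrable lborel (\<lambda>y::'a::euclidean_space. norm y powr (\<sigma> - real DIM('a)) * indicator (ball 0 R) y)
     \<and> (LINT y|lborel. norm (y::'a) powr (\<sigma> - real DIM('a)) * indicator (ball 0 R) y) \<le> C * R powr \<sigma>"
proof -
  define N where "N = real DIM('a)"
  define q where "q = 2 powr (-\<sigma>)"
  have q: "0 \<le> q" "q < 1" using \<sigma> by (auto simp: q_def powr_less_one)
  define C where "C = measure lborel (ball (0::'a) 1) * 2 powr N * max 1 (2 powr (\<sigma> - N))"
  have C: "C \<ge> 0" by (simp add: C_def)
  have [measurable]: "ball (0::'a) R \<in> sets borel" for R by auto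
  show ?thesis unfolding N_def[symmetric]
  proof (intro exI[of _ "C / (1 - q)"] conjI allI impI)
    show "C / (1 - q) \<ge> 0" using C q by simp
    fix R :: real assume R: "R > 0"
    have pw: "(R / 2 ^ n) powr \<sigma> = R powr \<sigma> * q ^ n" for n
      using R by (simp add: powr_divide q_def powr_realpow[symmetric] powr_powr mult.commute powr_minus_divide)
    have "(\<integral>\<^sup>+y. ennreal (norm (y::'a) powr (\<sigma> - N) * indicator (ball 0 R) y) \<partial>lborel) \<le> (\<Sum>n. ennreal (C * (R / 2 ^ n) powr \<sigma>))"
      unfolding C_def N_def
    proof (rule nn_integral_power_annuli)
      fix y :: 'a assume y: "y \<in> ball 0 R" "y \<noteq> 0"
      then obtain n where n: "2 ^ n \<le> R / norm y" "R / norm y < 2 * 2 ^ n"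
        using dyadic_scale[of "R / norm y"] by (auto simp: field_simps)
      (* dyadic_scale gives R / 2^(n+1) < |y| <= R / 2^n; the right endpoint belongs to the previous annulus. *)
      then have "R / 2 ^ Suc n \<le> norm y \<and> norm y < 2 * (R / 2 ^ Suc n) \<or> norm y = R / 2 ^ n" using y R by (auto simp: field_simps)
      moreover have Rn: "R / 2 ^ n > 0" using R by simp
      moreover have "norm y = R / 2 ^ n \<Longrightarrow> R / 2 ^ n \<le> norm y \<and> norm y < 2 * (R / 2 ^ n)"
        using Rn by linarith
      ultimately show "\<exists>n. R / 2 ^ n \<le> norm y \<and> norm y < 2 * (R / 2 ^ n)" by blast
    qed (use R in auto)
    also have "\<dots> = ennreal (C / (1 - q) * R powr \<sigma>)"
      unfolding pw mult.assoc[symmetric] using C q by (subst suminf_geometric_ennreal) auto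
    finally have le: "(\<integral>\<^sup>+y. ennreal (norm (y::'a) powr (\<sigma> - N) * indicator (ball 0 R) y) \<partial>lborel) \<le> ennreal (C / (1 - q) * R powr \<sigma>)" .
    show "integrable lborel (\<lambda>y::'a. norm y powr (\<sigma> - N) * indicator (ball 0 R) y)"
      by (rule integrable_of_nn_integral_le(1)[OF _ _ le]) (use C q in auto)
    show "(LINT y|lborel. norm (y::'a) powr (\<sigma> - N) * indicator (ball 0 R) y) \<le> C / (1 - q) * R powr \<sigma>"
      by (rule integrable_of_nn_integral_le(2)[OF _ _ le]) (use C q in auto)
  qed
qed

section \<open>Square integrable functions\<close>

definition square_integrable :: "'b measure \<Rightarrow> ('b \<Rightarrow> real) \<Rightarrow> bool" where
  "square_integrable M f \<longleftrightarrow> f \<in> borel_measurable M \<and> integrable M (\<lambda>x. (f x)\<^sup>2)"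

lemma square_integrable_measurable[measurable_dest]: "square_integrable M f \<Longrightarrow> f \<in> borel_measurable M"
  by (simp add: square_integrable_def)

lemma square_integrable_mult:
  assumes f: "square_integrable M f" and g: "square_integrable M g"
  shows "integrable M (\<lambda>x. f x * g x)"
proof (rule Bochner_Integration.integrable_bound)
  show "integrable M (\<lambda>x. (f x)\<^sup>2 + (g x)\<^sup>2)"
    using f g by (auto simp: square_integrable_def)
  show "(\<lambda>x. f x * g x) \<in> borel_measurable M" using f g by (auto simp: square_integrable_def)
  have "\<bar>a * b\<bar> \<le> \<bar>a\<^sup>2 + b\<^sup>2\<bar>" for a b :: real
  proof -
    have "\<bar>a\<bar> * \<bar>b\<bar> \<le> 2 * \<bar>a\<bar> * \<bar>b\<bar>" by simp
    also have "\<dots> \<le> a\<^sup>2 + b\<^sup>2" using sum_squares_bound[of "\<bar>a\<bar>" "\<bar>b\<bar>"] by simp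
    finally show ?thesis by (simp add: abs_mult)
  qed
  then show "AE x in M. norm (f x * g x) \<le> norm ((f x)\<^sup>2 + (g x)\<^sup>2)" by auto
qed

lemma square_integrable_add:
  assumes f: "square_integrable M f" and g: "square_integrable M g"
  shows "square_integrable M (\<lambda>x. f x + g x)"
proof -
  have "integrable M (\<lambda>x. (f x)\<^sup>2 + (g x)\<^sup>2 + 2 * (f x * g x))"
    using f g square_integrable_mult[OF f g] by (auto simp: square_integrable_def)
  then show ?thesis using f g by (auto simp: square_integrable_def power2_sum mult.assoc)
qed

lemma square_integrable_cmult: "square_integrable M f \<Longrightarrow> square_integrable M (\<lambda>x. c * f x)"
  by (auto simp: square_integrable_def power_mult_distrib)

lemma square_integrable_diff:
  assumes f: "square_integrable M f" and g: "square_integrable M g"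
  shows "square_integrable M (\<lambda>x. f x - g x)"
  using square_integrable_add[OF f square_integrable_cmult[OF g, of "-1"]] by simp

lemma square_integrable_iff_nn_integral:
  "f \<in> borel_measurable M \<Longrightarrow>
     square_integrable M f \<longleftrightarrow> (\<integral>\<^sup>+x. ennreal ((f x)\<^sup>2) \<partial>M) < \<infinity>"
  by (simp add: square_integrable_def integrable_iff_bounded)

lemma square_integrable_bound:
  assumes "square_integrable M f" "g \<in> borel_measurable M" "AE x in M. \<bar>g x\<bar> \<le> \<bar>f x\<bar>"
  shows "square_integrable M g"
  unfolding square_integrable_def
proof
  show "integrable M (\<lambda>x. (g x)\<^sup>2)"
    by (rule Bochner_Integration.integrable_bound[of M "\<lambda>x. (f x)\<^sup>2"])
       (use assms in \<open>auto simp: square_integrable_def abs_le_square_iff elim!: eventually_mono\<close>)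
qed fact

lemma integrable_bounded_mult:
  fixes f g :: "'b \<Rightarrow> real"
  assumes f: "integrable M f" and [measurable]: "g \<in> borel_measurable M" and g: "\<And>x. \<bar>g x\<bar> \<le> c"
  shows "integrable M (\<lambda>x. g x * f x)"
proof (rule Bochner_Integration.integrable_bound)
  show "integrable M (\<lambda>x. c * f x)" using f by simp
  show "(\<lambda>x. g x * f x) \<in> borel_measurable M" using f by measurable
  show "AE x in M. norm (g x * f x) \<le> norm (c * f x)"
  proof (intro AE_I2)
    fix x
    have "\<bar>g x\<bar> \<le> \<bar>c\<bar>" using g[of x] by linarith
    then show "norm (g x * f x) \<le> norm (c * f x)" by (simp add: abs_mult mult_right_mono)
  qed
qed

lemma square_integrable_of_bounded:
  assumes f: "integrable M f" and c: "\<And>x. \<bar>f x\<bar> \<le> c"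
  shows "square_integrable M f"
proof -
  have m: "f \<in> borel_measurable M" using f by (rule borel_measurable_integrable)
  have "integrable M (\<lambda>x. f x * f x)" by (rule integrable_bounded_mult[OF f m c])
  then show ?thesis using m by (simp add: square_integrable_def power2_eq_square)
qed

text \<open>The discriminant of the nonnegative quadratic \<open>t \<mapsto> \<integral> (t f + g)\<^sup>2\<close>.\<close>

lemma cauchy_schwarz_integral:
  assumes f: "square_integrable M f" and g: "square_integrable M g"
  shows "(\<integral>x. f x * g x \<partial>M)\<^sup>2 \<le> (\<integral>x. (f x)\<^sup>2 \<partial>M) * (\<integral>x. (g x)\<^sup>2 \<partial>M)"
proof -
  have q: "0 \<le> (\<integral>x. (f x)\<^sup>2 \<partial>M) * t\<^sup>2 + 2 * (\<integral>x. f x * g x \<partial>M) * t + (\<integral>x. (g x)\<^sup>2 \<partial>M)" (is "0 \<le> ?q t") for t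
  proof -
    have "0 \<le> (\<integral>x. (t * f x + g x)\<^sup>2 \<partial>M)" by simp
    also have "(\<lambda>x. (t * f x + g x)\<^sup>2) = (\<lambda>x. t\<^sup>2 * (f x)\<^sup>2 + (2 * t) * (f x * g x) + (g x)\<^sup>2)"
      by (auto simp: power2_eq_square algebra_simps)
    also have "(\<integral>x. t\<^sup>2 * (f x)\<^sup>2 + (2 * t) * (f x * g x) + (g x)\<^sup>2 \<partial>M)
        = t\<^sup>2 * (\<integral>x. (f x)\<^sup>2 \<partial>M) + (2 * t) * (\<integral>x. f x * g x \<partial>M) + (\<integral>x. (g x)\<^sup>2 \<partial>M)"
      using f g square_integrable_mult[OF f g] by (subst Bochner_Integration.integral_add, auto simp: square_integrable_def)+
    finally show ?thesis by (simp add: mult.commute mult.left_commute)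
  qed
  define A B C where "A = (\<integral>x. (f x)\<^sup>2 \<partial>M)" and "B = (\<integral>x. f x * g x \<partial>M)" and "C = (\<integral>x. (g x)\<^sup>2 \<partial>M)"
  have A0: "A \<ge> 0" "C \<ge> 0" by (auto simp: A_def C_def)
  have q': "0 \<le> A * t\<^sup>2 + 2 * B * t + C" for t using q[of t] by (simp add: A_def B_def C_def)
  have "B\<^sup>2 \<le> A * C"
  proof (cases "A = 0")
    case True
    have "B = 0"
    proof (rule ccontr)
      assume "B \<noteq> 0"
      then show False using q'[of "- (C + 1) / (2 * B)"] True by (simp add: field_simps)
    qed
    then show ?thesis using True by simp
  next
    case False
    then have "A > 0" using A0 by simp
    have "0 \<le> A * (A * (- B / A)\<^sup>2 + 2 * B * (- B / A) + C)"
      using q'[of "- B / A"] \<open>A > 0\<close> by (intro mult_nonneg_nonneg) auto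
    also have "\<dots> = A * C - B\<^sup>2" using \<open>A > 0\<close> by (simp add: field_simps power2_eq_square)
    finally show ?thesis by simp
  qed
  then show ?thesis by (simp add: A_def B_def C_def)
qed

text \<open>Completeness. Along a subsequence with \<open>\<integral>(f\<^sub>j\<^sub>+\<^sub>1 - f\<^sub>j)\<^sup>2 \<le> 16\<^sup>-\<^sup>j\<close> the sum of \<open>4\<^sup>j (f\<^sub>j\<^sub>+\<^sub>1 - f\<^sub>j)\<^sup>2\<close> is integrable, so
  \<open>|f\<^sub>j\<^sub>+\<^sub>1 - f\<^sub>j|\<close> is almost everywhere dominated by a multiple of \<open>2\<^sup>-\<^sup>j\<close>; the limit of the
  subsequence is the limit in the mean by Fatou's lemma.\<close>

lemma riesz_fischer:
  fixes f :: "nat \<Rightarrow> 'b \<Rightarrow> real"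
  assumes f: "\<And>n. square_integrable M (f n)"
    and cauchy: "\<And>e. e > 0 \<Longrightarrow> \<exists>n0. \<forall>m\<ge>n0. \<forall>n\<ge>n0. (\<integral>x. (f m x - f n x)\<^sup>2 \<partial>M) < e"
  shows "\<exists>g. square_integrable M g \<and> (\<lambda>n. \<integral>x. (f n x - g x)\<^sup>2 \<partial>M) \<longlonglongrightarrow> 0"
proof -
  have [measurable]: "f n \<in> borel_measurable M" for n using f[of n] by (simp add: square_integrable_def)
  have sqd: "integrable M (\<lambda>x. (f m x - f n x)\<^sup>2)" for m n
    using square_integrable_diff[OF f f] by (auto simp: square_integrable_def)
  have "\<forall>j. \<exists>n0. \<forall>m\<ge>n0. \<forall>n\<ge>n0. (\<integral>x. (f m x - f n x)\<^sup>2 \<partial>M) < (1/16)^j"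
    using cauchy by simp
  then obtain n0 where n0: "\<And>j m n. m \<ge> n0 j \<Longrightarrow> n \<ge> n0 j \<Longrightarrow> (\<integral>x. (f m x - f n x)\<^sup>2 \<partial>M) < (1/16)^j"
    by metis
  (* A running sum, so that both r j and r (Suc j) are at least n0 j; the summand j makes r unbounded. *)
  define r where "r j = (\<Sum>i\<le>j. n0 i) + j" for j
  have r: "r j \<ge> n0 j" "r (Suc j) \<ge> n0 j" "r j \<ge> j" for j
  proof -
    have "n0 j \<le> (\<Sum>i\<le>j. n0 i)" by (rule member_le_sum) auto
    then show "r j \<ge> n0 j" "r (Suc j) \<ge> n0 j" "r j \<ge> j" by (auto simp: r_def)
  qed
  define D where "D j x = f (r (Suc j)) x - f (r j) x" for j x
  have [measurable]: "D j \<in> borel_measurable M" for j by (simp add: D_def[abs_def])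
  have D: "(\<integral>\<^sup>+x. ennreal ((D j x)\<^sup>2) \<partial>M) \<le> ennreal ((1/16)^j)" for j
    using n0[OF r(2)[of j] r(1)[of j]] sqd
    by (subst nn_integral_eq_integral) (auto simp: D_def intro!: ennreal_leI)
  have "(\<integral>\<^sup>+x. (\<Sum>j. ennreal (4^j * (D j x)\<^sup>2)) \<partial>M) = (\<Sum>j. \<integral>\<^sup>+x. ennreal (4^j * (D j x)\<^sup>2) \<partial>M)"
    by (rule nn_integral_suminf) measurable
  also have "\<dots> \<le> (\<Sum>j. ennreal (1 * (1/4)^j))"
  proof (rule suminf_le)
    fix j
    have "(\<integral>\<^sup>+x. ennreal (4^j * (D j x)\<^sup>2) \<partial>M) = ennreal (4^j) * (\<integral>\<^sup>+x. ennreal ((D j x)\<^sup>2) \<partial>M)"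
      by (subst nn_integral_cmult[symmetric]) (auto simp: ennreal_mult)
    also have "\<dots> \<le> ennreal (4^j) * ennreal ((1/16)^j)" by (intro mult_left_mono D) auto
    also have "\<dots> = ennreal (1 * (1/4)^j)"
      by (subst ennreal_mult[symmetric]) (auto simp: power_mult_distrib[symmetric])
    finally show "(\<integral>\<^sup>+x. ennreal (4^j * (D j x)\<^sup>2) \<partial>M) \<le> ennreal (1 * (1/4)^j)" .
  qed auto
  also have "\<dots> < \<infinity>" by (subst suminf_geometric_ennreal) auto
  finally have "AE x in M. (\<Sum>j. ennreal (4^j * (D j x)\<^sup>2)) \<noteq> \<infinity>"
    by (intro nn_integral_PInf_AE) auto
  then have conv: "AE x in M. convergent (\<lambda>j. f (r j) x)"
  proof (rule eventually_mono)
    fix x assume fin: "(\<Sum>j. ennreal (4^j * (D j x)\<^sup>2)) \<noteq> \<infinity>"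
    define S where "S = enn2real (\<Sum>j. ennreal (4^j * (D j x)\<^sup>2))"
    have S: "(\<Sum>j. ennreal (4^j * (D j x)\<^sup>2)) = ennreal S"
      using fin unfolding S_def by (simp add: less_top)
    have S0: "S \<ge> 0" by (simp add: S_def)
    have bd: "norm (D j x) \<le> sqrt S * (1/2)^j" for j
    proof -
      have "ennreal (4^j * (D j x)\<^sup>2) \<le> ennreal S" unfolding S[symmetric] by (rule ennreal_le_suminf)
      then have "4^j * (D j x)\<^sup>2 \<le> S" using S0 by simp
      moreover have pow4: "(2^j)\<^sup>2 = (4::real)^j"
        by (simp add: power2_eq_square power_mult_distrib[symmetric])
      ultimately have "(2^j * \<bar>D j x\<bar>)\<^sup>2 \<le> (sqrt S)\<^sup>2" using S0
        by (simp add: power_mult_distrib)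
      then have "2^j * \<bar>D j x\<bar> \<le> sqrt S" by (rule power2_le_imp_le) (use S0 in auto)
      then show ?thesis by (simp add: field_simps)
    qed
    have "summable (\<lambda>j. D j x)"
      by (rule summable_comparison_test'[of "\<lambda>j. sqrt S * (1/2)^j" 0])
         (use bd in \<open>auto intro!: summable_mult summable_geometric\<close>)
    then have "convergent (\<lambda>n. \<Sum>j<n. D j x)" by (simp add: summable_iff_convergent)
    moreover have "(\<Sum>j<n. D j x) = f (r n) x - f (r 0) x" for n
      unfolding D_def by (rule sum_lessThan_telescope)
    ultimately have "convergent (\<lambda>n. f (r n) x - f (r 0) x)" by simp
    then have "convergent (\<lambda>n. (f (r n) x - f (r 0) x) + f (r 0) x)"
      by (intro convergent_add convergent_const)
    then show "convergent (\<lambda>j. f (r j) x)" by simp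
  qed
  define g where "g x = lim (\<lambda>j. f (r j) x)" for x
  have g[measurable]: "g \<in> borel_measurable M" unfolding g_def[abs_def] by measurable
  have lim: "AE x in M. (\<lambda>j. f (r j) x) \<longlonglongrightarrow> g x"
    using conv by eventually_elim (simp add: g_def convergent_LIMSEQ_iff)
  have key: "(\<integral>\<^sup>+x. ennreal ((f m x - g x)\<^sup>2) \<partial>M) \<le> ennreal e"
    if m: "\<And>n. n \<ge> N \<Longrightarrow> (\<integral>x. (f m x - f n x)\<^sup>2 \<partial>M) \<le> e" for m N e
  proof -
    have "(\<integral>\<^sup>+x. ennreal ((f m x - g x)\<^sup>2) \<partial>M)
        = (\<integral>\<^sup>+x. liminf (\<lambda>j. ennreal ((f m x - f (r j) x)\<^sup>2)) \<partial>M)"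
    proof (rule nn_integral_cong_AE)
      show "AE x in M. ennreal ((f m x - g x)\<^sup>2) = liminf (\<lambda>j. ennreal ((f m x - f (r j) x)\<^sup>2))"
        using lim
      proof eventually_elim
        case (elim x)
        have "(\<lambda>j. ennreal ((f m x - f (r j) x)\<^sup>2)) \<longlonglongrightarrow> ennreal ((f m x - g x)\<^sup>2)"
          by (intro tendsto_ennrealI tendsto_power tendsto_diff tendsto_const elim)
        then show ?case by (intro lim_imp_Liminf[symmetric]) auto
      qed
    qed
    also have "\<dots> \<le> liminf (\<lambda>j. \<integral>\<^sup>+x. ennreal ((f m x - f (r j) x)\<^sup>2) \<partial>M)"
      by (rule nn_integral_liminf) measurable
    also have "\<dots> \<le> liminf (\<lambda>j. ennreal e)"
    proof (rule Liminf_mono)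
      show "\<forall>\<^sub>F j in sequentially. (\<integral>\<^sup>+x. ennreal ((f m x - f (r j) x)\<^sup>2) \<partial>M) \<le> ennreal e"
        using eventually_ge_at_top[of N]
      proof eventually_elim
        case (elim j)
        then have "r j \<ge> N" using r(3)[of j] by simp
        then show ?case using m sqd by (subst nn_integral_eq_integral) (auto intro!: ennreal_leI)
      qed
    qed
    also have "\<dots> = ennreal e" by (simp add: Liminf_const)
    finally show ?thesis .
  qed
  obtain N1 where N1: "\<And>m n. m \<ge> N1 \<Longrightarrow> n \<ge> N1 \<Longrightarrow> (\<integral>x. (f m x - f n x)\<^sup>2 \<partial>M) < 1"
    using cauchy[of 1] by auto
  have "(\<integral>\<^sup>+x. ennreal ((f N1 x - g x)\<^sup>2) \<partial>M) \<le> ennreal 1"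
    using N1 by (intro key[of N1]) (auto intro: less_imp_le)
  then have "square_integrable M (\<lambda>x. f N1 x - g x)"
    by (subst square_integrable_iff_nn_integral) (auto simp: le_less_trans)
  from square_integrable_diff[OF f[of N1] this] have sg: "square_integrable M g" by simp
  have "(\<lambda>n. \<integral>x. (f n x - g x)\<^sup>2 \<partial>M) \<longlonglongrightarrow> 0"
  proof (rule LIMSEQ_I)
    fix e :: real assume e: "e > 0"
    obtain N where N: "\<And>m n. m \<ge> N \<Longrightarrow> n \<ge> N \<Longrightarrow> (\<integral>x. (f m x - f n x)\<^sup>2 \<partial>M) < e / 2"
      using cauchy[of "e/2"] e by auto
    show "\<exists>no. \<forall>n\<ge>no. norm ((\<integral>x. (f n x - g x)\<^sup>2 \<partial>M) - 0) < e"
    proof (intro exI allI impI)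
      fix n assume "n \<ge> N"
      then have "(\<integral>\<^sup>+x. ennreal ((f n x - g x)\<^sup>2) \<partial>M) \<le> ennreal (e / 2)"
        using N by (intro key[of N]) (auto intro: less_imp_le)
      moreover have "(\<integral>\<^sup>+x. ennreal ((f n x - g x)\<^sup>2) \<partial>M) = ennreal (\<integral>x. (f n x - g x)\<^sup>2 \<partial>M)"
        using square_integrable_diff[OF f sg] by (intro nn_integral_eq_integral) (auto simp: square_integrable_def)
      ultimately show "norm ((\<integral>x. (f n x - g x)\<^sup>2 \<partial>M) - 0) < e" using e by simp
    qed
  qed
  then show ?thesis using sg by blast
qed

lemma integral_tendsto_mean_square:
  assumes g: "square_integrable M g" and f: "\<And>n. square_integrable M (f n)"
    and lim: "(\<lambda>n::nat. \<integral>x. (f n x - g x)\<^sup>2 \<partial>M) \<longlonglongrightarrow> 0" and h: "square_integrable M h"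
  shows "(\<lambda>n. \<integral>x. h x * f n x \<partial>M) \<longlonglongrightarrow> (\<integral>x. h x * g x \<partial>M)"
    and "(\<lambda>n. \<integral>x. (f n x)\<^sup>2 \<partial>M) \<longlonglongrightarrow> (\<integral>x. (g x)\<^sup>2 \<partial>M)"
proof -
  have weak: "(\<lambda>n. \<integral>x. h x * (f n x - g x) \<partial>M) \<longlonglongrightarrow> 0" if h: "square_integrable M h" for h
  proof -
    have "(\<lambda>n. (\<integral>x. h x * (f n x - g x) \<partial>M)\<^sup>2) \<longlonglongrightarrow> 0"
    proof (rule tendsto_sandwich[OF _ _ tendsto_const])
      show "\<forall>\<^sub>F n in sequentially. (\<integral>x. h x * (f n x - g x) \<partial>M)\<^sup>2
          \<le> (\<integral>x. (h x)\<^sup>2 \<partial>M) * (\<integral>x. (f n x - g x)\<^sup>2 \<partial>M)"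
        by (intro always_eventually allI cauchy_schwarz_integral h square_integrable_diff f g)
      show "(\<lambda>n. (\<integral>x. (h x)\<^sup>2 \<partial>M) * (\<integral>x. (f n x - g x)\<^sup>2 \<partial>M)) \<longlonglongrightarrow> 0"
        by (rule tendsto_mult_right_zero[OF lim])
    qed auto
    from tendsto_real_sqrt[OF this] show ?thesis by (simp add: tendsto_rabs_zero_iff)
  qed
  have "(\<integral>x. h x * f n x \<partial>M) = (\<integral>x. h x * (f n x - g x) \<partial>M) + (\<integral>x. h x * g x \<partial>M)" for n
    using square_integrable_mult[OF h f] square_integrable_mult[OF h g] by (simp add: right_diff_distrib)
  then show "(\<lambda>n. \<integral>x. h x * f n x \<partial>M) \<longlonglongrightarrow> (\<integral>x. h x * g x \<partial>M)"
    using tendsto_add[OF weak[OF h] tendsto_const] by simp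
  have "(\<integral>x. (f n x)\<^sup>2 \<partial>M) = (\<integral>x. (f n x - g x)\<^sup>2 \<partial>M) + 2 * (\<integral>x. g x * (f n x - g x) \<partial>M) + (\<integral>x. (g x)\<^sup>2 \<partial>M)" for n
  proof -
    have d: "square_integrable M (\<lambda>x. f n x - g x)" by (intro square_integrable_diff f g)
    have "(\<integral>x. (f n x)\<^sup>2 \<partial>M) = (\<integral>x. (f n x - g x)\<^sup>2 + 2 * (g x * (f n x - g x)) + (g x)\<^sup>2 \<partial>M)"
      by (intro Bochner_Integration.integral_cong) (auto simp: power2_eq_square algebra_simps)
    then show ?thesis using d g square_integrable_mult[OF g d] by (simp add: square_integrable_def)
  qed
  then show "(\<lambda>n. \<integral>x. (f n x)\<^sup>2 \<partial>M) \<longlonglongrightarrow> (\<integral>x. (g x)\<^sup>2 \<partial>M)"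
    using tendsto_add[OF tendsto_add[OF lim tendsto_mult_right_zero[OF weak[OF g], of 2]] tendsto_const] by simp
qed

section \<open>Lebesgue points\<close>

text \<open>If \<open>f < a\<close> on \<open>S\<close> while arbitrarily small balls around each point of \<open>S\<close> have \<open>f\<close>-mean above
  \<open>b > a\<close>, then Vitali balls inside an open set barely larger than a cover \<open>A\<close> of \<open>S\<close> again cover \<open>S\<close>,
  and have volume at most \<open>a / b\<close> times that of \<open>A\<close>. Hence the infimum
  \<open>m\<close> of the volumes of Borel covers satisfies \<open>m \<le> (a / b) m\<close> and is zero. Covers are used because the
  condition on \<open>S\<close> involves uncountably many radii.\<close>

lemma negligible_large_means:
  fixes f :: "'a::euclidean_space \<Rightarrow> ennreal" and a b :: real
  assumes f[measurable]: "f \<in> borel_measurable borel" and ab: "0 < a" "a < b"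
    and fin: "(\<integral>\<^sup>+x. f x * indicator (ball 0 R) x \<partial>lborel) < \<infinity>"
  shows "negligible {x \<in> ball 0 R. f x < ennreal a \<and> (\<forall>d>0. \<exists>r. 0 < r \<and> r < d \<and>
           (\<integral>\<^sup>+y. f y * indicator (ball x r) y \<partial>lborel) > ennreal b * emeasure lborel (ball x r))}"
    (is "negligible ?S")
proof -
  define S where "S = ?S"
  define \<nu> where "\<nu> = density lborel f"
  (* The finite measure mu controls volume and the integral of f together, so one open set approximates both. *)
  define \<mu> where "\<mu> = density lborel (\<lambda>x. (f x + 1) * indicator (ball 0 R) x)"
  have [simp]: "sets \<mu> = sets borel" "space \<mu> = UNIV" "sets \<nu> = sets borel" by (auto simp: \<mu>_def \<nu>_def)
  have finball: "emeasure lborel (ball (0::'a) R) < \<infinity>"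
    using emeasure_bounded_finite[of "ball (0::'a) R"] by auto
  have [measurable]: "ball (0::'a) R \<in> sets borel" by auto
  have mu_eq: "emeasure \<mu> A = (\<integral>\<^sup>+x. f x * indicator (A \<inter> ball 0 R) x \<partial>lborel) + emeasure lborel (A \<inter> ball 0 R)"
    if [measurable]: "A \<in> sets borel" for A
  proof -
    have "emeasure \<mu> A = (\<integral>\<^sup>+x. f x * indicator (A \<inter> ball 0 R) x + indicator (A \<inter> ball 0 R) x \<partial>lborel)"
      unfolding \<mu>_def by (subst emeasure_density) (auto intro!: nn_integral_cong simp: indicator_def)
    also have "\<dots> = (\<integral>\<^sup>+x. f x * indicator (A \<inter> ball 0 R) x \<partial>lborel) + (\<integral>\<^sup>+x. indicator (A \<inter> ball 0 R) x \<partial>lborel)"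
      by (rule nn_integral_add) measurable
    finally show ?thesis by simp
  qed
  have mufin: "emeasure \<mu> A < \<infinity>" if A: "A \<in> sets borel" for A
  proof -
    have "emeasure \<mu> A \<le> emeasure \<mu> UNIV" using A by (intro emeasure_mono) auto
    also have "\<dots> < \<infinity>" using fin finball by (subst mu_eq) auto
    finally show ?thesis .
  qed
  interpret \<mu>: finite_measure \<mu> using mufin[of UNIV] by (intro finite_measureI) auto
  define G where "G = {A \<in> sets borel. S \<subseteq> A \<and> A \<subseteq> ball 0 R \<inter> {x. f x < ennreal a}}"
  have Gfin: "emeasure lborel A < \<infinity>" if "A \<in> G" for A
    using that finball emeasure_mono[of A "ball 0 R" lborel] by (auto simp: G_def intro: le_less_trans)
  have step: "\<exists>A2\<in>G. b * measure lborel A2 \<le> a * measure lborel A + \<eta>" if A: "A \<in> G" and "\<eta> > 0" for A \<eta>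
  proof -
    have [measurable]: "A \<in> sets borel" using A by (simp add: G_def)
    have AR: "A \<inter> ball 0 R = A" using A by (auto simp: G_def)
    have "emeasure \<mu> A = (INF U\<in>{U. A \<subseteq> U \<and> open U}. emeasure \<mu> U)"
      by (rule outer_regular) (use mufin[of UNIV] in auto)
    moreover have "emeasure \<mu> A < emeasure \<mu> A + ennreal \<eta>"
      using \<open>\<eta> > 0\<close>
      by (simp add: \<mu>.emeasure_eq_measure ennreal_plus[symmetric] ennreal_less_iff del: ennreal_plus)
    ultimately obtain U0 where U0: "A \<subseteq> U0" "open U0" "emeasure \<mu> U0 < emeasure \<mu> A + ennreal \<eta>"
      by (auto simp: INF_less_iff)
    define U where "U = U0 \<inter> ball 0 R"
    have U: "A \<subseteq> U" "open U" "U \<inter> ball 0 R = U" using U0 AR by (auto simp: U_def)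
    have [measurable]: "U \<in> sets borel" using U by auto
    have "emeasure \<mu> U \<le> emeasure \<mu> U0" by (rule emeasure_mono) (use U0 in \<open>auto simp: U_def\<close>)
    then have muU: "emeasure \<mu> U < emeasure \<mu> A + ennreal \<eta>" using U0 by auto
    have "emeasure \<mu> A + emeasure \<mu> (U - A) = emeasure \<mu> U"
      using U by (subst plus_emeasure) (auto intro!: arg_cong[where f="emeasure \<mu>"])
    then have "ennreal (measure \<mu> A + measure \<mu> (U - A)) < ennreal (measure \<mu> A + \<eta>)"
      using muU \<open>\<eta> > 0\<close> by (simp add: \<mu>.emeasure_eq_measure)
    then have muUA: "emeasure \<mu> (U - A) \<le> ennreal \<eta>"
      by (simp add: \<mu>.emeasure_eq_measure ennreal_less_iff ennreal_leI del: ennreal_plus)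
    have "(U - A) \<inter> ball 0 R = U - A" using U by blast
    then have "emeasure \<mu> (U - A) = emeasure \<nu> (U - A) + emeasure lborel (U - A)"
      using mu_eq[of "U - A"] by (simp add: \<nu>_def emeasure_density)
    then have d1: "emeasure \<nu> (U - A) \<le> ennreal \<eta>"
      using muUA by (metis add_increasing2 dual_order.trans order_refl zero_le)
    have d2: "emeasure \<nu> A \<le> ennreal a * emeasure lborel A"
    proof -
      have "emeasure \<nu> A = (\<integral>\<^sup>+x. f x * indicator A x \<partial>lborel)" unfolding \<nu>_def by (rule emeasure_density) auto
      also have "\<dots> \<le> (\<integral>\<^sup>+x. ennreal a * indicator A x \<partial>lborel)"
        using A by (intro nn_integral_mono) (auto simp: G_def indicator_def less_imp_le subset_iff)
      finally show ?thesis by (simp add: nn_integral_cmult_indicator)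
    qed
    have d3: "emeasure \<nu> U \<le> ennreal a * emeasure lborel A + ennreal \<eta>"
    proof -
      have "emeasure \<nu> A + emeasure \<nu> (U - A) = emeasure \<nu> U"
        using U by (subst plus_emeasure) (auto intro!: arg_cong[where f="emeasure \<nu>"])
      then show ?thesis using add_mono[OF d2 d1] by simp
    qed
    define K where "K = {(x, r). x \<in> S \<and> 0 < r \<and> ball x r \<subseteq> U \<and> ennreal b * emeasure lborel (ball x r) \<le> emeasure \<nu> (ball x r)}"
    have nuball: "emeasure \<nu> (ball x r) = (\<integral>\<^sup>+y. f y * indicator (ball x r) y \<partial>lborel)" for x r
      unfolding \<nu>_def by (rule emeasure_density) auto
    have "\<exists>i. i \<in> K \<and> x \<in> ball (fst i) (snd i) \<and> snd i < d" if x: "x \<in> S" and d: "d > 0" for x d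
    proof -
      have "x \<in> U" using x A U by (auto simp: G_def)
      then obtain d1 where d1: "d1 > 0" "ball x d1 \<subseteq> U" using U(2) by (meson openE)
      obtain r where r: "0 < r" "r < min d d1"
          "(\<integral>\<^sup>+y. f y * indicator (ball x r) y \<partial>lborel) > ennreal b * emeasure lborel (ball x r)"
        using x d d1(1) unfolding S_def by (auto dest!: spec[of _ "min d d1"])
      have "ball x r \<subseteq> U" using r d1 by (meson min_less_iff_conj order_trans subset_ball less_imp_le)
      then show ?thesis using r x by (intro exI[of _ "(x, r)"]) (auto simp: K_def nuball)
    qed
    from Vitali_covering_theorem_balls[of S K fst snd, OF this]
    obtain C where C: "countable C" "C \<subseteq> K"
        "pairwise (\<lambda>i j. disjnt (ball (fst i) (snd i)) (ball (fst j) (snd j))) C"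
        "negligible (S - (\<Union>i\<in>C. ball (fst i) (snd i)))" by blast
    define W where "W = (\<Union>i\<in>C. ball (fst i) (snd i))"
    have [measurable]: "W \<in> sets borel" unfolding W_def using C(1) by (intro sets.countable_UN'') auto
    have "S - W \<in> null_sets (completion lborel)"
      using C(4) by (simp add: W_def negligible_iff_null_sets)
    then obtain N where N: "N \<in> null_sets lborel" "S - W \<subseteq> N"
      by (auto simp: null_sets_completion_iff2)
    then have [measurable]: "N \<in> sets borel" by auto
    have disj: "disjoint_family_on (\<lambda>i. ball (fst i) (snd i)) C"
      using C(3) by (auto simp: disjoint_family_on_def pairwise_def disjnt_def)
    have "ennreal b * emeasure lborel W = ennreal b * (\<integral>\<^sup>+i. emeasure lborel (ball (fst i) (snd i)) \<partial>count_space C)"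
      unfolding W_def using C(1) disj by (subst emeasure_UN_countable) auto
    also have "\<dots> = (\<integral>\<^sup>+i. ennreal b * emeasure lborel (ball (fst i) (snd i)) \<partial>count_space C)"
      by (rule nn_integral_cmult[symmetric]) auto
    also have "\<dots> \<le> (\<integral>\<^sup>+i. emeasure \<nu> (ball (fst i) (snd i)) \<partial>count_space C)"
      using C(2) by (intro nn_integral_mono) (auto simp: K_def)
    also have "\<dots> = emeasure \<nu> W"
      unfolding W_def using C(1) disj by (subst emeasure_UN_countable) auto
    also have "\<dots> \<le> emeasure \<nu> U"
    proof (rule emeasure_mono)
      show "W \<subseteq> U" unfolding W_def using C(2) by (intro UN_least) (fastforce simp: K_def simp del: mem_ball)
    qed simp
    finally have W: "ennreal b * emeasure lborel W \<le> ennreal a * emeasure lborel A + ennreal \<eta>"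
      using d3 by (rule order_trans)
    define A2 where "A2 = A \<inter> (W \<union> N)"
    have A2: "A2 \<in> G" using A N by (auto simp: A2_def G_def)
    have "emeasure lborel A2 \<le> emeasure lborel (W \<union> N)" by (rule emeasure_mono) (auto simp: A2_def)
    also have "\<dots> = emeasure lborel W" by (rule emeasure_Un_null_set) (use N in auto)
    finally have "ennreal b * emeasure lborel A2 \<le> ennreal a * emeasure lborel A + ennreal \<eta>"
      using W by (meson mult_left_mono order_trans zero_le)
    then have "ennreal (b * measure lborel A2) \<le> ennreal (a * measure lborel A + \<eta>)"
      using Gfin[OF A] Gfin[OF A2] ab \<open>\<eta> > 0\<close>
      by (simp add: emeasure_eq_ennreal_measure ennreal_mult ennreal_plus)
    then have "b * measure lborel A2 \<le> a * measure lborel A + \<eta>"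
      using ab \<open>\<eta> > 0\<close> by (subst (asm) ennreal_le_iff) auto
    then show ?thesis using A2 by blast
  qed
  have S0: "ball 0 R \<inter> {x. f x < ennreal a} \<in> G"
  proof -
    have "{x. f x < ennreal a} \<in> sets borel" by measurable
    then show ?thesis by (auto simp: G_def S_def)
  qed
  define m where "m = (INF A\<in>G. measure lborel A)"
  have bdd: "bdd_below (measure lborel ` G)" by (intro bdd_belowI[of _ 0]) auto
  have mle: "m \<le> measure lborel A" if "A \<in> G" for A
    unfolding m_def by (rule cINF_lower[OF bdd that])
  have "b * m / a \<le> m"
  proof -
    have "b * m / a \<le> measure lborel A" if A: "A \<in> G" for A
    proof -
      have "b * m \<le> a * measure lborel A + \<eta>" if "\<eta> > 0" for \<eta>
        using step[OF A that] mle ab by (smt (verit, ccfv_SIG) mult_left_mono)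
      then have "b * m \<le> a * measure lborel A" by (rule field_le_epsilon)
      then show ?thesis using ab by (simp add: field_simps)
    qed
    then show ?thesis unfolding m_def[symmetric] using S0
      by (subst (2) m_def) (rule cINF_greatest, auto)
  qed
  then have "m * (b - a) \<le> 0" using ab by (simp add: field_simps)
  then have m0: "m \<le> 0" using ab by (simp add: mult_le_0_iff)
  have "negligible S"
  proof (subst negligible_outer, intro allI impI)
    fix e :: real assume "e > 0"
    then have "(INF A\<in>G. measure lborel A) < e" using m0 by (simp add: m_def)
    then obtain A where A: "A \<in> G" "measure lborel A < e"
      using cINF_less_iff[OF _ bdd] S0 by blast
    then have "A \<in> lmeasurable"
      using Gfin[OF A(1)] by (intro fmeasurableI) (auto simp: G_def)
    moreover have "measure lebesgue A = measure lborel A"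
      using A by (intro measure_completion) (auto simp: G_def)
    ultimately show "\<exists>T. S \<subseteq> T \<and> T \<in> lmeasurable \<and> measure lebesgue T < e"
      using A by (auto simp: G_def)
  qed
  then show ?thesis by (simp add: S_def)
qed

text \<open>Apply the preceding lemma to \<open>|g - q|\<close> for rational \<open>q\<close>: at a point outside the countably many
  exceptional sets, choose \<open>q\<close> close to \<open>g x\<close>.\<close>

theorem AE_lebesgue_point:
  fixes g :: "'a::euclidean_space \<Rightarrow> real"
  assumes g[measurable]: "g \<in> borel_measurable borel"
    and fin: "\<And>R. (\<integral>\<^sup>+x. ennreal \<bar>g x\<bar> * indicator (ball 0 R) x \<partial>lborel) < \<infinity>"
  shows "AE x in lborel. \<forall>e>0. \<exists>d>0. \<forall>r. 0 < r \<and> r < d \<longrightarrow>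
     (\<integral>\<^sup>+y. ennreal \<bar>g y - g x\<bar> * indicator (ball x r) y \<partial>lborel) \<le> ennreal e * emeasure lborel (ball x r)"
proof -
  define S where "S q n j = {x \<in> ball (0::'a) (real n). ennreal \<bar>g x - q\<bar> < ennreal (1 / real (Suc j)) \<and>
      (\<forall>d>0. \<exists>r. 0 < r \<and> r < d \<and> (\<integral>\<^sup>+y. ennreal \<bar>g y - q\<bar> * indicator (ball x r) y \<partial>lborel)
          > ennreal (2 / real (Suc j)) * emeasure lborel (ball x r))}" for q n j
  have "negligible (S q n j)" for q n j
    unfolding S_def
  proof (rule negligible_large_means)
    have [measurable]: "ball (0::'a) (real n) \<in> sets borel" by auto
    have "(\<integral>\<^sup>+x. ennreal \<bar>g x - q\<bar> * indicator (ball 0 (real n)) x \<partial>lborel)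
        \<le> (\<integral>\<^sup>+x. ennreal \<bar>g x\<bar> * indicator (ball 0 (real n)) x + ennreal \<bar>q\<bar> * indicator (ball 0 (real n)) x \<partial>lborel)"
      by (intro nn_integral_mono) (auto simp: indicator_def ennreal_plus[symmetric] simp del: ennreal_plus intro!: ennreal_leI)
    also have "\<dots> = (\<integral>\<^sup>+x. ennreal \<bar>g x\<bar> * indicator (ball 0 (real n)) x \<partial>lborel)
        + (\<integral>\<^sup>+x. ennreal \<bar>q\<bar> * indicator (ball (0::'a) (real n)) x \<partial>lborel)"
      by (rule nn_integral_add) measurable
    also have "\<dots> < \<infinity>" using fin[of n] emeasure_bounded_finite[of "ball (0::'a) n"]
      by (auto simp: nn_integral_cmult_indicator ennreal_mult_less_top)
    finally show "(\<integral>\<^sup>+x. ennreal \<bar>g x - q\<bar> * indicator (ball 0 (real n)) x \<partial>lborel) < \<infinity>" .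
  qed (auto simp: field_simps)
  then have "negligible (\<Union>(q, n, j)\<in>\<rat> \<times> UNIV. S q n j)"
    by (intro negligible_countable_Union) (auto intro!: countable_SIGMA countable_rat)
  then have "AE x in lebesgue. x \<notin> (\<Union>(q, n, j)\<in>\<rat> \<times> UNIV. S q n j)"
    unfolding negligible_iff_null_sets by (rule AE_not_in)
  then have "AE x in lborel. x \<notin> (\<Union>(q, n, j)\<in>\<rat> \<times> UNIV. S q n j)" by (simp add: AE_completion_iff)
  then show ?thesis
  proof eventually_elim
    case (elim x)
    show ?case
    proof (intro allI impI)
      fix e :: real assume "e > 0"
      obtain j where j: "3 / real (Suc j) < e"
        using reals_Archimedean[of "e/3"] \<open>e > 0\<close> by (auto simp: field_simps)
      obtain q where q: "q \<in> \<rat>" "g x - 1 / real (Suc j) < q" "q < g x + 1 / real (Suc j)"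
        using Rats_dense_in_real[of "g x - 1 / real (Suc j)" "g x + 1 / real (Suc j)"] by auto
      then have gq: "\<bar>g x - q\<bar> < 1 / real (Suc j)" by auto
      obtain n where n: "norm x < real n" using reals_Archimedean2 by blast
      have "x \<notin> S q n j" using elim q(1) by auto
      then obtain d where d: "d > 0" "\<And>r. 0 < r \<Longrightarrow> r < d \<Longrightarrow>
          (\<integral>\<^sup>+y. ennreal \<bar>g y - q\<bar> * indicator (ball x r) y \<partial>lborel) \<le> ennreal (2 / real (Suc j)) * emeasure lborel (ball x r)"
        using gq n unfolding S_def by (simp add: not_less ennreal_less_iff) (meson not_less)
      show "\<exists>d>0. \<forall>r. 0 < r \<and> r < d \<longrightarrow>
          (\<integral>\<^sup>+y. ennreal \<bar>g y - g x\<bar> * indicator (ball x r) y \<partial>lborel) \<le> ennreal e * emeasure lborel (ball x r)"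
      proof (intro exI[of _ d] conjI allI impI d(1))
        fix r assume r: "0 < r \<and> r < d"
        have [measurable]: "ball x r \<in> sets borel" by auto
        have "(\<integral>\<^sup>+y. ennreal \<bar>g y - g x\<bar> * indicator (ball x r) y \<partial>lborel)
            \<le> (\<integral>\<^sup>+y. ennreal \<bar>g y - q\<bar> * indicator (ball x r) y + ennreal (1 / real (Suc j)) * indicator (ball x r) y \<partial>lborel)"
          using gq by (intro nn_integral_mono)
            (auto simp: indicator_def ennreal_plus[symmetric] simp del: ennreal_plus intro!: ennreal_leI)
        also have "\<dots> = (\<integral>\<^sup>+y. ennreal \<bar>g y - q\<bar> * indicator (ball x r) y \<partial>lborel) + ennreal (1 / real (Suc j)) * emeasure lborel (ball x r)"
          by (subst nn_integral_add, measurable) (simp_all add: nn_integral_cmult_indicator)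
        also have "\<dots> \<le> ennreal (2 / real (Suc j)) * emeasure lborel (ball x r) + ennreal (1 / real (Suc j)) * emeasure lborel (ball x r)"
          using d(2)[of r] r by (intro add_right_mono) auto
        also have "\<dots> = ennreal (3 / real (Suc j)) * emeasure lborel (ball x r)"
          by (simp add: distrib_right[symmetric] ennreal_plus[symmetric] add_divide_distrib[symmetric] del: ennreal_plus)
        also have "\<dots> \<le> ennreal e * emeasure lborel (ball x r)"
          using j by (intro mult_right_mono ennreal_leI) auto
        finally show "(\<integral>\<^sup>+y. ennreal \<bar>g y - g x\<bar> * indicator (ball x r) y \<partial>lborel) \<le> ennreal e * emeasure lborel (ball x r)" .
      qed
    qed
  qed
qed

section \<open>Kernels\<close>

text \<open>The kernel of the fractional Laplacian of order \<open>s\<close>, that is of \<open>(-\<Delta>)\<^sup>s\<^sup>/\<^sup>2\<close>. The Gagliardo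
  seminorm of \<open>H\<^sup>s\<close> has the kernel \<open>kern (2 * s)\<close>.\<close>

definition kern :: "real \<Rightarrow> 'a::euclidean_space \<Rightarrow> real" where
  "kern s y = norm y powr (-(real DIM('a) + s))"

text \<open>The singularity is capped, not removed: a sharp truncation jumps at \<open>|y| = \<delta>\<close> and violates the
  Lipschitz bound below, on which all estimates uniform in \<open>\<delta>\<close> rest.\<close>

definition cut_kern :: "real \<Rightarrow> real \<Rightarrow> 'a::euclidean_space \<Rightarrow> real" where
  "cut_kern s \<delta> y = max (norm y) \<delta> powr (-(real DIM('a) + s))"

text \<open>Size and smoothness of \<open>kern s\<close> up to the factor \<open>L\<close>, in a form that passes to differences of
  kernels.\<close>

definition kernel_bounds :: "real \<Rightarrow> real \<Rightarrow> ('a::euclidean_space \<Rightarrow> real) \<Rightarrow> bool" where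
  "kernel_bounds s L K \<longleftrightarrow> K \<in> borel_measurable borel \<and> L \<ge> 0 \<and>
     (\<forall>y. y \<noteq> 0 \<longrightarrow> \<bar>K y\<bar> \<le> L * kern s y) \<and>
     (\<forall>z y. z \<noteq> 0 \<longrightarrow> norm y \<le> norm z / 2 \<longrightarrow>
        \<bar>K z - K (z - y)\<bar> \<le> L * (norm y * norm z powr (-(real DIM('a) + s) - 1)))"

text \<open>For integrable \<open>K\<close>, \<open>square_kernel K\<close> is \<open>2 (\<integral>K) K - K * K\<close> with \<open>*\<close> the convolution, the density off
  the origin of minus the convolution square of the measure \<open>(\<integral>K) \<delta>\<^sub>0 - K\<close>. Keeping the three terms under one
  integral makes it meaningful for \<open>kern s\<close>, where the single terms diverge.\<close>

definition square_integrand :: "('a::euclidean_space \<Rightarrow> real) \<Rightarrow> 'a \<Rightarrow> 'a \<Rightarrow> real" where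
  "square_integrand K z y = K y * K z + K (z - y) * K z - K y * K (z - y)"

definition square_kernel :: "('a::euclidean_space \<Rightarrow> real) \<Rightarrow> 'a \<Rightarrow> real" where
  "square_kernel K z = (\<integral>y. square_integrand K z y \<partial>lborel)"

lemma kern_nonneg: "kern s y \<ge> 0" by (simp add: kern_def)

lemma kern_measurable[measurable]: "kern s \<in> borel_measurable borel"
  unfolding kern_def[abs_def] by measurable

lemma cut_kern_measurable[measurable]: "cut_kern s d \<in> borel_measurable borel"
  unfolding cut_kern_def[abs_def] by measurable

lemma powr_neg_lipschitz:
  fixes a b m p :: real
  assumes "0 < m" "m \<le> a" "m \<le> b" "p > 0"
  shows "\<bar>a powr (-p) - b powr (-p)\<bar> \<le> p * m powr (-p - 1) * \<bar>a - b\<bar>"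
proof -
  have *: "\<bar>a powr (-p) - b powr (-p)\<bar> \<le> p * m powr (-p - 1) * \<bar>a - b\<bar>" if ab: "a < b" "m \<le> a" for a b :: real
  proof -
    have der: "DERIV (\<lambda>x. x powr (-p)) x :> -p * x powr (-p - 1)" if "a \<le> x" for x
      using that ab \<open>0 < m\<close> by (intro DERIV_fun_powr[where g="\<lambda>x. x" and m=1, simplified]) auto
    obtain z where z: "a < z" "z < b" "b powr (-p) - a powr (-p) = (b - a) * (-p * z powr (-p - 1))"
      using MVT2[OF ab(1), of "\<lambda>x. x powr (-p)" "\<lambda>x. -p * x powr (-p - 1)"] der by auto
    have "\<bar>a powr (-p) - b powr (-p)\<bar> = (b - a) * (p * z powr (-p - 1))"
    proof -
      have "(b - a) * (p * z powr (-p - 1)) \<ge> 0" using ab \<open>p > 0\<close> by simp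
      then show ?thesis using z(3) by simp
    qed
    also have "\<dots> \<le> (b - a) * (p * m powr (-p - 1))"
      using z assms ab by (intro mult_left_mono powr_mono2') auto
    finally show ?thesis using ab by (simp add: ac_simps)
  qed
  show ?thesis using *[of a b] *[of b a] assms by (cases a b rule: linorder_cases) (auto simp: abs_minus_commute)
qed

lemma kernel_bounds_cut:
  assumes s: "0 < s" and \<delta>: "\<delta> \<ge> 0"
  defines "p \<equiv> real DIM('a::euclidean_space) + s"
  shows "kernel_bounds s (1 + p * 2 powr (p + 1)) (cut_kern s \<delta> :: 'a \<Rightarrow> real)"
proof -
  have p: "p > 0" using s by (simp add: p_def)
  define L where "L = 1 + p * 2 powr (p + 1)"
  have L: "L \<ge> 1" "p * 2 powr (p + 1) \<le> L" using p by (auto simp: L_def)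
  show ?thesis unfolding kernel_bounds_def L_def[symmetric]
  proof (intro conjI allI impI)
    fix y :: 'a assume "y \<noteq> 0"
    then have "cut_kern s \<delta> y \<le> kern s y"
      using p unfolding cut_kern_def kern_def p_def[symmetric] by (intro powr_mono2') auto
    also have "\<dots> \<le> L * kern s y" using L kern_nonneg[of s y] by (simp add: mult_le_cancel_right1)
    finally show "\<bar>cut_kern s \<delta> y\<bar> \<le> L * kern s y" by (simp add: cut_kern_def)
  next
    fix z y :: 'a assume z: "z \<noteq> 0" and y: "norm y \<le> norm z / 2"
    have zy: "norm z / 2 \<le> norm (z - y)" using y norm_triangle_ineq2[of z y] by simp
    have "\<bar>cut_kern s \<delta> z - cut_kern s \<delta> (z - y)\<bar>
        \<le> p * (norm z / 2) powr (-p - 1) * \<bar>max (norm z) \<delta> - max (norm (z - y)) \<delta>\<bar>"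
      unfolding cut_kern_def p_def[symmetric]
    proof (rule powr_neg_lipschitz)
      show "norm z / 2 \<le> max (norm z) \<delta>" using norm_ge_zero[of z] by linarith
      show "norm z / 2 \<le> max (norm (z - y)) \<delta>" using zy by linarith
    qed (use z p in auto)
    also have "\<dots> \<le> p * (norm z / 2) powr (-p - 1) * norm y"
      using p norm_triangle_ineq3[of z "z - y"] by (intro mult_left_mono) auto
    also have "(norm z / 2) powr (-p - 1) = 2 powr (p + 1) * norm z powr (-p - 1)"
    proof -
      have "-p - 1 = -(p + 1)" by simp
      then show ?thesis using z by (simp only: powr_divide powr_minus norm_ge_zero zero_le_numeral)
        (simp add: field_simps)
    qed
    also have "p * (2 powr (p + 1) * norm z powr (-p - 1)) * norm y
        = (p * 2 powr (p + 1)) * (norm y * norm z powr (-p - 1))" by simp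
    also have "\<dots> \<le> L * (norm y * norm z powr (-p - 1))" using L(2) by (intro mult_right_mono) auto
    finally show "\<bar>cut_kern s \<delta> z - cut_kern s \<delta> (z - y)\<bar>
        \<le> L * (norm y * norm z powr (-(real DIM('a) + s) - 1))" by (simp add: p_def)
  qed (use L in auto)
qed

lemma cut_kern_0: "cut_kern s 0 = kern s" by (auto simp: cut_kern_def kern_def)

lemma kernel_bounds_diff:
  assumes "kernel_bounds s L K" "kernel_bounds s L K'"
  shows "kernel_bounds s (2 * L) (\<lambda>y. K y - K' y)"
  unfolding kernel_bounds_def
proof (intro conjI allI impI)
  show "(\<lambda>y. K y - K' y) \<in> borel_measurable borel" using assms by (auto simp: kernel_bounds_def)
  show "2 * L \<ge> 0" using assms by (auto simp: kernel_bounds_def)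
  fix y :: 'a assume "y \<noteq> 0"
  then have "\<bar>K y\<bar> \<le> L * kern s y" "\<bar>K' y\<bar> \<le> L * kern s y" using assms by (auto simp: kernel_bounds_def)
  then show "\<bar>K y - K' y\<bar> \<le> 2 * L * kern s y" by (simp add: algebra_simps)
next
  fix z y :: 'a assume "z \<noteq> 0" "norm y \<le> norm z / 2"
  then have "\<bar>K z - K (z - y)\<bar> \<le> L * (norm y * norm z powr (-(real DIM('a) + s) - 1))"
    "\<bar>K' z - K' (z - y)\<bar> \<le> L * (norm y * norm z powr (-(real DIM('a) + s) - 1))"
    using assms unfolding kernel_bounds_def by blast+
  then show "\<bar>K z - K' z - (K (z - y) - K' (z - y))\<bar>
      \<le> 2 * L * (norm y * norm z powr (-(real DIM('a) + s) - 1))" by linarith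
qed

text \<open>Near \<open>y = 0\<close> the first and third term of the integrand are paired, which replaces the singularity
  \<open>|y|\<^sup>-\<^sup>N\<^sup>-\<^sup>s\<close> by the integrable \<open>|y|\<^sup>1\<^sup>-\<^sup>N\<^sup>-\<^sup>s\<close>; near \<open>y = z\<close> the same happens after the symmetry
  \<open>y \<mapsto> z - y\<close>. The sum \<open>square_majorant s z y + square_majorant s z (z - y)\<close> covers both.\<close>

definition square_majorant :: "real \<Rightarrow> 'a::euclidean_space \<Rightarrow> 'a \<Rightarrow> real" where
  "square_majorant s z y =
     (let p = real DIM('a) + s in
      (norm z powr (-p - 1) * norm y powr (1 - p) + 2 powr p * norm z powr (-2 * p)) * indicator (ball 0 (norm z)) y
      + (1 + 2 powr p) * norm z powr (-p) * norm y powr (-p) * indicator (- ball 0 (norm z / 2)) y)"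

lemma square_majorant_nonneg: "square_majorant s z y \<ge> 0"
  unfolding square_majorant_def Let_def
  by (intro add_nonneg_nonneg mult_nonneg_nonneg) auto

lemma square_majorant_measurable[measurable]: "square_majorant s z \<in> borel_measurable borel"
proof -
  have [measurable]: "ball (0::'a) r \<in> sets borel" for r by auto
  show ?thesis unfolding square_majorant_def[abs_def] Let_def by measurable
qed

lemma square_integrand_bound:
  assumes s: "s > 0" and K: "kernel_bounds s L K" and z: "z \<noteq> 0"
  shows "\<bar>square_integrand K z y\<bar> \<le> L\<^sup>2 * (square_majorant s z y + square_majorant s z (z - y))"
proof -
  define p where "p = real DIM('a) + s"
  have p: "p > 0" using s by (simp add: p_def)
  have L: "L \<ge> 0" using K by (simp add: kernel_bounds_def)
  have Kb: "\<bar>K y\<bar> \<le> L * norm y powr (-p)" if "y \<noteq> 0" for y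
    using K that by (simp add: kernel_bounds_def kern_def p_def)
  have Kd: "\<bar>K z - K (z - y)\<bar> \<le> L * (norm y * norm z powr (-p - 1))" if "norm y \<le> norm z / 2" for y
    using K that z by (simp add: kernel_bounds_def p_def)
  have half: "norm x powr (-p) \<le> 2 powr p * norm z powr (-p)" if "norm x \<ge> norm z / 2" for x :: 'a
  proof -
    have "norm x powr (-p) \<le> (norm z / 2) powr (-p)" using that z p by (intro powr_mono2') auto
    also have "\<dots> = 2 powr p * norm z powr (-p)" using z by (simp add: powr_divide powr_minus_divide)
    finally show ?thesis .
  qed
  have near: "\<bar>square_integrand K z y\<bar> \<le> L\<^sup>2 * square_majorant s z y" if y: "norm y \<le> norm z / 2" for y
  proof -
    have yz: "norm y < norm z"
    proof -
      have "norm z > 0" using z by simp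
      then show ?thesis using y by linarith
    qed
    have zy: "norm z / 2 \<le> norm (z - y)" using y norm_triangle_ineq2[of z y] by simp
    then have zy0: "z - y \<noteq> 0" using z by auto
    have 1: "\<bar>K y * (K z - K (z - y))\<bar> \<le> L\<^sup>2 * (norm z powr (-p - 1) * norm y powr (1 - p))"
    proof (cases "y = 0")
      case False
      have "\<bar>K y * (K z - K (z - y))\<bar> \<le> (L * norm y powr (-p)) * (L * (norm y * norm z powr (-p - 1)))"
        unfolding abs_mult using Kb[OF False] Kd[OF y] L by (intro mult_mono) auto
      also have "\<dots> = L\<^sup>2 * (norm z powr (-p - 1) * (norm y * norm y powr (-p)))"
        by (simp add: power2_eq_square)
      also have "norm y * norm y powr (-p) = norm y powr (1 - p)"
        using False by (simp add: powr_diff powr_minus_divide)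
      finally show ?thesis .
    qed auto
    have 2: "\<bar>K (z - y) * K z\<bar> \<le> L\<^sup>2 * (2 powr p * norm z powr (-2 * p))"
    proof -
      have "\<bar>K (z - y) * K z\<bar> \<le> (L * norm (z - y) powr (-p)) * (L * norm z powr (-p))"
        unfolding abs_mult using Kb[OF zy0] Kb[OF z] L by (intro mult_mono) auto
      also have "\<dots> \<le> (L * (2 powr p * norm z powr (-p))) * (L * norm z powr (-p))"
        using half[OF zy] L by (intro mult_right_mono mult_left_mono) auto
      also have "\<dots> = L\<^sup>2 * (2 powr p * (norm z powr (-p) * norm z powr (-p)))" by (simp add: power2_eq_square)
      also have "norm z powr (-p) * norm z powr (-p) = norm z powr (-2 * p)" by (simp add: powr_add[symmetric])
      finally show ?thesis .
    qed
    have "\<bar>square_integrand K z y\<bar> = \<bar>K y * (K z - K (z - y)) + K (z - y) * K z\<bar>"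
      by (simp add: square_integrand_def algebra_simps)
    also have "\<dots> \<le> L\<^sup>2 * (norm z powr (-p - 1) * norm y powr (1 - p) + 2 powr p * norm z powr (-2 * p))"
      using 1 2 by (simp add: distrib_left)
    also have "\<dots> \<le> L\<^sup>2 * square_majorant s z y"
      using yz by (intro mult_left_mono) (simp_all add: square_majorant_def Let_def p_def[symmetric])
    finally show ?thesis .
  qed
  have sym: "square_integrand K z (z - y) = square_integrand K z y"
    by (simp add: square_integrand_def)
  have maj0: "L\<^sup>2 * square_majorant s z x \<ge> 0" for x by (simp add: square_majorant_nonneg)
  consider "norm y \<le> norm z / 2" | "norm (z - y) \<le> norm z / 2" | "norm y > norm z / 2" "norm (z - y) > norm z / 2"
    by linarith
  then show ?thesis
  proof cases
    case 1 then show ?thesis using near[of y] maj0[of "z - y"] by (simp add: distrib_left)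
  next
    case 2 then show ?thesis using near[of "z - y"] maj0[of y] sym by (simp add: distrib_left)
  next
    case 3
    then have y0: "y \<noteq> 0" "z - y \<noteq> 0" using z by auto
    define a b c where "a = norm y powr (-p)" and "b = norm (z - y) powr (-p)" and "c = norm z powr (-p)"
    have abc: "a \<ge> 0" "b \<ge> 0" "c \<ge> 0" "b \<le> 2 powr p * c"
      using half[of "z - y"] 3 by (auto simp: a_def b_def c_def)
    have Kk: "\<bar>K y\<bar> \<le> L * a" "\<bar>K (z - y)\<bar> \<le> L * b" "\<bar>K z\<bar> \<le> L * c"
      using Kb y0 z by (auto simp: a_def b_def c_def)
    have "\<bar>square_integrand K z y\<bar> \<le> \<bar>K y\<bar> * \<bar>K z\<bar> + \<bar>K (z - y)\<bar> * \<bar>K z\<bar> + \<bar>K y\<bar> * \<bar>K (z - y)\<bar>"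
      unfolding square_integrand_def abs_mult[symmetric] by linarith
    also have "\<dots> \<le> (L * a) * (L * c) + (L * b) * (L * c) + (L * a) * (L * b)"
      using Kk L abc by (intro add_mono mult_mono) auto
    also have "\<dots> = L\<^sup>2 * (a * c + b * c + a * b)" by (simp add: power2_eq_square algebra_simps)
    also have "\<dots> \<le> L\<^sup>2 * (a * c + b * c + a * (2 powr p * c))"
      using abc by (intro mult_left_mono add_left_mono) auto
    also have "\<dots> \<le> L\<^sup>2 * ((1 + 2 powr p) * c * a + (1 + 2 powr p) * c * b)"
      using abc by (intro mult_left_mono) (auto simp: algebra_simps)
    also have "\<dots> \<le> L\<^sup>2 * (square_majorant s z y + square_majorant s z (z - y))"
    proof (intro mult_left_mono add_mono)
      show "(1 + 2 powr p) * c * a \<le> square_majorant s z y" "(1 + 2 powr p) * c * b \<le> square_majorant s z (z - y)"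
        using 3 by (auto simp: square_majorant_def Let_def p_def[symmetric] a_def b_def c_def indicator_def)
    qed auto
    finally show ?thesis .
  qed
qed

lemma integral_square_majorant:
  assumes s: "0 < s" "s < 1"
  shows "\<exists>C\<ge>0. \<forall>z::'a::euclidean_space. z \<noteq> 0 \<longrightarrow>
     integrable lborel (square_majorant s z) \<and> (\<integral>y. square_majorant s z y \<partial>lborel) \<le> C * kern (2 * s) z"
proof -
  define N where "N = real DIM('a)"
  define p where "p = N + s"
  obtain C1 where C1: "C1 \<ge> 0" "\<And>R. R > 0 \<Longrightarrow> integrable lborel (\<lambda>y::'a. norm y powr ((1 - s) - N) * indicator (ball 0 R) y)"
      "\<And>R. R > 0 \<Longrightarrow> (\<integral>y. norm (y::'a) powr ((1 - s) - N) * indicator (ball 0 R) y \<partial>lborel) \<le> C1 * R powr (1 - s)"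
    using power_integral_inside[where 'a='a, of "1 - s"] s unfolding N_def by auto
  obtain C2 where C2: "C2 \<ge> 0" "\<And>R. R > 0 \<Longrightarrow> integrable lborel (\<lambda>y::'a. norm y powr (-p) * indicator (- ball 0 R) y)"
      "\<And>R. R > 0 \<Longrightarrow> (\<integral>y. norm (y::'a) powr (-p) * indicator (- ball 0 R) y \<partial>lborel) \<le> C2 * R powr (-s)"
    using power_integral_outside[where 'a='a, of s] s unfolding N_def p_def by auto
  define B where "B = measure lborel (ball (0::'a) 1)"
  define C where "C = C1 + 2 powr p * B + (1 + 2 powr p) * C2 * 2 powr s"
  show ?thesis
  proof (intro exI[of _ C] conjI allI impI)
    show "C \<ge> 0" using C1(1) C2(1) by (simp add: C_def B_def)
    fix z :: 'a assume z: "z \<noteq> 0"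
    define r where "r = norm z"
    have r: "r > 0" using z by (simp add: r_def)
    have eq: "square_majorant s z = (\<lambda>y. r powr (-p - 1) * (norm y powr ((1 - s) - N) * indicator (ball 0 r) y)
          + (2 powr p * r powr (-2 * p) * indicator (ball 0 r) y
          + (1 + 2 powr p) * r powr (-p) * (norm y powr (-p) * indicator (- ball 0 (r / 2)) y)))"
    proof
      fix y :: 'a
      have "1 - p = (1 - s) - N" by (simp add: p_def)
      then show "square_majorant s z y = r powr (-p - 1) * (norm y powr ((1 - s) - N) * indicator (ball 0 r) y)
          + (2 powr p * r powr (-2 * p) * indicator (ball 0 r) y
          + (1 + 2 powr p) * r powr (-p) * (norm y powr (-p) * indicator (- ball 0 (r / 2)) y))"
        unfolding square_majorant_def Let_def r_def[symmetric] N_def[symmetric] p_def[symmetric]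
        by (simp only: distrib_right mult.assoc add.assoc)
    qed
    show "integrable lborel (square_majorant s z)"
      unfolding eq using C1(2)[OF r] C2(2)[of "r / 2"] r integrable_indicator_ball[of "0::'a" r] by simp
    have "(\<integral>y. square_majorant s z y \<partial>lborel) = r powr (-p - 1) * (\<integral>y. norm (y::'a) powr ((1 - s) - N) * indicator (ball 0 r) y \<partial>lborel)
          + (2 powr p * r powr (-2 * p) * measure lborel (ball (0::'a) r)
          + (1 + 2 powr p) * r powr (-p) * (\<integral>y. norm (y::'a) powr (-p) * indicator (- ball 0 (r / 2)) y \<partial>lborel))"
      unfolding eq using C1(2)[OF r] C2(2)[of "r / 2"] r integrable_indicator_ball[of "0::'a" r] by simp
    also have "\<dots> \<le> r powr (-p - 1) * (C1 * r powr (1 - s)) + (2 powr p * r powr (-2 * p) * (B * r powr N)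
          + (1 + 2 powr p) * r powr (-p) * (C2 * (r / 2) powr (-s)))"
      using r measure_ball_powr[of r "0::'a"] by (intro add_mono mult_left_mono C1 C2) (auto simp: B_def N_def)
    also have "(r / 2) powr (-s) = r powr (-s) * 2 powr s" using r by (simp add: powr_divide powr_minus_divide)
    also have "r powr (-p - 1) * (C1 * r powr (1 - s)) + (2 powr p * r powr (-2 * p) * (B * r powr N)
          + (1 + 2 powr p) * r powr (-p) * (C2 * (r powr (-s) * 2 powr s)))
        = C1 * (r powr (-p - 1) * r powr (1 - s)) + (2 powr p * B * (r powr (-2 * p) * r powr N)
          + (1 + 2 powr p) * C2 * 2 powr s * (r powr (-p) * r powr (-s)))" by simp
    also have "\<dots> = C * kern (2 * s) z"
    proof -
      have "-p - 1 + (1 - s) = -(N + 2 * s)" "-2 * p + N = -(N + 2 * s)" "-p + -s = -(N + 2 * s)"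
        by (simp_all add: p_def)
      then show ?thesis
        unfolding powr_add[symmetric] C_def kern_def r_def[symmetric] N_def[symmetric] by (simp only: distrib_right add.assoc)
    qed
    finally show "(\<integral>y. square_majorant s z y \<partial>lborel) \<le> C * kern (2 * s) z" .
  qed
qed

text \<open>Since \<open>2 (N + s) - N = N + 2 s\<close>, the square of \<open>kern s\<close> has the size of \<open>kern (2 * s)\<close>; the constant
  is the same for all kernels with the same bounds.\<close>

lemma square_kernel_bound:
  assumes s: "0 < s" "s < 1"
  shows "\<exists>C\<ge>0. \<forall>L (K :: 'a \<Rightarrow> real) z. kernel_bounds s L K \<longrightarrow> z \<noteq> 0 \<longrightarrow> \<bar>square_kernel K z\<bar> \<le> C * L\<^sup>2 * kern (2 * s) (z::'a::euclidean_space)"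
    and "z \<noteq> 0 \<Longrightarrow> integrable lborel (\<lambda>y. square_majorant s (z::'a) y + square_majorant s z (z - y))"
proof -
  obtain C where C: "C \<ge> 0" "\<And>z::'a. z \<noteq> 0 \<Longrightarrow> integrable lborel (square_majorant s z)"
      "\<And>z::'a. z \<noteq> 0 \<Longrightarrow> (\<integral>y. square_majorant s z y \<partial>lborel) \<le> C * kern (2 * s) z"
    using integral_square_majorant[OF s, where 'a='a] by auto
  have int: "integrable lborel (\<lambda>y. square_majorant s z y + square_majorant s z (z - y))" if "z \<noteq> 0" for z :: 'a
    using C(2)[OF that] integral_lborel_reflect_translate(2)[of "square_majorant s z" z] by auto
  then show "z \<noteq> 0 \<Longrightarrow> integrable lborel (\<lambda>y. square_majorant s (z::'a) y + square_majorant s z (z - y))" .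
  show "\<exists>C\<ge>0. \<forall>L (K :: 'a \<Rightarrow> real) z. kernel_bounds s L K \<longrightarrow> z \<noteq> 0 \<longrightarrow> \<bar>square_kernel K z\<bar> \<le> C * L\<^sup>2 * kern (2 * s) (z::'a)"
  proof (intro exI[of _ "2 * C"] conjI allI impI)
    fix L and K :: "'a \<Rightarrow> real" and z :: 'a assume K: "kernel_bounds s L K" and z: "z \<noteq> 0"
    have "\<bar>square_kernel K z\<bar> \<le> (\<integral>y. \<bar>square_integrand K z y\<bar> \<partial>lborel)"
      unfolding square_kernel_def by (rule integral_abs_bound)
    also have "\<dots> \<le> (\<integral>y. L\<^sup>2 * (square_majorant s z y + square_majorant s z (z - y)) \<partial>lborel)"
      using square_integrand_bound[OF s(1) K z] int[OF z]
      by (intro integral_mono') (auto simp: square_majorant_nonneg)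
    also have "\<dots> = L\<^sup>2 * (2 * (\<integral>y. square_majorant s z y \<partial>lborel))"
      using C(2)[OF z] integral_lborel_reflect_translate[of "square_majorant s z" z] by simp
    also have "\<dots> \<le> L\<^sup>2 * (2 * (C * kern (2 * s) z))" using C(3)[OF z] by (intro mult_left_mono) auto
    finally show "\<bar>square_kernel K z\<bar> \<le> 2 * C * L\<^sup>2 * kern (2 * s) z" by (simp add: ac_simps)
  qed (use C in auto)
qed

lemma AE_lborel_neq: "AE y in lborel. y \<noteq> (c::'a::euclidean_space)"
  by (rule AE_I[of _ _ "{c}"]) auto

lemma square_integrand_measurable[measurable]:
  assumes [measurable]: "K \<in> borel_measurable borel"
  shows "square_integrand K z \<in> borel_measurable borel"
  unfolding square_integrand_def[abs_def] by measurable

lemma square_kernel_measurable[measurable]: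
  assumes [measurable]: "K \<in> borel_measurable borel"
  shows "square_kernel K \<in> borel_measurable borel"
  unfolding square_kernel_def[abs_def] square_integrand_def[abs_def] by measurable

lemma kernel_bounds_measurable: "kernel_bounds s L K \<Longrightarrow> K \<in> borel_measurable borel"
  unfolding kernel_bounds_def by blast

lemma square_kernel_tendsto:
  assumes s: "0 < s" "s < 1" and K: "\<And>n::nat. kernel_bounds s L (K n)" and K': "K' \<in> borel_measurable borel"
    and lim: "\<And>y. y \<noteq> 0 \<Longrightarrow> (\<lambda>n. K n y) \<longlonglongrightarrow> K' y" and z: "z \<noteq> (0::'a::euclidean_space)"
  shows "(\<lambda>n. square_kernel (K n) z) \<longlonglongrightarrow> square_kernel K' z"
  unfolding square_kernel_def
proof (rule integral_dominated_convergence)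
  show "integrable lborel (\<lambda>y. L\<^sup>2 * (square_majorant s z y + square_majorant s z (z - y)))"
    using square_kernel_bound(2)[OF s z] by simp
  show "AE y in lborel. norm (square_integrand (K n) z y) \<le> L\<^sup>2 * (square_majorant s z y + square_majorant s z (z - y))" for n
    using square_integrand_bound[OF s(1) K z] by simp
  show "AE y in lborel. (\<lambda>n. square_integrand (K n) z y) \<longlonglongrightarrow> square_integrand K' z y"
    using AE_lborel_neq[of 0] AE_lborel_neq[of z]
  proof eventually_elim
    case (elim y)
    then show ?case unfolding square_integrand_def using z by (intro tendsto_intros lim) auto
  qed
  show "square_integrand (K n) z \<in> borel_measurable lborel" for n
    using square_integrand_measurable[OF kernel_bounds_measurable[OF K]] by simp
  show "square_integrand K' z \<in> borel_measurable lborel"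
    using square_integrand_measurable[OF K'] by simp
qed

text \<open>Scaling fixes the degree of homogeneity, reflections the dependence on the direction.\<close>

lemma square_kernel_kern:
  "\<exists>c. \<forall>z::'a::euclidean_space. z \<noteq> 0 \<longrightarrow> square_kernel (kern s) z = c * kern (2 * s) z"
proof -
  define p where "p = real DIM('a) + s"
  define e :: 'a where "e = (SOME b. b \<in> Basis)"
  have e: "norm e = 1" unfolding e_def by (rule norm_Basis) (simp add: some_in_eq)
  have "square_kernel (kern s) z = square_kernel (kern s) e * kern (2 * s) z" if z: "z \<noteq> 0" for z :: 'a
  proof -
    (* Move z to the multiple r e of the fixed unit vector e, then scale by r. *)
    define r where "r = norm z"
    have r: "r > 0" using z by (simp add: r_def)
    have hom: "kern s (r *\<^sub>R y) = r powr (-p) * kern s y" for y :: 'a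
      using r unfolding kern_def p_def norm_scaleR by (subst powr_mult) auto
    have si: "square_integrand (kern s) (r *\<^sub>R e) (r *\<^sub>R y) = (r powr (-p))\<^sup>2 * square_integrand (kern s) e y" for y
      unfolding square_integrand_def scaleR_right_diff_distrib[symmetric] hom power2_eq_square
      by (simp only: right_diff_distrib distrib_left mult.assoc mult.left_commute)
    have "square_kernel (kern s) z = square_kernel (kern s) (r *\<^sub>R e)"
      unfolding square_kernel_def
    proof (rule integral_radial_eq)
      show "norm z = norm (r *\<^sub>R e)" using e r by (simp add: r_def)
      fix T :: "'a \<Rightarrow> 'a" and z y assume "linear T" "\<And>x. norm (T x) = norm x"
      then show "square_integrand (kern s) (T z) (T y) = square_integrand (kern s) z y"
        by (simp add: square_integrand_def kern_def linear_diff[symmetric])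
    qed simp
    also have "\<dots> = r ^ DIM('a) * (\<integral>y. square_integrand (kern s) (r *\<^sub>R e) (r *\<^sub>R y) \<partial>lborel)"
      unfolding square_kernel_def using r by (intro integral_lborel_scale) auto
    also have "\<dots> = (r ^ DIM('a) * (r powr (-p))\<^sup>2) * square_kernel (kern s) e"
      by (simp add: si square_kernel_def)
    also have "r ^ DIM('a) * (r powr (-p))\<^sup>2 = kern (2 * s) z"
    proof -
      have "r ^ DIM('a) = r powr real DIM('a)" using r by (simp add: powr_realpow)
      then have "r ^ DIM('a) * (r powr (-p))\<^sup>2 = r powr (real DIM('a) + (-p + -p))"
        by (simp only: power2_eq_square powr_add)
      then show ?thesis by (simp add: kern_def r_def[symmetric] p_def)
    qed
    finally show ?thesis by simp
  qed
  then show ?thesis by blast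
qed

section \<open>Energy of difference operators with integrable kernels\<close>

definition difference_op :: "('a::euclidean_space \<Rightarrow> real) \<Rightarrow> ('a \<Rightarrow> real) \<Rightarrow> 'a \<Rightarrow> real" where
  "difference_op K u x = (\<integral>z. (u x - u (x + z)) * K z \<partial>lborel)"

definition diff_energy :: "('a::euclidean_space \<Rightarrow> real) \<Rightarrow> 'a \<Rightarrow> real" where
  "diff_energy u z = (\<integral>x. (u x - u (x + z))\<^sup>2 \<partial>lborel)"

lemma square_integrable_lborel_measurable: "square_integrable lborel u \<Longrightarrow> u \<in> borel_measurable borel"
  by (simp add: square_integrable_def)

lemma square_integrable_shift:
  assumes u: "square_integrable lborel (u :: 'a::euclidean_space \<Rightarrow> real)"
  shows "square_integrable lborel (\<lambda>x. u (x + z))"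
proof -
  have [measurable]: "u \<in> borel_measurable borel" using u by (rule square_integrable_lborel_measurable)
  have "integrable lborel (\<lambda>x. (u (z + x))\<^sup>2)"
    using u integrable_lborel_translate[of "\<lambda>x. (u x)\<^sup>2" z] by (simp add: square_integrable_def)
  then show ?thesis by (simp add: square_integrable_def add.commute)
qed

lemma diff_energy_measurable[measurable]:
  assumes [measurable]: "u \<in> borel_measurable borel"
  shows "diff_energy u \<in> borel_measurable borel"
  unfolding diff_energy_def[abs_def] by measurable

lemma difference_op_measurable[measurable]:
  assumes [measurable]: "u \<in> borel_measurable borel" "K \<in> borel_measurable borel"
  shows "difference_op K u \<in> borel_measurable borel"
  unfolding difference_op_def[abs_def] by measurable

lemma diff_energy_nonneg: "diff_energy u z \<ge> 0" by (simp add: diff_energy_def)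

lemma diff_energy_le:
  assumes u: "square_integrable lborel (u :: 'a::euclidean_space \<Rightarrow> real)"
  shows "diff_energy u z \<le> 4 * (\<integral>x. (u x)\<^sup>2 \<partial>lborel)"
proof -
  have [measurable]: "u \<in> borel_measurable borel" using u by (rule square_integrable_lborel_measurable)
  note uz = square_integrable_shift[OF u, of z]
  have "diff_energy u z \<le> (\<integral>x. 2 * (u x)\<^sup>2 + 2 * (u (x + z))\<^sup>2 \<partial>lborel)"
    unfolding diff_energy_def
  proof (rule integral_mono)
    show "integrable lborel (\<lambda>x. (u x - u (x + z))\<^sup>2)"
      using square_integrable_diff[OF u uz] by (simp add: square_integrable_def)
    show "integrable lborel (\<lambda>x. 2 * (u x)\<^sup>2 + 2 * (u (x + z))\<^sup>2)"
      using u uz by (simp add: square_integrable_def)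
    fix x show "(u x - u (x + z))\<^sup>2 \<le> 2 * (u x)\<^sup>2 + 2 * (u (x + z))\<^sup>2"
      using zero_le_power2[of "u x + u (x + z)"] by (simp add: power2_eq_square algebra_simps)
  qed
  also have "\<dots> = 4 * (\<integral>x. (u x)\<^sup>2 \<partial>lborel)"
    using u uz integral_lborel_translate'[of "\<lambda>x. (u x)\<^sup>2" z] by (simp add: square_integrable_def)
  finally show ?thesis .
qed

lemma diff_energy_shift:
  fixes u :: "'a::euclidean_space \<Rightarrow> real"
  assumes [measurable]: "u \<in> borel_measurable borel"
  shows "(\<integral>x. (u (x + w) - u (x + y))\<^sup>2 \<partial>lborel) = diff_energy u (w - y)"
proof -
  have "diff_energy u (w - y) = (\<integral>x. (u (x + y) - u (x + y + (w - y)))\<^sup>2 \<partial>lborel)"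
    unfolding diff_energy_def by (rule integral_lborel_translate'[symmetric]) measurable
  then show ?thesis by (simp add: power2_commute algebra_simps)
qed

lemma
  fixes f :: "'a::euclidean_space \<Rightarrow> real" and g :: "'b::euclidean_space \<Rightarrow> real"
  assumes f: "integrable lborel f" and g: "integrable lborel g"
  shows integrable_tensor: "integrable (lborel \<Otimes>\<^sub>M lborel) (\<lambda>(x, y). f x * g y)"
    and integral_tensor: "(\<integral>p. (case p of (x, y) \<Rightarrow> f x * g y) \<partial>(lborel \<Otimes>\<^sub>M lborel)) = (\<integral>x. f x \<partial>lborel) * (\<integral>y. g y \<partial>lborel)"
proof -
  have [measurable]: "f \<in> borel_measurable borel" "g \<in> borel_measurable borel" using f g by auto
  show *: "integrable (lborel \<Otimes>\<^sub>M lborel) (\<lambda>(x, y). f x * g y)"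
    by (rule lborel_pair.Fubini_integrable) (use f g in \<open>auto simp: abs_mult\<close>)
  show "(\<integral>p. (case p of (x, y) \<Rightarrow> f x * g y) \<partial>(lborel \<Otimes>\<^sub>M lborel)) = (\<integral>x. f x \<partial>lborel) * (\<integral>y. g y \<partial>lborel)"
    using lborel_pair.integral_fst'[OF *] by simp
qed

text \<open>For almost every \<open>x\<close> the square of \<open>u (x + z)\<close> is integrable in \<open>z\<close> against \<open>|K z|\<close>, by Tonelli's theorem.\<close>

lemma AE_difference_integrable:
  fixes u K :: "'a::euclidean_space \<Rightarrow> real"
  assumes u: "square_integrable lborel u" and K: "integrable lborel K"
  shows "AE x in lborel. integrable lborel (\<lambda>z. (u x - u (x + z)) * K z)"
proof -
  have [measurable]: "u \<in> borel_measurable borel" using u by (rule square_integrable_lborel_measurable)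
  have [measurable]: "K \<in> borel_measurable borel" using K by auto
  have usq: "(\<integral>\<^sup>+x. ennreal ((u x)\<^sup>2) \<partial>lborel) < \<infinity>" using u square_integrable_iff_nn_integral[of u lborel] by simp
  have Kn: "(\<integral>\<^sup>+z. ennreal \<bar>K z\<bar> \<partial>lborel) < \<infinity>" using K by (simp add: integrable_iff_bounded)
  have "(\<integral>\<^sup>+x. (\<integral>\<^sup>+z. ennreal ((u (x + z))\<^sup>2) * ennreal \<bar>K z\<bar> \<partial>lborel) \<partial>lborel)
      = (\<integral>\<^sup>+z. (\<integral>\<^sup>+x. ennreal ((u (x + z))\<^sup>2) * ennreal \<bar>K z\<bar> \<partial>lborel) \<partial>lborel)"
    by (rule lborel_pair.Fubini'[symmetric]) measurable
  also have "\<dots> = (\<integral>\<^sup>+z. (\<integral>\<^sup>+x. ennreal ((u x)\<^sup>2) \<partial>lborel) * ennreal \<bar>K z\<bar> \<partial>lborel)"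
  proof (rule nn_integral_cong)
    fix z :: 'a
    show "(\<integral>\<^sup>+x. ennreal ((u (x + z))\<^sup>2) * ennreal \<bar>K z\<bar> \<partial>lborel) = (\<integral>\<^sup>+x. ennreal ((u x)\<^sup>2) \<partial>lborel) * ennreal \<bar>K z\<bar>"
      using nn_integral_translate'[of "\<lambda>x. ennreal ((u x)\<^sup>2)" z] by (subst nn_integral_multc) auto
  qed
  also have "\<dots> < \<infinity>" using usq Kn by (subst nn_integral_cmult) (auto simp: ennreal_mult_less_top)
  finally have "AE x in lborel. (\<integral>\<^sup>+z. ennreal ((u (x + z))\<^sup>2) * ennreal \<bar>K z\<bar> \<partial>lborel) \<noteq> \<infinity>"
    by (intro nn_integral_PInf_AE) auto
  then show ?thesis
  proof eventually_elim
    case (elim x)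
    have i2: "integrable lborel (\<lambda>z. (u (x + z))\<^sup>2 * \<bar>K z\<bar>)"
      by (rule integrableI_bounded) (use elim in \<open>auto simp: abs_mult ennreal_mult less_top\<close>)
    show ?case
    proof (rule Bochner_Integration.integrable_bound)
      show "integrable lborel (\<lambda>z. (\<bar>u x\<bar> + 1) * \<bar>K z\<bar> + (u (x + z))\<^sup>2 * \<bar>K z\<bar>)" using K i2 by simp
      show "AE z in lborel. norm ((u x - u (x + z)) * K z) \<le> norm ((\<bar>u x\<bar> + 1) * \<bar>K z\<bar> + (u (x + z))\<^sup>2 * \<bar>K z\<bar>)"
      proof (intro AE_I2)
        fix z
        have "\<bar>u (x + z)\<bar> \<le> 1 + (u (x + z))\<^sup>2"
        proof (cases "\<bar>u (x + z)\<bar> \<le> 1")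
          case False
          then have "\<bar>u (x + z)\<bar> * 1 \<le> \<bar>u (x + z)\<bar> * \<bar>u (x + z)\<bar>" by (intro mult_left_mono) auto
          then show ?thesis by (simp add: power2_eq_square)
        qed (auto intro: add_increasing2)
        then have "\<bar>u x - u (x + z)\<bar> \<le> \<bar>u x\<bar> + 1 + (u (x + z))\<^sup>2" by linarith
        then have "\<bar>u x - u (x + z)\<bar> * \<bar>K z\<bar> \<le> (\<bar>u x\<bar> + 1 + (u (x + z))\<^sup>2) * \<bar>K z\<bar>" by (rule mult_right_mono) simp
        then show "norm ((u x - u (x + z)) * K z) \<le> norm ((\<bar>u x\<bar> + 1) * \<bar>K z\<bar> + (u (x + z))\<^sup>2 * \<bar>K z\<bar>)"
          by (simp add: abs_mult distrib_right)
      qed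
    qed measurable
  qed
qed

text \<open>Writing the square of the operator as a double integral in \<open>y\<close> and \<open>w\<close>, the identity
  \<open>2 a b = a\<^sup>2 + b\<^sup>2 - (a - b)\<^sup>2\<close> for \<open>a = u x - u (x + y)\<close>, \<open>b = u x - u (x + w)\<close> expresses the integral over \<open>x\<close>
  through the energies of the increments \<open>y\<close>, \<open>w\<close> and \<open>w - y\<close>. Renaming the increment to \<open>z\<close> in each
  of the three terms gives \<open>square_kernel K\<close>.\<close>

theorem difference_op_energy:
  fixes u K :: "'a::euclidean_space \<Rightarrow> real"
  assumes u: "square_integrable lborel u" and K: "integrable lborel K" and even: "\<And>y. K (- y) = K y"
  shows "square_integrable lborel (difference_op K u)"
    and "(\<integral>x. (difference_op K u x)\<^sup>2 \<partial>lborel) = 1/2 * (\<integral>z. diff_energy u z * square_kernel K z \<partial>lborel)"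
proof -
  have um[measurable]: "u \<in> borel_measurable borel" using u by (rule square_integrable_lborel_measurable)
  have Km[measurable]: "K \<in> borel_measurable borel" using K by auto
  define V where "V = diff_energy u"
  have [measurable]: "V \<in> borel_measurable borel" by (simp add: V_def)
  define c where "c = 4 * (\<integral>x. (u x)\<^sup>2 \<partial>lborel)"
  have c0: "c \<ge> 0" by (simp add: c_def)
  have V: "0 \<le> V z" "V z \<le> c" "\<bar>V z\<bar> \<le> c" for z
    using diff_energy_nonneg[of u z] diff_energy_le[OF u, of z] by (auto simp: V_def c_def)
  define D where "D y x = u x - u (x + y)" for x y
  have [measurable]: "(\<lambda>(x, y). D (f x y) (g x y)) \<in> borel_measurable (borel \<Otimes>\<^sub>M borel)"
    if [measurable]: "(\<lambda>(x, y). f x y) \<in> borel_measurable (borel \<Otimes>\<^sub>M borel)" "(\<lambda>(x, y). g x y) \<in> borel_measurable (borel \<Otimes>\<^sub>M borel)"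
    for f g :: "'a \<Rightarrow> 'a \<Rightarrow> 'a" unfolding D_def by measurable
  have Dsq: "square_integrable lborel (D y)" for y
    unfolding D_def[abs_def] by (intro square_integrable_diff u square_integrable_shift)
  have DV: "(\<integral>x. (D y x)\<^sup>2 \<partial>lborel) = V y" for y by (simp add: D_def V_def diff_energy_def)
  have DD: "(\<integral>x. D y x * D w x \<partial>lborel) = (V y + V w - V (w - y)) / 2" for y w
  proof -
    have "(\<integral>x. D y x * D w x \<partial>lborel) = (\<integral>x. ((D y x)\<^sup>2 + (D w x)\<^sup>2 - (u (x + w) - u (x + y))\<^sup>2) / 2 \<partial>lborel)"
      by (intro Bochner_Integration.integral_cong) (auto simp: D_def power2_eq_square algebra_simps)
    also have "\<dots> = (V y + V w - V (w - y)) / 2"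
      using Dsq[of y] Dsq[of w] square_integrable_diff[OF square_integrable_shift[OF u, of w] square_integrable_shift[OF u, of y]]
      by (simp add: square_integrable_def DV diff_energy_shift V_def)
    finally show ?thesis .
  qed
  define F where "F p x = D (fst p) x * D (snd p) x * (K (fst p) * K (snd p))" for p x
  have Fm[measurable]: "(\<lambda>(p, x). F p x) \<in> borel_measurable (lborel \<Otimes>\<^sub>M lborel)"
    unfolding F_def D_def lborel_prod[symmetric] by measurable
  have FI: "integrable lborel (F p)" for p
    unfolding F_def by (intro integrable_mult_left square_integrable_mult Dsq)
  have KK: "integrable lborel (\<lambda>p. K (fst p) * K (snd p))"
    using integrable_tensor[OF K K] by (simp add: lborel_prod case_prod_beta')
  have Fabs: "(\<integral>x. \<bar>F p x\<bar> \<partial>lborel) \<le> c * \<bar>K (fst p) * K (snd p)\<bar>" for p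
  proof -
    have "(\<integral>x. \<bar>F p x\<bar> \<partial>lborel) = (\<integral>x. \<bar>D (fst p) x * D (snd p) x\<bar> \<partial>lborel) * \<bar>K (fst p) * K (snd p)\<bar>"
      unfolding F_def abs_mult[of _ "K _ * K _"] by simp
    also have "(\<integral>x. \<bar>D (fst p) x * D (snd p) x\<bar> \<partial>lborel) \<le> (\<integral>x. ((D (fst p) x)\<^sup>2 + (D (snd p) x)\<^sup>2) / 2 \<partial>lborel)"
    proof (rule integral_mono)
      show "integrable lborel (\<lambda>x. \<bar>D (fst p) x * D (snd p) x\<bar>)"
        by (intro integrable_abs square_integrable_mult Dsq)
      show "integrable lborel (\<lambda>x. ((D (fst p) x)\<^sup>2 + (D (snd p) x)\<^sup>2) / 2)"
        using Dsq[of "fst p"] Dsq[of "snd p"] by (simp add: square_integrable_def)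
      fix x show "\<bar>D (fst p) x * D (snd p) x\<bar> \<le> ((D (fst p) x)\<^sup>2 + (D (snd p) x)\<^sup>2) / 2"
        using sum_squares_bound[of "\<bar>D (fst p) x\<bar>" "\<bar>D (snd p) x\<bar>"] by (simp add: abs_mult)
    qed
    also have "\<dots> = (V (fst p) + V (snd p)) / 2"
      using Dsq[of "fst p"] Dsq[of "snd p"] by (simp add: square_integrable_def DV)
    also have "\<dots> \<le> c" using V(2)[of "fst p"] V(2)[of "snd p"] by simp
    finally show ?thesis by (simp add: mult_right_mono)
  qed
  have Fint: "integrable (lborel \<Otimes>\<^sub>M lborel) (\<lambda>(p, x). F p x)"
  proof (rule lborel_pair.Fubini_integrable)
    have [measurable]: "(\<lambda>p. (\<integral>x. \<bar>F p x\<bar> \<partial>lborel)) \<in> borel_measurable lborel" by measurable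
    show "integrable lborel (\<lambda>p. \<integral>x. norm (case (p, x) of (p, x) \<Rightarrow> F p x) \<partial>lborel)"
    proof (rule Bochner_Integration.integrable_bound)
      show "integrable lborel (\<lambda>p. c * \<bar>K (fst p) * K (snd p)\<bar>)" using KK by simp
      show "AE p in lborel. norm (\<integral>x. norm (case (p, x) of (p, x) \<Rightarrow> F p x) \<partial>lborel) \<le> norm (c * \<bar>K (fst p) * K (snd p)\<bar>)"
        using Fabs c0 by (auto simp: abs_mult)
    qed simp
  qed (use FI in auto)
  have inner: "AE x in lborel. (\<integral>p. F p x \<partial>lborel) = (difference_op K u x)\<^sup>2"
    using AE_difference_integrable[OF u K]
  proof eventually_elim
    case (elim x)
    then have e: "integrable lborel (\<lambda>z. D z x * K z)" by (simp add: D_def)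
    have "(\<integral>p. F p x \<partial>lborel) = (\<integral>p. (case p of (y, w) \<Rightarrow> (D y x * K y) * (D w x * K w)) \<partial>(lborel \<Otimes>\<^sub>M lborel))"
      unfolding lborel_prod by (intro Bochner_Integration.integral_cong) (auto simp: F_def)
    also have "\<dots> = (difference_op K u x)\<^sup>2"
      by (subst integral_tensor[OF e e]) (simp add: difference_op_def D_def power2_eq_square)
    finally show ?case .
  qed
  have "integrable lborel (\<lambda>x. \<integral>p. F p x \<partial>lborel)" using lborel_pair.integrable_snd[OF Fint] by simp
  then have "integrable lborel (\<lambda>x. (difference_op K u x)\<^sup>2)"
    by (rule integrable_cong_AE_imp) (use inner in auto)
  then show "square_integrable lborel (difference_op K u)" by (simp add: square_integrable_def)
  have "(\<integral>x. (difference_op K u x)\<^sup>2 \<partial>lborel) = (\<integral>x. (\<integral>p. F p x \<partial>lborel) \<partial>lborel)"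
    by (rule integral_cong_AE) (use inner in auto)
  also have "\<dots> = (\<integral>p. (\<integral>x. F p x \<partial>lborel) \<partial>lborel)"
    by (rule lborel_pair.Fubini_integral[OF Fint])
  also have "\<dots> = (\<integral>p. (V (fst p) + V (snd p) - V (snd p - fst p)) / 2 * (K (fst p) * K (snd p)) \<partial>lborel)"
    by (intro Bochner_Integration.integral_cong refl) (simp add: F_def DD)
  also have "\<dots> = (\<integral>p. ((V (fst p) * K (fst p)) * K (snd p) + K (fst p) * (V (snd p) * K (snd p))
      - V (snd p - fst p) * (K (fst p) * K (snd p))) / 2 \<partial>lborel)"
    by (intro Bochner_Integration.integral_cong refl) (simp add: field_simps)
  also have "\<dots> = ((\<integral>p. (V (fst p) * K (fst p)) * K (snd p) \<partial>lborel) + (\<integral>p. K (fst p) * (V (snd p) * K (snd p)) \<partial>lborel)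
      - (\<integral>p. V (snd p - fst p) * (K (fst p) * K (snd p)) \<partial>lborel)) / 2"
  proof -
    have VK: "integrable lborel (\<lambda>y. V y * K y)" using K V(3) by (intro integrable_bounded_mult) auto
    have 1: "integrable lborel (\<lambda>p. (V (fst p) * K (fst p)) * K (snd p))"
      using integrable_tensor[OF VK K] by (simp add: lborel_prod case_prod_beta')
    have 2: "integrable lborel (\<lambda>p. K (fst p) * (V (snd p) * K (snd p)))"
      using integrable_tensor[OF K VK] by (simp add: lborel_prod case_prod_beta')
    have [measurable]: "(\<lambda>p. V (snd p - fst p)) \<in> borel_measurable lborel"
      unfolding lborel_prod[symmetric] by measurable
    have 3: "integrable lborel (\<lambda>p. V (snd p - fst p) * (K (fst p) * K (snd p)))"
      by (rule integrable_bounded_mult[OF KK _ V(3)]) measurable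
    show ?thesis using 1 2 3 by simp
  qed
  also have "\<dots> = 1/2 * (\<integral>z. V z * square_kernel K z \<partial>lborel)"
  proof -
    define m where "m = (\<integral>y. K y \<partial>lborel)"
    have VK: "integrable lborel (\<lambda>y. V y * K y)" using K V(3) by (intro integrable_bounded_mult) auto
    have t1: "(\<integral>p. (V (fst p) * K (fst p)) * K (snd p) \<partial>lborel) = (\<integral>z. V z * K z \<partial>lborel) * m"
      using integral_tensor[OF VK K] by (simp add: lborel_prod case_prod_beta' m_def)
    have t2: "(\<integral>p. K (fst p) * (V (snd p) * K (snd p)) \<partial>lborel) = m * (\<integral>z. V z * K z \<partial>lborel)"
      using integral_tensor[OF K VK] by (simp add: lborel_prod case_prod_beta' m_def)
    have [measurable]: "(\<lambda>p. V (snd p - fst p)) \<in> borel_measurable lborel"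
      unfolding lborel_prod[symmetric] by measurable
    have i3: "integrable (lborel \<Otimes>\<^sub>M lborel) (\<lambda>p. V (snd p - fst p) * (K (fst p) * K (snd p)))"
      unfolding lborel_prod by (rule integrable_bounded_mult[OF KK _ V(3)]) measurable
    have iK: "integrable lborel (\<lambda>z. K (z + y))" for y
      using integrable_lborel_translate[of K y] K by (simp add: add.commute)
    have iVK: "integrable lborel (\<lambda>z. V z * K (z + y))" for y
      using iK V(3) by (intro integrable_bounded_mult) auto
    define G where "G y z = V z * (K y * K (z + y))" for y z
    have Gm[measurable]: "(\<lambda>(y, z). G y z) \<in> borel_measurable (lborel \<Otimes>\<^sub>M lborel)"
      unfolding G_def by measurable
    have Gabs: "(\<integral>z. \<bar>G y z\<bar> \<partial>lborel) \<le> c * (\<integral>z. \<bar>K z\<bar> \<partial>lborel) * \<bar>K y\<bar>" for y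
    proof -
      have "(\<integral>z. \<bar>G y z\<bar> \<partial>lborel) = (\<integral>z. \<bar>V z * K (z + y)\<bar> \<partial>lborel) * \<bar>K y\<bar>"
        by (subst integral_mult_left_zero[symmetric]) (auto simp: G_def abs_mult ac_simps)
      also have "(\<integral>z. \<bar>V z * K (z + y)\<bar> \<partial>lborel) \<le> (\<integral>z. c * \<bar>K (z + y)\<bar> \<partial>lborel)"
      proof (rule integral_mono)
        show "integrable lborel (\<lambda>z. \<bar>V z * K (z + y)\<bar>)" by (rule integrable_abs[OF iVK])
        show "integrable lborel (\<lambda>z. c * \<bar>K (z + y)\<bar>)" using iK[of y] by simp
        show "\<bar>V z * K (z + y)\<bar> \<le> c * \<bar>K (z + y)\<bar>" for z
          unfolding abs_mult by (rule mult_right_mono[OF V(3)]) simp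
      qed
      also have "\<dots> = c * (\<integral>z. \<bar>K z\<bar> \<partial>lborel)"
        using integral_lborel_translate'[of "\<lambda>z. \<bar>K z\<bar>" y] by simp
      finally show ?thesis by (simp add: mult_right_mono)
    qed
    have Gint: "integrable (lborel \<Otimes>\<^sub>M lborel) (\<lambda>(y, z). G y z)"
    proof (rule lborel_pair.Fubini_integrable)
      show "integrable lborel (\<lambda>y. \<integral>z. norm (case (y, z) of (y, z) \<Rightarrow> G y z) \<partial>lborel)"
      proof (rule Bochner_Integration.integrable_bound)
        show "integrable lborel (\<lambda>y. c * (\<integral>z. \<bar>K z\<bar> \<partial>lborel) * \<bar>K y\<bar>)" using K by simp
        show "AE y in lborel. norm (\<integral>z. norm (case (y, z) of (y, z) \<Rightarrow> G y z) \<partial>lborel)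
            \<le> norm (c * (\<integral>z. \<bar>K z\<bar> \<partial>lborel) * \<bar>K y\<bar>)"
          using Gabs c0 by (auto simp: abs_mult)
      qed simp
      have "integrable lborel (\<lambda>z. (V z * K (z + y)) * K y)" for y using iVK[of y] by simp
      then show "AE y in lborel. integrable lborel (\<lambda>z. case (y, z) of (y, z) \<Rightarrow> G y z)"
        by (simp add: G_def ac_simps)
    qed simp
    have "(\<integral>p. V (snd p - fst p) * (K (fst p) * K (snd p)) \<partial>lborel)
        = (\<integral>y. (\<integral>w. V (w - y) * (K y * K w) \<partial>lborel) \<partial>lborel)"
      using lborel_pair.integral_fst'[OF i3] by (simp add: lborel_prod)
    also have "\<dots> = (\<integral>y. (\<integral>z. G y z \<partial>lborel) \<partial>lborel)"
    proof (rule Bochner_Integration.integral_cong[OF refl])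
      fix y :: 'a
      have "(\<integral>w. V (w - y) * (K y * K w) \<partial>lborel) = (\<integral>z. V (z + y - y) * (K y * K (z + y)) \<partial>lborel)"
        by (rule integral_lborel_translate'[symmetric]) measurable
      then show "(\<integral>w. V (w - y) * (K y * K w) \<partial>lborel) = (\<integral>z. G y z \<partial>lborel)" by (simp add: G_def)
    qed
    also have "\<dots> = (\<integral>z. (\<integral>y. G y z \<partial>lborel) \<partial>lborel)"
      by (rule lborel_pair.Fubini_integral[OF Gint, symmetric])
    finally have t3: "(\<integral>p. V (snd p - fst p) * (K (fst p) * K (snd p)) \<partial>lborel) = (\<integral>z. (\<integral>y. G y z \<partial>lborel) \<partial>lborel)" .
    have Gz: "integrable lborel (\<lambda>z. \<integral>y. G y z \<partial>lborel)" using lborel_pair.integrable_snd[OF Gint] by simp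
    have AEG: "AE z in lborel. integrable lborel (\<lambda>y. G y z)"
      using lborel_pair.AE_integrable_snd[OF Gint] by simp
    have "AE z in lborel. V z * square_kernel K z = 2 * m * (V z * K z) - (\<integral>y. G y z \<partial>lborel)"
      using AEG
    proof eventually_elim
      case (elim z)
      show ?case
      proof (cases "V z = 0")
        case True then show ?thesis by (simp add: G_def)
      next
        case False
        have "integrable lborel (\<lambda>y. G y z / V z)" using elim by simp
        then have KKz: "integrable lborel (\<lambda>y. K y * K (z + y))" using False by (simp add: G_def)
        have eqn: "K y * K (z - y) = K (- y) * K (z + - y)" for y by (simp add: even)
        have KKz': "integrable lborel (\<lambda>y. K y * K (z - y))"
          unfolding eqn using integrable_lborel_reflect[of "\<lambda>y. K y * K (z + y)"] KKz by simp
        have KKe: "(\<integral>y. K y * K (z - y) \<partial>lborel) = (\<integral>y. K y * K (z + y) \<partial>lborel)"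
          unfolding eqn using integral_lborel_reflect[of "\<lambda>y. K y * K (z + y)"] by simp
        have Kz: "integrable lborel (\<lambda>y. K (z - y))" "(\<integral>y. K (z - y) \<partial>lborel) = m"
          using integral_lborel_reflect_translate[of K z] K by (auto simp: m_def)
        have sk: "square_kernel K z = m * K z + m * K z - (\<integral>y. K y * K (z + y) \<partial>lborel)"
          unfolding square_kernel_def square_integrand_def
          using K Kz KKz' KKe by (simp add: m_def)
        have Gv: "(\<integral>y. G y z \<partial>lborel) = V z * (\<integral>y. K y * K (z + y) \<partial>lborel)" by (simp add: G_def)
        show ?thesis unfolding sk Gv by (simp add: algebra_simps)
      qed
    qed
    then have "(\<integral>z. V z * square_kernel K z \<partial>lborel) = (\<integral>z. 2 * m * (V z * K z) - (\<integral>y. G y z \<partial>lborel) \<partial>lborel)"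
      by (intro integral_cong_AE) auto
    also have "\<dots> = 2 * m * (\<integral>z. V z * K z \<partial>lborel) - (\<integral>z. (\<integral>y. G y z \<partial>lborel) \<partial>lborel)"
      using VK Gz by simp
    finally show ?thesis by (simp add: t1 t2 t3)
  qed
  finally show "(\<integral>x. (difference_op K u x)\<^sup>2 \<partial>lborel) = 1/2 * (\<integral>z. diff_energy u z * square_kernel K z \<partial>lborel)"
    by (simp add: V_def)
qed

section \<open>The operator in the mean-square sense\<close>

lemma cut_kern_even: "cut_kern s \<delta> (- y) = cut_kern s \<delta> y" by (simp add: cut_kern_def)

lemma cut_kern_eq_kern: "\<delta> \<le> norm y \<Longrightarrow> cut_kern s \<delta> y = kern s y"
  by (simp add: cut_kern_def kern_def max_def)

lemma cut_kern_nonneg: "cut_kern s \<delta> y \<ge> 0" by (simp add: cut_kern_def)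

lemma cut_kern_le:
  assumes "s > 0" "\<delta> > 0"
  shows "cut_kern s \<delta> (y::'a::euclidean_space) \<le> \<delta> powr (-(real DIM('a) + s))"
  unfolding cut_kern_def using assms by (intro powr_mono2') auto

lemma cut_kern_le_kern:
  assumes "s > 0" "(y::'a::euclidean_space) \<noteq> 0"
  shows "cut_kern s \<delta> y \<le> kern s y"
  unfolding cut_kern_def kern_def using assms by (intro powr_mono2') auto

lemma kern_integrable_outside:
  assumes s: "s > 0" and r: "r > 0"
  shows "integrable lborel (\<lambda>y::'a::euclidean_space. kern s y * indicator (- ball 0 r) y)"
  using power_integral_outside[OF s, where 'a='a] r unfolding kern_def by blast

lemma kern_outside_le:
  assumes "s > 0" "r > 0"
  shows "\<bar>kern s (y::'a::euclidean_space) * indicator (- ball 0 r) y\<bar> \<le> r powr (-(real DIM('a) + s))"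
proof (cases "norm y < r")
  case False
  then have "kern s y \<le> r powr (-(real DIM('a) + s))" using assms unfolding kern_def by (intro powr_mono2') auto
  then show ?thesis using False by (simp add: kern_nonneg)
qed simp

lemma kern_square_integrable_outside:
  assumes "s > 0" "r > 0"
  shows "square_integrable lborel (\<lambda>y::'a::euclidean_space. kern s y * indicator (- ball 0 r) y)"
  by (rule square_integrable_of_bounded[OF kern_integrable_outside[OF assms] kern_outside_le[OF assms]])

lemma cut_kern_integrable:
  assumes s: "s > 0" and \<delta>: "\<delta> > 0"
  shows "integrable lborel (cut_kern s \<delta> :: 'a::euclidean_space \<Rightarrow> real)"
proof (rule Bochner_Integration.integrable_bound)
  let ?b = "\<lambda>y::'a. \<delta> powr (-(real DIM('a) + s)) * indicator (ball 0 \<delta>) y + kern s y * indicator (- ball 0 \<delta>) y"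
  show "integrable lborel ?b"
    using kern_integrable_outside[OF s \<delta>, where 'a='a] integrable_indicator_ball[of "0::'a" \<delta>] by simp
  show "AE y in lborel. norm (cut_kern s \<delta> y) \<le> norm (?b y)"
    using cut_kern_le[OF s \<delta>] cut_kern_eq_kern[of \<delta> "_::'a" s] kern_nonneg[of s "_::'a"]
    by (intro AE_I2) (auto simp: indicator_def cut_kern_nonneg not_less)
qed simp

lemma cut_kern_tendsto:
  assumes "\<delta> \<longlonglongrightarrow> 0" and y: "y \<noteq> 0"
  shows "(\<lambda>n. cut_kern s (\<delta> n) y) \<longlonglongrightarrow> kern s y"
proof (rule tendsto_eventually)
  have "eventually (\<lambda>n. \<delta> n < norm y) sequentially"
    using order_tendstoD(2)[OF assms(1), of "norm y"] y by simp
  then show "eventually (\<lambda>n. cut_kern s (\<delta> n) y = kern s y) sequentially"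
    by eventually_elim (simp add: cut_kern_eq_kern)
qed

lemma difference_op_diff:
  fixes u :: "'a::euclidean_space \<Rightarrow> real"
  assumes u: "square_integrable lborel u" and "integrable lborel K" "integrable lborel K'"
  shows "AE x in lborel. difference_op (\<lambda>y. K y - K' y) u x = difference_op K u x - difference_op K' u x"
  using AE_difference_integrable[OF u assms(2)] AE_difference_integrable[OF u assms(3)]
  by eventually_elim (simp add: difference_op_def right_diff_distrib)

lemma difference_op_energy_tendsto:
  fixes u :: "'a::euclidean_space \<Rightarrow> real"
  assumes s: "0 < s" "s < 1" and u: "square_integrable lborel u"
    and fin: "integrable lborel (\<lambda>z. diff_energy u z * kern (2 * s) z)"
    and K: "\<And>n::nat. kernel_bounds s L (K n)" "\<And>n. integrable lborel (K n)" "\<And>n y. K n (- y) = K n y"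
    and K': "K' \<in> borel_measurable borel" and lim: "\<And>y. y \<noteq> 0 \<Longrightarrow> (\<lambda>n. K n y) \<longlonglongrightarrow> K' y"
  shows "(\<lambda>n. \<integral>x. (difference_op (K n) u x)\<^sup>2 \<partial>lborel) \<longlonglongrightarrow> 1/2 * (\<integral>z. diff_energy u z * square_kernel K' z \<partial>lborel)"
proof -
  obtain C where C: "C \<ge> 0" "\<And>L (K::'a \<Rightarrow> real) z. kernel_bounds s L K \<Longrightarrow> z \<noteq> 0 \<Longrightarrow> \<bar>square_kernel K z\<bar> \<le> C * L\<^sup>2 * kern (2 * s) z"
    using square_kernel_bound(1)[OF s, where 'a='a] by blast
  have [measurable]: "u \<in> borel_measurable borel" using u by (rule square_integrable_lborel_measurable)
  have Km[measurable]: "K n \<in> borel_measurable borel" for n using K(1) by (rule kernel_bounds_measurable)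
  have "(\<lambda>n. \<integral>z. diff_energy u z * square_kernel (K n) z \<partial>lborel) \<longlonglongrightarrow> (\<integral>z. diff_energy u z * square_kernel K' z \<partial>lborel)"
  proof (rule integral_dominated_convergence)
    show "integrable lborel (\<lambda>z. C * L\<^sup>2 * (diff_energy u z * kern (2 * s) z))" using fin by simp
    show "AE z in lborel. norm (diff_energy u z * square_kernel (K n) z) \<le> C * L\<^sup>2 * (diff_energy u z * kern (2 * s) z)" for n
      using AE_lborel_neq[of 0]
    proof eventually_elim
      case (elim z)
      have "diff_energy u z * \<bar>square_kernel (K n) z\<bar> \<le> diff_energy u z * (C * L\<^sup>2 * kern (2 * s) z)"
        using C(2)[OF K(1) elim] diff_energy_nonneg by (intro mult_left_mono) auto
      then show ?case using diff_energy_nonneg[of u z] by (simp add: abs_mult ac_simps)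
    qed
    show "AE z in lborel. (\<lambda>n. diff_energy u z * square_kernel (K n) z) \<longlonglongrightarrow> diff_energy u z * square_kernel K' z"
      using AE_lborel_neq[of 0]
      by eventually_elim (intro tendsto_intros square_kernel_tendsto[OF s K(1) K' lim])
  qed (use K' in measurable)
  then have "(\<lambda>n. 1/2 * (\<integral>z. diff_energy u z * square_kernel (K n) z \<partial>lborel)) \<longlonglongrightarrow> 1/2 * (\<integral>z. diff_energy u z * square_kernel K' z \<partial>lborel)"
    by (rule tendsto_mult_left)
  then show ?thesis unfolding difference_op_energy(2)[OF u K(2) K(3)] .
qed

text \<open>Differences of capped kernels satisfy uniform bounds and tend to zero pointwise, so their
  energies tend to zero by dominated convergence: the capped operators form a Cauchy sequence. The same argument
  applied to the capped kernels themselves computes the energy of the limit.\<close>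

theorem difference_op_mean_square_limit:
  fixes u :: "'a::euclidean_space \<Rightarrow> real"
  assumes s: "0 < s" "s < 1" and u: "square_integrable lborel u"
    and fin: "integrable lborel (\<lambda>z. diff_energy u z * kern (2 * s) z)"
    and c: "\<And>z::'a. z \<noteq> 0 \<Longrightarrow> square_kernel (kern s) z = c * kern (2 * s) z"
  shows "\<exists>g. square_integrable lborel g \<and>
     (\<lambda>n. \<integral>x. (difference_op (cut_kern s (1 / real (Suc n))) u x - g x)\<^sup>2 \<partial>lborel) \<longlonglongrightarrow> 0 \<and>
     (\<integral>x. (g x)\<^sup>2 \<partial>lborel) = c / 2 * (\<integral>z. diff_energy u z * kern (2 * s) z \<partial>lborel)"
proof -
  define L where "L = 1 + (real DIM('a) + s) * 2 powr ((real DIM('a) + s) + 1)"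
  define k where "k n = (cut_kern s (1 / real (Suc n)) :: 'a \<Rightarrow> real)" for n
  have kb: "kernel_bounds s L (k n)" for n
    unfolding k_def L_def by (rule kernel_bounds_cut) (use s in auto)
  have ki: "integrable lborel (k n)" for n
    unfolding k_def by (rule cut_kern_integrable) (use s in auto)
  have ke: "k n (- y) = k n y" for n y by (simp add: k_def cut_kern_even)
  have lim0: "(\<lambda>n. 1 / real (Suc n)) \<longlonglongrightarrow> 0" using LIMSEQ_Suc[OF lim_1_over_n] by simp
  have [measurable]: "k n \<in> borel_measurable borel" for n unfolding k_def by simp
  have [measurable]: "u \<in> borel_measurable borel" using u by (rule square_integrable_lborel_measurable)
  define f where "f n = difference_op (k n) u" for n
  have fs: "square_integrable lborel (f n)" for n
    unfolding f_def by (rule difference_op_energy(1)[OF u ki ke])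
  have cauchy: "\<exists>n0. \<forall>m\<ge>n0. \<forall>n\<ge>n0. (\<integral>x. (f m x - f n x)\<^sup>2 \<partial>lborel) < e" if e: "e > 0" for e
  proof (rule ccontr)
    assume "\<not> ?thesis"
    then have "\<forall>j. \<exists>m n. m \<ge> j \<and> n \<ge> j \<and> (\<integral>x. (f m x - f n x)\<^sup>2 \<partial>lborel) \<ge> e" by (auto simp: not_less)
    then obtain m n where mn: "\<And>j. m j \<ge> j" "\<And>j. n j \<ge> j" "\<And>j. (\<integral>x. (f (m j) x - f (n j) x)\<^sup>2 \<partial>lborel) \<ge> e"
      by metis
    have sub: "(\<lambda>j. 1 / real (Suc (r j))) \<longlonglongrightarrow> 0" if "\<And>j. r j \<ge> j" for r :: "nat \<Rightarrow> nat"
    proof (rule tendsto_sandwich[OF _ _ tendsto_const lim0])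
      show "\<forall>\<^sub>F j in sequentially. 1 / real (Suc (r j)) \<le> 1 / real (Suc j)"
        using that by (intro always_eventually allI divide_left_mono) auto
    qed auto
    have "(\<lambda>j. \<integral>x. (difference_op (\<lambda>y. k (m j) y - k (n j) y) u x)\<^sup>2 \<partial>lborel)
        \<longlonglongrightarrow> 1/2 * (\<integral>z. diff_energy u z * square_kernel (\<lambda>y::'a. 0) z \<partial>lborel)"
    proof (rule difference_op_energy_tendsto[OF s u fin])
      show "kernel_bounds s (2 * L) (\<lambda>y. k (m j) y - k (n j) y)" for j by (rule kernel_bounds_diff[OF kb kb])
      fix y :: 'a assume y: "y \<noteq> 0"
      have "(\<lambda>j. k (m j) y - k (n j) y) \<longlonglongrightarrow> kern s y - kern s y"
        unfolding k_def by (intro tendsto_diff cut_kern_tendsto[OF _ y] sub mn)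
      then show "(\<lambda>j. k (m j) y - k (n j) y) \<longlonglongrightarrow> 0" by simp
    qed (auto simp: ke intro: ki)
    also have "(\<lambda>j. \<integral>x. (difference_op (\<lambda>y. k (m j) y - k (n j) y) u x)\<^sup>2 \<partial>lborel) = (\<lambda>j. \<integral>x. (f (m j) x - f (n j) x)\<^sup>2 \<partial>lborel)"
    proof
      fix j
      show "(\<integral>x. (difference_op (\<lambda>y. k (m j) y - k (n j) y) u x)\<^sup>2 \<partial>lborel) = (\<integral>x. (f (m j) x - f (n j) x)\<^sup>2 \<partial>lborel)"
        using difference_op_diff[OF u ki ki, of "m j" "n j"]
        by (intro integral_cong_AE) (auto simp: f_def)
    qed
    finally have "(\<lambda>j. \<integral>x. (f (m j) x - f (n j) x)\<^sup>2 \<partial>lborel) \<longlonglongrightarrow> 0"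
      by (simp add: square_kernel_def square_integrand_def)
    then have "eventually (\<lambda>j. (\<integral>x. (f (m j) x - f (n j) x)\<^sup>2 \<partial>lborel) < e) sequentially"
      using e by (rule order_tendstoD(2))
    then show False using mn(3) by (auto simp: eventually_sequentially not_less[symmetric])
  qed
  obtain g where g: "square_integrable lborel g" "(\<lambda>n. \<integral>x. (f n x - g x)\<^sup>2 \<partial>lborel) \<longlonglongrightarrow> 0"
    using riesz_fischer[OF fs cauchy] by blast
  have l1: "(\<lambda>n. \<integral>x. (f n x)\<^sup>2 \<partial>lborel) \<longlonglongrightarrow> (\<integral>x. (g x)\<^sup>2 \<partial>lborel)"
    by (rule integral_tendsto_mean_square(2)[OF g(1) fs g(2) g(1)])
  have l2: "(\<lambda>n. \<integral>x. (f n x)\<^sup>2 \<partial>lborel) \<longlonglongrightarrow> 1/2 * (\<integral>z. diff_energy u z * square_kernel (kern s) z \<partial>lborel)"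
    unfolding f_def
    by (rule difference_op_energy_tendsto[OF s u fin kb ki ke])
       (simp_all only: k_def kern_measurable cut_kern_tendsto[OF lim0] not_False_eq_True)
  have "(\<integral>z. diff_energy u z * square_kernel (kern s) z \<partial>lborel) = (\<integral>z. c * (diff_energy u z * kern (2 * s) z) \<partial>lborel)"
  proof (rule integral_cong_AE)
    show "AE z in lborel. diff_energy u z * square_kernel (kern s) z = c * (diff_energy u z * kern (2 * s) z)"
      using AE_lborel_neq[of 0] by eventually_elim (simp add: c)
  qed auto
  then have "(\<integral>x. (g x)\<^sup>2 \<partial>lborel) = c / 2 * (\<integral>z. diff_energy u z * kern (2 * s) z \<partial>lborel)"
    using LIMSEQ_unique[OF l1 l2] by simp
  then show ?thesis using g unfolding f_def k_def by blast
qed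

section \<open>Almost everywhere convergence of the truncated integrals\<close>

text \<open>Averages over balls are taken with a Lipschitz profile, to which the operator applies without
  singularities.\<close>

definition tent :: "real \<Rightarrow> 'a::euclidean_space \<Rightarrow> real" where
  "tent e z = max 0 (1 - norm z / e) / (\<integral>w. max 0 (1 - norm (w::'a) / e) \<partial>lborel)"

lemma tent_measurable[measurable]: "tent e \<in> borel_measurable borel"
  unfolding tent_def[abs_def] by measurable

lemma tent_properties:
  "\<exists>B>0. \<forall>e>0. (\<forall>z::'a::euclidean_space. 0 \<le> tent e z \<and> tent e z \<le> B * e powr (- real DIM('a)) \<and> (e \<le> norm z \<longrightarrow> tent e z = 0))
     \<and> (\<forall>z w::'a. \<bar>tent e z - tent e w\<bar> \<le> B * e powr (- real DIM('a) - 1) * norm (z - w))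
     \<and> integrable lborel (tent e :: 'a \<Rightarrow> real) \<and> (\<integral>z. tent e (z::'a) \<partial>lborel) = 1"
proof -
  define N where "N = real DIM('a)"
  define b where "b = measure lborel (ball (0::'a) 1)"
  have b: "b > 0" unfolding b_def using content_ball_pos[of 1 "0::'a"] by simp
  define M where "M e = (\<integral>w. max 0 (1 - norm (w::'a) / e) \<partial>lborel)" for e
  define B where "B = 2 * 2 powr N / b"
  have B: "B > 0" using b by (simp add: B_def)
  have int: "integrable lborel (\<lambda>w::'a. max 0 (1 - norm w / e))" if e: "e > 0" for e :: real
  proof (rule Bochner_Integration.integrable_bound)
    show "integrable lborel (indicator (ball (0::'a) e) :: 'a \<Rightarrow> real)" by (rule integrable_indicator_ball)
    show "AE w::'a in lborel. norm (max 0 (1 - norm w / e)) \<le> norm (indicator (ball 0 e) w :: real)"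
      using e by (intro AE_I2) (auto simp: indicator_def max_def field_simps)
  qed measurable
  have M: "1 / B * e powr N \<le> M e" if e: "e > 0" for e
  proof -
    have "1 / B * e powr N = (\<integral>w. 1/2 * indicator (ball (0::'a) (e/2)) w \<partial>lborel)"
    proof -
      have "measure lborel (ball (0::'a) (e/2)) = b * (e/2) powr N"
        using emeasure_ball_powr[of "e/2" "0::'a"] e b by (simp add: measure_def b_def N_def)
      then show ?thesis using e by (simp add: B_def powr_divide)
    qed
    also have "\<dots> \<le> M e" unfolding M_def
    proof (rule integral_mono)
      show "integrable lborel (\<lambda>w::'a. 1/2 * indicator (ball 0 (e/2)) w :: real)"
        using integrable_indicator_ball[of "0::'a" "e/2"] by simp
      fix w :: 'a show "1/2 * indicator (ball 0 (e/2)) w \<le> max 0 (1 - norm w / e)"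
        using e by (auto simp: indicator_def max_def field_simps)
    qed (rule int[OF e])
    finally show ?thesis .
  qed
  have Mpos: "M e > 0" if "e > 0" for e
  proof -
    have "1 / B * e powr N > 0" using B that by simp
    then show ?thesis using M[OF that] by linarith
  qed
  have iM: "1 / M e \<le> B * e powr (-N)" if e: "e > 0" for e
  proof -
    have "1 / M e \<le> 1 / (1 / B * e powr N)" using M[OF e] B e Mpos[OF e] by (intro divide_left_mono) auto
    then show ?thesis by (simp add: powr_minus_divide)
  qed
  have tn: "tent e z = max 0 (1 - norm z / e) / M e" for e and z :: 'a by (simp add: tent_def M_def)
  show ?thesis
  proof (intro exI[of _ B] conjI allI impI B)
    fix e :: real assume e: "e > 0"
    note Mp = Mpos[OF e]
    show t0: "0 \<le> tent e z" for z :: 'a using Mp by (simp add: tn)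
    show "tent e z \<le> B * e powr (- real DIM('a))" for z :: 'a
    proof -
      have "tent e z \<le> 1 / M e" unfolding tn using Mp e by (intro divide_right_mono) auto
      then show ?thesis using iM[OF e] by (simp add: N_def)
    qed
    show "tent e z = 0" if "e \<le> norm z" for z :: 'a using that e by (simp add: tn max_def field_simps)
    show "integrable lborel (tent e :: 'a \<Rightarrow> real)" unfolding tn[abs_def] using int[OF e] by simp
    show "(\<integral>z. tent e (z::'a) \<partial>lborel) = 1" unfolding tn using Mp by (simp add: M_def)
    show "\<bar>tent e z - tent e w\<bar> \<le> B * e powr (- real DIM('a) - 1) * norm (z - w)" for z w :: 'a
    proof -
      have "\<bar>max 0 (1 - norm z / e) - max 0 (1 - norm w / e)\<bar> \<le> \<bar>norm z / e - norm w / e\<bar>" by linarith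
      also have "\<dots> = \<bar>norm z - norm w\<bar> / e" using e by (simp add: diff_divide_distrib[symmetric])
      also have "\<dots> \<le> norm (z - w) / e" using e by (intro divide_right_mono norm_triangle_ineq3) auto
      finally have "\<bar>tent e z - tent e w\<bar> \<le> 1 / M e * (norm (z - w) / e)"
        unfolding tn diff_divide_distrib[symmetric] using Mp by (simp add: field_simps)
      also have "\<dots> \<le> (B * e powr (-N)) * (norm (z - w) / e)" using iM[OF e] e by (intro mult_right_mono) auto
      also have "\<dots> = B * (e powr (-N) / e) * norm (z - w)" by simp
      also have "e powr (-N) / e = e powr (-N - 1)" using e by (simp add: powr_diff)
      finally show ?thesis by (simp add: N_def)
    qed
  qed
qed

lemma tent_square_integrable: "e > 0 \<Longrightarrow> square_integrable lborel (tent e :: 'a::euclidean_space \<Rightarrow> real)"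
  using tent_properties[where 'a='a] by (metis abs_of_nonneg square_integrable_of_bounded)

text \<open>Two applications of Fubini's theorem; in between, \<open>z\<close> is shifted by \<open>y\<close> and \<open>y\<close> is reflected.\<close>

lemma difference_op_adjoint:
  fixes h W K :: "'a::euclidean_space \<Rightarrow> real"
  assumes [measurable]: "h \<in> borel_measurable borel" "W \<in> borel_measurable borel"
    and K: "integrable lborel K" and even: "\<And>y. K (- y) = K y"
    and int: "\<And>y. integrable lborel (\<lambda>z. h z * W (z + y))"
    and bd: "\<And>y. (\<integral>z. \<bar>h z * W (z + y)\<bar> \<partial>lborel) \<le> c"
  shows "(\<integral>z. h z * (\<integral>y. (W (z + y) - W z) * K y \<partial>lborel) \<partial>lborel)
       = - (\<integral>z. difference_op K h z * W z \<partial>lborel)"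
proof -
  have [measurable]: "K \<in> borel_measurable borel" using K by auto
  have c0: "c \<ge> 0" using bd[of 0] by (rule order_trans[rotated]) simp
  have prod: "integrable (lborel \<Otimes>\<^sub>M lborel) (\<lambda>(y, z). H y z * K y)"
    if Hm[measurable]: "(\<lambda>(y, z). H y z) \<in> borel_measurable (lborel \<Otimes>\<^sub>M lborel)"
      and Hi: "\<And>y. integrable lborel (H y)" and Hb: "\<And>y. (\<integral>z. \<bar>H y z\<bar> \<partial>lborel) \<le> 2 * c" for H :: "'a \<Rightarrow> 'a \<Rightarrow> real"
  proof (rule lborel_pair.Fubini_integrable)
    have [measurable]: "(\<lambda>y. \<integral>z. \<bar>H y z * K y\<bar> \<partial>lborel) \<in> borel_measurable lborel" by measurable
    show "integrable lborel (\<lambda>y. \<integral>z. norm (case (y, z) of (y, z) \<Rightarrow> H y z * K y) \<partial>lborel)"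
    proof (rule Bochner_Integration.integrable_bound)
      show "integrable lborel (\<lambda>y. 2 * c * \<bar>K y\<bar>)" using K by simp
      show "AE y in lborel. norm (\<integral>z. norm (case (y, z) of (y, z) \<Rightarrow> H y z * K y) \<partial>lborel) \<le> norm (2 * c * \<bar>K y\<bar>)"
      proof (rule AE_I2)
        fix y
        have "(\<integral>z. \<bar>H y z * K y\<bar> \<partial>lborel) = (\<integral>z. \<bar>H y z\<bar> \<partial>lborel) * \<bar>K y\<bar>" by (simp add: abs_mult)
        also have "\<dots> \<le> 2 * c * \<bar>K y\<bar>" using Hb[of y] by (intro mult_right_mono) auto
        finally show "norm (\<integral>z. norm (case (y, z) of (y, z) \<Rightarrow> H y z * K y) \<partial>lborel) \<le> norm (2 * c * \<bar>K y\<bar>)"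
          using c0 by (simp add: abs_mult)
      qed
    qed simp
  qed (use Hi in auto)
  have tr: "integrable lborel (\<lambda>z. h (z - y) * W z)" "(\<integral>z. \<bar>h (z - y) * W z\<bar> \<partial>lborel) \<le> c"
     "(\<integral>z. h (z - y) * W z \<partial>lborel) = (\<integral>z. h z * W (z + y) \<partial>lborel)" for y
  proof -
    have [measurable]: "(\<lambda>z. h (z - y) * W z) \<in> borel_measurable borel" by measurable
    show "integrable lborel (\<lambda>z. h (z - y) * W z)"
      using integrable_lborel_translate[of "\<lambda>z. h (z - y) * W z" y] int[of y] by (simp add: add.commute)
    show "(\<integral>z. \<bar>h (z - y) * W z\<bar> \<partial>lborel) \<le> c"
      using integral_lborel_translate'[of "\<lambda>z. \<bar>h (z - y) * W z\<bar>" y] bd[of y] by simp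
    show "(\<integral>z. h (z - y) * W z \<partial>lborel) = (\<integral>z. h z * W (z + y) \<partial>lborel)"
      using integral_lborel_translate'[of "\<lambda>z. h (z - y) * W z" y] by simp
  qed
  have tr': "integrable lborel (\<lambda>z. h (z + y) * W z)" "(\<integral>z. \<bar>h (z + y) * W z\<bar> \<partial>lborel) \<le> c" for y
    using tr(1,2)[of "- y"] by simp_all
  have int0: "integrable lborel (\<lambda>z. h z * W z)" "(\<integral>z. \<bar>h z * W z\<bar> \<partial>lborel) \<le> c"
    using int[of 0] bd[of 0] by simp_all
  define H1 where "H1 y z = h z * (W (z + y) - W z)" for y z
  define H2 where "H2 y z = (h (z + y) - h z) * W z" for y z
  have sub: "integrable lborel (\<lambda>z. f z - g z) \<and> (\<integral>z. \<bar>f z - g z\<bar> \<partial>lborel) \<le> 2 * c"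
    if "integrable lborel f" "integrable lborel g" "(\<integral>z. \<bar>f z\<bar> \<partial>lborel) \<le> c" "(\<integral>z. \<bar>g z\<bar> \<partial>lborel) \<le> c" for f g :: "'a \<Rightarrow> real"
  proof
    have "(\<integral>z. \<bar>f z - g z\<bar> \<partial>lborel) \<le> (\<integral>z. \<bar>f z\<bar> + \<bar>g z\<bar> \<partial>lborel)"
      using that by (intro integral_mono) (auto intro!: integrable_abs Bochner_Integration.integrable_diff)
    also have "\<dots> = (\<integral>z. \<bar>f z\<bar> \<partial>lborel) + (\<integral>z. \<bar>g z\<bar> \<partial>lborel)" using that by simp
    finally show "(\<integral>z. \<bar>f z - g z\<bar> \<partial>lborel) \<le> 2 * c" using that by simp
  qed (use that in simp)
  have H1: "integrable lborel (H1 y) \<and> (\<integral>z. \<bar>H1 y z\<bar> \<partial>lborel) \<le> 2 * c" for y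
    using sub[OF int int0(1) bd int0(2), of y] unfolding H1_def by (simp add: right_diff_distrib)
  have H2: "integrable lborel (H2 y) \<and> (\<integral>z. \<bar>H2 y z\<bar> \<partial>lborel) \<le> 2 * c" for y
    using sub[OF tr'(1) int0(1) tr'(2) int0(2), of y] unfolding H2_def by (simp add: left_diff_distrib)
  have m1: "(\<lambda>(y, z). H1 y z) \<in> borel_measurable (lborel \<Otimes>\<^sub>M lborel)"
    and m2: "(\<lambda>(y, z). H2 y z) \<in> borel_measurable (lborel \<Otimes>\<^sub>M lborel)"
    unfolding H1_def H2_def by measurable
  have P1: "integrable (lborel \<Otimes>\<^sub>M lborel) (\<lambda>(y, z). H1 y z * K y)" by (rule prod[OF m1]) (use H1 in auto)
  have P2: "integrable (lborel \<Otimes>\<^sub>M lborel) (\<lambda>(y, z). H2 y z * K y)" by (rule prod[OF m2]) (use H2 in auto)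
  have "(\<integral>z. h z * (\<integral>y. (W (z + y) - W z) * K y \<partial>lborel) \<partial>lborel) = (\<integral>z. (\<integral>y. H1 y z * K y \<partial>lborel) \<partial>lborel)"
    by (simp add: H1_def mult.assoc)
  also have "\<dots> = (\<integral>y. (\<integral>z. H1 y z * K y \<partial>lborel) \<partial>lborel)" by (rule lborel_pair.Fubini_integral[OF P1])
  also have "\<dots> = (\<integral>y. (\<integral>z. H1 y z \<partial>lborel) * K y \<partial>lborel)" by simp
  also have "\<dots> = (\<integral>y. (\<integral>z. H2 (- y) z \<partial>lborel) * K (- y) \<partial>lborel)"
  proof -
    have "(\<integral>z. H1 y z \<partial>lborel) = (\<integral>z. H2 (- y) z \<partial>lborel)" for y
      unfolding H1_def H2_def right_diff_distrib left_diff_distrib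
      using int[of y] int0 tr(1,3)[of y] by simp
    then show ?thesis by (simp add: even)
  qed
  also have "\<dots> = (\<integral>y. (\<integral>z. H2 y z \<partial>lborel) * K y \<partial>lborel)"
    by (rule integral_lborel_reflect) (use m2 in measurable)
  also have "\<dots> = (\<integral>y. (\<integral>z. H2 y z * K y \<partial>lborel) \<partial>lborel)" by simp
  also have "\<dots> = (\<integral>z. (\<integral>y. H2 y z * K y \<partial>lborel) \<partial>lborel)" by (rule lborel_pair.Fubini_integral[OF P2, symmetric])
  also have "\<dots> = (\<integral>z. - (difference_op K h z * W z) \<partial>lborel)"
  proof (rule Bochner_Integration.integral_cong[OF refl])
    fix z
    have "(\<integral>y. H2 y z * K y \<partial>lborel) = (\<integral>y. (- W z) * ((h z - h (z + y)) * K y) \<partial>lborel)"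
      by (intro Bochner_Integration.integral_cong refl) (simp add: H2_def algebra_simps)
    then show "(\<integral>y. H2 y z * K y \<partial>lborel) = - (difference_op K h z * W z)"
      by (simp add: difference_op_def)
  qed
  finally show ?thesis by simp
qed

text \<open>Bounds for the operator applied to the tent function, uniform in the cutoff. Inside \<open>ball 0 (2 e)\<close>
  they follow from the Lipschitz bound; outside, \<open>tent e\<close> averages the smooth kernel over a ball of
  radius \<open>e\<close>, so that \<open>- cut_kern s \<delta> z\<close> is reproduced up to a first-order error.\<close>

lemma difference_op_tent:
  assumes s: "0 < s" "s < 1"
  obtains C where "C > 0"
    "\<And>e \<delta> (z::'a::euclidean_space). e > 0 \<Longrightarrow> \<delta> \<ge> 0 \<Longrightarrow>
        \<bar>difference_op (cut_kern s \<delta>) (tent e) z\<bar> \<le> C * e powr (-(real DIM('a) + s))"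
    "\<And>e \<delta> (z::'a). e > 0 \<Longrightarrow> \<delta> \<ge> 0 \<Longrightarrow> 2 * e \<le> norm z \<Longrightarrow>
        \<bar>cut_kern s \<delta> z + difference_op (cut_kern s \<delta>) (tent e) z\<bar> \<le> C * e * norm z powr (-(real DIM('a) + s) - 1)"
    "\<And>e \<delta> (z::'a). e > 0 \<Longrightarrow> \<delta> \<longlonglongrightarrow> 0 \<Longrightarrow>
        (\<lambda>n. difference_op (cut_kern s (\<delta> n)) (tent e) z) \<longlonglongrightarrow> difference_op (kern s) (tent e) z"
proof -
  define N where "N = real DIM('a)"
  have N1: "N \<ge> 1" using DIM_positive[where 'a='a] by (simp add: N_def Suc_leI)
  define p where "p = N + s"
  have p: "p > 0" using N1 s by (simp add: p_def)
  obtain B where B: "B > 0"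
    "\<And>e (z::'a). e > 0 \<Longrightarrow> 0 \<le> tent e z"
    "\<And>e (z::'a). e > 0 \<Longrightarrow> tent e z \<le> B * e powr (-N)"
    "\<And>e (z::'a) w. e > 0 \<Longrightarrow> \<bar>tent e z - tent e w\<bar> \<le> B * e powr (-N - 1) * norm (z - w)"
    "\<And>e (z::'a). e > 0 \<Longrightarrow> e \<le> norm z \<Longrightarrow> tent e z = 0"
    "\<And>e. e > 0 \<Longrightarrow> integrable lborel (tent e :: 'a \<Rightarrow> real)"
    "\<And>e. e > 0 \<Longrightarrow> (\<integral>z. tent e (z::'a) \<partial>lborel) = 1"
  proof -
    show ?thesis using tent_properties[where 'a='a, folded N_def] by (elim exE conjE) (rule that, auto)
  qed
  obtain C1 where C1: "C1 \<ge> 0" "\<And>R. R > 0 \<Longrightarrow> integrable lborel (\<lambda>y::'a. norm y powr ((1 - s) - N) * indicator (ball 0 R) y)"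
      "\<And>R. R > 0 \<Longrightarrow> (\<integral>y. norm (y::'a) powr ((1 - s) - N) * indicator (ball 0 R) y \<partial>lborel) \<le> C1 * R powr (1 - s)"
    using power_integral_inside[where 'a='a, of "1 - s"] s unfolding N_def by auto
  obtain C2 where C2: "C2 \<ge> 0" "\<And>R. R > 0 \<Longrightarrow> integrable lborel (\<lambda>y::'a. norm y powr (-p) * indicator (- ball 0 R) y)"
      "\<And>R. R > 0 \<Longrightarrow> (\<integral>y. norm (y::'a) powr (-p) * indicator (- ball 0 R) y \<partial>lborel) \<le> C2 * R powr (-s)"
    using power_integral_outside[where 'a='a, of s] s unfolding N_def p_def by auto
  have [measurable]: "ball (0::'a) r \<in> sets borel" for r by auto
  define L where "L = 1 + p * 2 powr (p + 1)"
  have kb: "kernel_bounds s L (cut_kern s \<delta> :: 'a \<Rightarrow> real)" if "\<delta> \<ge> 0" for \<delta>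
    unfolding L_def p_def N_def by (rule kernel_bounds_cut) (use s that in auto)
  have L: "L \<ge> 1" using p by (simp add: L_def)
  (* m e dominates the integrand of the operator at every point, by the Lipschitz bound near 0 and the sup bound away from 0. *)
  define m where "m e y = B * e powr (-N - 1) * (norm y powr ((1 - s) - N) * indicator (ball 0 e) y)
      + B * e powr (-N) * (norm y powr (-p) * indicator (- ball 0 e) y)" for e and y :: 'a
  have m0: "m e y \<ge> 0" for e y using B(1) unfolding m_def by (intro add_nonneg_nonneg mult_nonneg_nonneg) auto
  have mint: "integrable lborel (m e)" if "e > 0" for e
    unfolding m_def[abs_def] using C1(2)[OF that] C2(2)[OF that] by simp
  have mval: "(\<integral>y. m e y \<partial>lborel) \<le> B * (C1 + C2) * e powr (-p)" if e: "e > 0" for e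
  proof -
    have "(\<integral>y. m e y \<partial>lborel) = B * e powr (-N - 1) * (\<integral>y. norm (y::'a) powr ((1 - s) - N) * indicator (ball 0 e) y \<partial>lborel)
        + B * e powr (-N) * (\<integral>y. norm (y::'a) powr (-p) * indicator (- ball 0 e) y \<partial>lborel)"
      unfolding m_def using C1(2)[OF e] C2(2)[OF e] by simp
    also have "\<dots> \<le> B * e powr (-N - 1) * (C1 * e powr (1 - s)) + B * e powr (-N) * (C2 * e powr (-s))"
      using B(1) by (intro add_mono mult_left_mono C1 C2 e) auto
    also have "\<dots> = B * C1 * (e powr (-N - 1) * e powr (1 - s)) + B * C2 * (e powr (-N) * e powr (-s))" by simp
    also have "\<dots> = B * (C1 + C2) * e powr (-p)"
    proof -
      have "-N - 1 + (1 - s) = -p" "-N + -s = -p" by (simp_all add: p_def)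
      then show ?thesis unfolding powr_add[symmetric] by (simp only: distrib_left distrib_right)
    qed
    finally show ?thesis .
  qed
  have bound: "\<bar>(tent e z - tent e (z + y)) * cut_kern s \<delta> y\<bar> \<le> m e y"
    if e: "e > 0" and y: "y \<noteq> 0" for e \<delta> and z y :: 'a
  proof -
    have k: "cut_kern s \<delta> y \<le> norm y powr (-p)"
      using cut_kern_le_kern[OF s(1) y, of \<delta>] by (simp add: kern_def p_def N_def)
    show ?thesis
    proof (cases "norm y < e")
      case True
      have "\<bar>tent e z - tent e (z + y)\<bar> \<le> B * e powr (-N - 1) * norm y" using B(4)[OF e, of z "z + y"] by simp
      then have "\<bar>(tent e z - tent e (z + y)) * cut_kern s \<delta> y\<bar> \<le> (B * e powr (-N - 1) * norm y) * norm y powr (-p)"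
        unfolding abs_mult using k cut_kern_nonneg[of s \<delta> y] by (intro mult_mono) auto
      also have "\<dots> = B * e powr (-N - 1) * (norm y * norm y powr (-p))" by simp
      also have "norm y * norm y powr (-p) = norm y powr (1 + -p)"
        using y by (simp add: powr_diff powr_minus_divide)
      also have "1 + -p = (1 - s) - N" by (simp add: p_def)
      finally show ?thesis using True by (simp add: m_def)
    next
      case False
      have "\<bar>tent e z - tent e (z + y)\<bar> \<le> B * e powr (-N)"
        using B(2,3)[OF e, of z] B(2,3)[OF e, of "z + y"] by linarith
      then have "\<bar>(tent e z - tent e (z + y)) * cut_kern s \<delta> y\<bar> \<le> (B * e powr (-N)) * norm y powr (-p)"
        unfolding abs_mult using k cut_kern_nonneg[of s \<delta> y] B(1) by (intro mult_mono) auto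
      then show ?thesis using False by (simp add: m_def)
    qed
  qed
  have intg: "integrable lborel (\<lambda>y. (tent e z - tent e (z + y)) * cut_kern s \<delta> y)" if e: "e > 0" for e \<delta> and z :: 'a
  proof (rule Bochner_Integration.integrable_bound[OF mint[OF e]])
    show "AE y in lborel. norm ((tent e z - tent e (z + y)) * cut_kern s \<delta> y) \<le> norm (m e y)"
      using AE_lborel_neq[of 0] by eventually_elim (use bound[OF e] m0[of e] in auto)
  qed measurable
  define C where "C = B * (C1 + C2) + L"
  show thesis
  proof (rule that)
    show "C > 0" using B(1) C1(1) C2(1) L by (simp add: C_def add_nonneg_pos)
    show "\<bar>difference_op (cut_kern s \<delta>) (tent e) z\<bar> \<le> C * e powr (-(real DIM('a) + s))"
      if e: "e > 0" for e \<delta> and z :: 'a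
    proof -
      have "\<bar>difference_op (cut_kern s \<delta>) (tent e) z\<bar> \<le> (\<integral>y. m e y \<partial>lborel)"
        unfolding difference_op_def
      proof (rule order_trans[OF integral_abs_bound], rule integral_mono_AE)
        show "AE y in lborel. \<bar>(tent e z - tent e (z + y)) * cut_kern s \<delta> y\<bar> \<le> m e y"
          using AE_lborel_neq[of 0] by eventually_elim (rule bound[OF e])
      qed (use intg[OF e] mint[OF e] in \<open>auto intro: integrable_abs\<close>)
      also have "\<dots> \<le> C * e powr (-p)"
        using mval[OF e] L by (simp add: C_def distrib_right add_increasing2)
      finally show ?thesis by (simp add: p_def N_def)
    qed
    show "(\<lambda>n. difference_op (cut_kern s (\<delta> n)) (tent e) z) \<longlonglongrightarrow> difference_op (kern s) (tent e) z"
      if e: "e > 0" and d: "\<delta> \<longlonglongrightarrow> 0" for e \<delta> and z :: 'a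
      unfolding difference_op_def
    proof (rule integral_dominated_convergence[OF _ _ mint[OF e]])
      show "AE y in lborel. norm ((tent e z - tent e (z + y)) * cut_kern s (\<delta> n) y) \<le> m e y" for n
        using AE_lborel_neq[of 0] by eventually_elim (use bound[OF e] in auto)
      show "AE y in lborel. (\<lambda>n. (tent e z - tent e (z + y)) * cut_kern s (\<delta> n) y)
          \<longlonglongrightarrow> (tent e z - tent e (z + y)) * kern s y"
        using AE_lborel_neq[of 0] by eventually_elim (intro tendsto_mult_left cut_kern_tendsto[OF d])
    qed measurable
    show "\<bar>cut_kern s \<delta> z + difference_op (cut_kern s \<delta>) (tent e) z\<bar> \<le> C * e * norm z powr (-(real DIM('a) + s) - 1)"
      if e: "e > 0" and d: "\<delta> \<ge> 0" and z: "2 * e \<le> norm z" for e \<delta> and z :: 'a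
    proof -
      have z0: "z \<noteq> 0" using z e by auto
      have tz: "tent e z = 0" using B(5)[OF e, of z] z e by simp
      define k where "k = (cut_kern s \<delta> :: 'a \<Rightarrow> real)"
      have [measurable]: "k \<in> borel_measurable borel" by (simp add: k_def)
      have kd: "\<bar>tent e w * (k z - k (z - w))\<bar> \<le> tent e w * (L * (e * norm z powr (-p - 1)))" for w
      proof (cases "norm w < e")
        case True
        then have "norm w \<le> norm z / 2" using z by simp
        then have "\<bar>k z - k (z - w)\<bar> \<le> L * (norm w * norm z powr (-p - 1))"
          using kb[OF d] z0 by (simp add: kernel_bounds_def k_def p_def N_def)
        also have "\<dots> \<le> L * (e * norm z powr (-p - 1))" using True L by (intro mult_left_mono mult_right_mono) auto
        finally show ?thesis unfolding abs_mult using B(2)[OF e, of w] by (simp add: mult_left_mono)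
      next
        case False then show ?thesis using B(5)[OF e, of w] by simp
      qed
      have i1: "integrable lborel (\<lambda>w::'a. tent e w * k z)" using B(6)[OF e] by simp
      have i3: "integrable lborel (\<lambda>w. tent e w * (k z - k (z - w)))"
      proof (rule Bochner_Integration.integrable_bound)
        show "integrable lborel (\<lambda>w::'a. tent e w * (L * (e * norm z powr (-p - 1))))" using B(6)[OF e] by simp
        show "AE w in lborel. norm (tent e w * (k z - k (z - w))) \<le> norm (tent e w * (L * (e * norm z powr (-p - 1))))"
        proof (rule AE_I2)
          fix w
          have "norm (tent e w * (k z - k (z - w))) \<le> tent e w * (L * (e * norm z powr (-p - 1)))"
            using kd[of w] by simp
          then show "norm (tent e w * (k z - k (z - w))) \<le> norm (tent e w * (L * (e * norm z powr (-p - 1))))"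
            by simp
        qed
      qed measurable
      have i2: "integrable lborel (\<lambda>w. tent e w * k (z - w))"
        using Bochner_Integration.integrable_diff[OF i1 i3] by (simp add: right_diff_distrib)
      have "difference_op k (tent e) z = (\<integral>y. - (tent e (z + y) * k y) \<partial>lborel)"
        unfolding difference_op_def by (simp add: tz)
      also have "\<dots> = (\<integral>y. - (tent e (z + y) * k (z - (z + y))) \<partial>lborel)"
        by (simp add: k_def cut_kern_even)
      also have "\<dots> = (\<integral>w. - (tent e w * k (z - w)) \<partial>lborel)"
        by (rule integral_lborel_translate) measurable
      finally have "difference_op k (tent e) z = - (\<integral>w. tent e w * k (z - w) \<partial>lborel)" by simp
      moreover have "k z = (\<integral>w. tent e (w::'a) * k z \<partial>lborel)" using B(7)[OF e] by simp
      ultimately have "k z + difference_op k (tent e) z = (\<integral>w. tent e w * (k z - k (z - w)) \<partial>lborel)"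
        using i1 i2 by (simp add: right_diff_distrib)
      also have "\<bar>\<dots>\<bar> \<le> (\<integral>w. tent e (w::'a) * (L * (e * norm z powr (-p - 1))) \<partial>lborel)"
      proof (rule order_trans[OF integral_abs_bound], rule integral_mono)
        show "integrable lborel (\<lambda>w::'a. tent e w * (L * (e * norm z powr (-p - 1))))" using B(6)[OF e] by simp
      qed (use kd i3 in \<open>auto intro: integrable_abs\<close>)
      also have "\<dots> = L * e * norm z powr (-p - 1)" using B(7)[OF e] by simp
      also have "\<dots> \<le> C * e * norm z powr (-p - 1)"
        using B(1) C1(1) C2(1) e by (intro mult_right_mono) (auto simp: C_def)
      finally show ?thesis by (simp add: k_def p_def N_def)
    qed
  qed
qed

text \<open>The truncated integrals whose limit defines the fractional Laplacian of order \<open>s\<close>, centred at the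
  origin in the variable \<open>z = y - x\<close> and without the normalising constant.\<close>

definition truncated :: "real \<Rightarrow> ('a::euclidean_space \<Rightarrow> real) \<Rightarrow> real \<Rightarrow> 'a \<Rightarrow> real" where
  "truncated s u e x = (\<integral>z. (u x - u (x + z)) * kern s z * indicator (- ball 0 e) z \<partial>lborel)"

text \<open>The mollification \<open>tent e * g\<close> of the mean-square limit has a pointwise meaning: moving the
  operator to the tent function leaves an absolutely convergent integral of \<open>u x - u (x + z)\<close>.\<close>

lemma tent_mean_of_limit:
  fixes u g :: "'a::euclidean_space \<Rightarrow> real"
  assumes s: "0 < s" "s < 1" and u: "square_integrable lborel u" and g: "square_integrable lborel g"
    and lim: "(\<lambda>n. \<integral>x. (difference_op (cut_kern s (1 / real (Suc n))) u x - g x)\<^sup>2 \<partial>lborel) \<longlonglongrightarrow> 0"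
    and e: "e > 0"
  shows "(\<integral>z. tent e z * g (x + z) \<partial>lborel) = - (\<integral>z. difference_op (kern s) (tent e) z * (u x - u (x + z)) \<partial>lborel)"
    and "integrable lborel (\<lambda>z. difference_op (kern s) (tent e) z * (u x - u (x + z)))"
proof -
  define p where "p = real DIM('a) + s"
  have p: "p > 0" using s by (simp add: p_def)
  have [measurable]: "u \<in> borel_measurable borel" "g \<in> borel_measurable borel"
    using u g by (auto intro: square_integrable_lborel_measurable)
  have [measurable]: "ball (0::'a) r \<in> sets borel" for r by auto
  obtain B where B: "B > 0" "\<And>z::'a. 0 \<le> tent e z" "\<And>z::'a. tent e z \<le> B * e powr (- real DIM('a))"
      "integrable lborel (tent e :: 'a \<Rightarrow> real)"
    using tent_properties[where 'a='a] e by blast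
  obtain C where C: "C > 0"
    "\<And>\<delta> (z::'a). \<delta> \<ge> 0 \<Longrightarrow> \<bar>difference_op (cut_kern s \<delta>) (tent e) z\<bar> \<le> C * e powr (-p)"
    "\<And>\<delta> (z::'a). \<delta> \<ge> 0 \<Longrightarrow> 2 * e \<le> norm z \<Longrightarrow>
        \<bar>cut_kern s \<delta> z + difference_op (cut_kern s \<delta>) (tent e) z\<bar> \<le> C * e * norm z powr (-p - 1)"
    "\<And>\<delta> (z::'a). \<delta> \<longlonglongrightarrow> 0 \<Longrightarrow>
        (\<lambda>n. difference_op (cut_kern s (\<delta> n)) (tent e) z) \<longlonglongrightarrow> difference_op (kern s) (tent e) z"
  proof (rule difference_op_tent[OF s, where 'a='a], goal_cases)
    case (1 C)
    show ?case
      by (rule 1(1)[OF 1(2)]) (use 1(3)[OF e] 1(4)[OF e] 1(5)[OF e] in \<open>auto simp: p_def\<close>)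
  qed
  (* H dominates the operator applied to the tent for all caps, and lies in both L^1 and L^2. *)
  define H where "H z = C * e powr (-p) * indicator (ball 0 (2 * e)) z + (1 + C) * (kern s z * indicator (- ball 0 (2 * e)) z)" for z :: 'a
  have Hm[measurable]: "H \<in> borel_measurable borel" unfolding H_def[abs_def] by measurable
  have Hint: "integrable lborel H"
    unfolding H_def[abs_def]
    using kern_integrable_outside[OF s(1), of "2 * e", where 'a='a] e integrable_indicator_ball[of "0::'a" "2 * e"] by simp
  have H0: "H z \<ge> 0" for z using C(1) kern_nonneg[of s z] by (simp add: H_def)
  have Hb: "H z \<le> C * e powr (-p) + (1 + C) * (2 * e) powr (-p)" for z
  proof (cases "norm z < 2 * e")
    case True then show ?thesis using C(1) by (simp add: H_def)
  next
    case False
    then have "kern s z \<le> (2 * e) powr (-p)" using e p unfolding kern_def p_def[symmetric] by (intro powr_mono2') auto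
    then have "(1 + C) * kern s z \<le> (1 + C) * (2 * e) powr (-p)" using C(1) by (intro mult_left_mono) auto
    then show ?thesis using False C(1) by (simp add: H_def add_increasing)
  qed
  have Hsq: "square_integrable lborel H"
    by (rule square_integrable_of_bounded[OF Hint, of "C * e powr (-p) + (1 + C) * (2 * e) powr (-p)"]) (use H0 Hb in auto)
  have DH: "\<bar>difference_op (cut_kern s \<delta>) (tent e) z\<bar> \<le> H z" if \<delta>: "\<delta> \<ge> 0" for \<delta> and z :: 'a
  proof (cases "norm z < 2 * e")
    case True then show ?thesis using C(2)[OF \<delta>, of z] by (simp add: H_def)
  next
    case False
    then have z0: "z \<noteq> 0" using e by auto
    have "cut_kern s \<delta> z \<le> kern s z" by (rule cut_kern_le_kern[OF s(1) z0])
    moreover have "C * e * norm z powr (-p - 1) \<le> C * kern s z"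
    proof -
      have "e * norm z powr (-p - 1) \<le> norm z * norm z powr (-p - 1)" using False e by (intro mult_right_mono) auto
      also have "\<dots> = kern s z" using z0 by (simp add: kern_def p_def powr_diff)
      finally show ?thesis using C(1) by (simp add: mult.assoc)
    qed
    ultimately have "\<bar>difference_op (cut_kern s \<delta>) (tent e) z\<bar> \<le> (1 + C) * kern s z"
      using C(3)[OF \<delta>, of z] False cut_kern_nonneg[of s \<delta> z] by (simp add: distrib_right)
    then show ?thesis using False by (simp add: H_def)
  qed
  define W where "W z = u x - u (x + z)" for z
  have [measurable]: "W \<in> borel_measurable borel" unfolding W_def by measurable
  have v: "square_integrable lborel (\<lambda>z. u (x + z))"
    using square_integrable_shift[OF u, of x] by (simp add: add.commute)
  have HW: "integrable lborel (\<lambda>z. H z * W z)"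
    using square_integrable_mult[OF Hsq v] Hint by (simp add: W_def right_diff_distrib)
  have DHW: "\<bar>difference_op (cut_kern s \<delta>) (tent e) z * W z\<bar> \<le> \<bar>H z * W z\<bar>" if "\<delta> \<ge> 0" for \<delta> z
    unfolding abs_mult using DH[OF that, of z] H0[of z] by (intro mult_right_mono) auto
  show i0: "integrable lborel (\<lambda>z. difference_op (kern s) (tent e) z * (u x - u (x + z)))"
  proof (rule Bochner_Integration.integrable_bound[OF HW])
    show "AE z in lborel. norm (difference_op (kern s) (tent e) z * (u x - u (x + z))) \<le> norm (H z * W z)"
      using DHW[of 0] by (simp add: W_def cut_kern_0)
  qed measurable
  define k where "k n = (cut_kern s (1 / real (Suc n)) :: 'a \<Rightarrow> real)" for n
  define f where "f n = difference_op (k n) u" for n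
  have ki: "integrable lborel (k n)" for n unfolding k_def by (rule cut_kern_integrable) (use s in auto)
  have ke: "k n (- y) = k n y" for n y by (simp add: k_def cut_kern_even)
  have lim0: "(\<lambda>n. 1 / real (Suc n)) \<longlonglongrightarrow> 0" using LIMSEQ_Suc[OF lim_1_over_n] by simp
  have fs: "square_integrable lborel (f n)" for n unfolding f_def by (rule difference_op_energy(1)[OF u ki ke])
  have tsq: "square_integrable lborel (tent e :: 'a \<Rightarrow> real)" by (rule tent_square_integrable[OF e])
  have eq: "(\<integral>z. tent e z * f n (x + z) \<partial>lborel) = - (\<integral>z. difference_op (k n) (tent e) z * W z \<partial>lborel)" for n
  proof -
    have vy: "square_integrable lborel (\<lambda>z. u (x + (z + y)))" for y
      using square_integrable_shift[OF u, of "x + y"] by (simp add: ac_simps)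
    have tW: "integrable lborel (\<lambda>z. tent e z * W (z + y))" for y
      using square_integrable_mult[OF tsq vy[of y]] B(4) by (simp add: W_def right_diff_distrib)
    have tWb: "(\<integral>z. \<bar>tent e z * W (z + y)\<bar> \<partial>lborel) \<le> \<bar>u x\<bar> * (\<integral>z. tent e (z::'a) \<partial>lborel) + (\<integral>z. (tent e (z::'a))\<^sup>2 \<partial>lborel) + (\<integral>z. (u z)\<^sup>2 \<partial>lborel)" for y
    proof -
      have "(\<integral>z. \<bar>tent e z * W (z + y)\<bar> \<partial>lborel) \<le> (\<integral>z. (\<bar>u x\<bar> * tent e z + (tent e z)\<^sup>2) + (u (x + (z + y)))\<^sup>2 \<partial>lborel)"
      proof (rule integral_mono)
        show "integrable lborel (\<lambda>z. \<bar>tent e z * W (z + y)\<bar>)" by (rule integrable_abs[OF tW])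
        show "integrable lborel (\<lambda>z. (\<bar>u x\<bar> * tent e z + (tent e z)\<^sup>2) + (u (x + (z + y)))\<^sup>2)"
          using B(4) tsq vy[of y] by (simp add: square_integrable_def)
        fix z
        have "tent e z * \<bar>W (z + y)\<bar> \<le> tent e z * (\<bar>u x\<bar> + \<bar>u (x + (z + y))\<bar>)"
          using B(2)[of z] unfolding W_def by (intro mult_left_mono) auto
        moreover have "tent e z * \<bar>u (x + (z + y))\<bar> \<le> (tent e z)\<^sup>2 + (u (x + (z + y)))\<^sup>2"
        proof -
          have "2 * (tent e z * \<bar>u (x + (z + y))\<bar>) \<le> (tent e z)\<^sup>2 + (u (x + (z + y)))\<^sup>2"
            using sum_squares_bound[of "tent e z" "\<bar>u (x + (z + y))\<bar>"] by simp
          moreover have "0 \<le> tent e z * \<bar>u (x + (z + y))\<bar>" using B(2)[of z] by simp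
          ultimately show ?thesis by linarith
        qed
        ultimately show "\<bar>tent e z * W (z + y)\<bar> \<le> (\<bar>u x\<bar> * tent e z + (tent e z)\<^sup>2) + (u (x + (z + y)))\<^sup>2"
          using B(2)[of z] by (simp add: abs_mult distrib_left mult.commute)
      qed
      also have "\<dots> = \<bar>u x\<bar> * (\<integral>z. tent e (z::'a) \<partial>lborel) + (\<integral>z. (tent e (z::'a))\<^sup>2 \<partial>lborel) + (\<integral>z. (u (x + (z + y)))\<^sup>2 \<partial>lborel)"
        using B(4) tsq vy[of y] by (simp add: square_integrable_def)
      also have "(\<integral>z. (u (x + (z + y)))\<^sup>2 \<partial>lborel) = (\<integral>z. (u z)\<^sup>2 \<partial>lborel)"
        using integral_lborel_translate'[of "\<lambda>z. (u z)\<^sup>2" "x + y"] by (simp add: ac_simps)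
      finally show ?thesis .
    qed
    have "f n (x + z) = (\<integral>y. (W (z + y) - W z) * k n y \<partial>lborel)" for z
      by (simp add: f_def difference_op_def W_def add.assoc)
    then show ?thesis
      using difference_op_adjoint[OF tent_measurable _ ki ke tW tWb, of n] by simp
  qed
  have l1: "(\<lambda>n. \<integral>z. tent e z * f n (x + z) \<partial>lborel) \<longlonglongrightarrow> (\<integral>z. tent e z * g (x + z) \<partial>lborel)"
  proof -
    have ts: "square_integrable lborel (\<lambda>z. tent e (z - x))"
      using square_integrable_shift[OF tsq, of "- x"] by simp
    have [measurable]: "f n \<in> borel_measurable borel" for n using fs by (rule square_integrable_lborel_measurable)
    have "(\<integral>z. tent e (z - x) * h z \<partial>lborel) = (\<integral>z. tent e z * h (x + z) \<partial>lborel)" if [measurable]: "h \<in> borel_measurable borel" for h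
      using integral_lborel_translate[of "\<lambda>z. tent e (z - x) * h z" x] by simp
    then show ?thesis
      using integral_tendsto_mean_square(1)[OF g fs _ ts] lim by (simp add: f_def k_def)
  qed
  have l2: "(\<lambda>n. \<integral>z. difference_op (k n) (tent e) z * W z \<partial>lborel) \<longlonglongrightarrow> (\<integral>z. difference_op (kern s) (tent e) z * W z \<partial>lborel)"
  proof (rule integral_dominated_convergence[OF _ _ integrable_abs[OF HW]])
    show "AE z in lborel. norm (difference_op (k n) (tent e) z * W z) \<le> \<bar>H z * W z\<bar>" for n
      using DHW[of "1 / real (Suc n)"] by (simp add: k_def)
    show "AE z in lborel. (\<lambda>n. difference_op (k n) (tent e) z * W z) \<longlonglongrightarrow> difference_op (kern s) (tent e) z * W z"
      unfolding k_def by (intro AE_I2 tendsto_mult_right C(4) lim0)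
  qed (unfold k_def, measurable)
  have "(\<lambda>n. \<integral>z. tent e z * f n (x + z) \<partial>lborel) \<longlonglongrightarrow> - (\<integral>z. difference_op (kern s) (tent e) z * W z \<partial>lborel)"
    unfolding eq by (rule tendsto_minus[OF l2])
  from LIMSEQ_unique[OF l1 this]
  show "(\<integral>z. tent e z * g (x + z) \<partial>lborel) = - (\<integral>z. difference_op (kern s) (tent e) z * (u x - u (x + z)) \<partial>lborel)"
    by (simp add: W_def)
qed

text \<open>The truncated integral and the mollified limit differ by the integral of \<open>u x - u (x + z)\<close> against
  a kernel of size \<open>min (e powr (- N - s)) (e * norm z powr (- N - s - 1))\<close>. By Cauchy-Schwarz with the weight
  \<open>min 1 (e / norm z)\<close> this is controlled by a weighted Gagliardo integral at \<open>x\<close>, which tends to zero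
  by dominated convergence.\<close>

lemma truncated_minus_tent_mean:
  fixes u g :: "'a::euclidean_space \<Rightarrow> real"
  assumes s: "0 < s" "s < 1"
  shows "\<exists>K\<ge>0. \<forall>u g x e. square_integrable lborel u \<longrightarrow> square_integrable lborel g \<longrightarrow>
    (\<lambda>n. \<integral>x. (difference_op (cut_kern s (1 / real (Suc n))) u x - g x)\<^sup>2 \<partial>lborel) \<longlonglongrightarrow> 0 \<longrightarrow>
    integrable lborel (\<lambda>z. (u x - u (x + z))\<^sup>2 * kern (2 * s) z) \<longrightarrow> e > 0 \<longrightarrow>
    (truncated s u e (x::'a) - (\<integral>z. tent e z * g (x + z) \<partial>lborel))\<^sup>2
      \<le> K * (\<integral>z. (u x - u (x + z))\<^sup>2 * kern (2 * s) z * min 1 (e / norm z) \<partial>lborel)"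
proof -
  define N where "N = real DIM('a)"
  have N1: "N \<ge> 1" using DIM_positive[where 'a='a] by (simp add: N_def Suc_leI)
  define p where "p = N + s"
  have p: "p > 0" using N1 s by (simp add: p_def)
  define b where "b = measure lborel (ball (0::'a) 1)"
  have b0: "b \<ge> 0" by (simp add: b_def)
  have [measurable]: "ball (0::'a) r \<in> sets borel" for r by auto
  obtain C where C: "C > 0"
    "\<And>e (z::'a). e > 0 \<Longrightarrow> \<bar>difference_op (kern s) (tent e) z\<bar> \<le> C * e powr (-p)"
    "\<And>e (z::'a). e > 0 \<Longrightarrow> 2 * e \<le> norm z \<Longrightarrow>
        \<bar>kern s z + difference_op (kern s) (tent e) z\<bar> \<le> C * e * norm z powr (-p - 1)"
  proof (rule difference_op_tent[OF s, where 'a='a], goal_cases)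
    case (1 C)
    show ?case
      by (rule 1(1)[OF 1(2)]) (use 1(3)[of _ 0] 1(4)[of _ 0] in \<open>auto simp: p_def N_def cut_kern_0\<close>)
  qed
  obtain C3 where C3: "C3 \<ge> 0" "\<And>R. R > 0 \<Longrightarrow> integrable lborel (\<lambda>y::'a. norm y powr (-(N + 1)) * indicator (- ball 0 R) y)"
      "\<And>R. R > 0 \<Longrightarrow> (\<integral>y. norm (y::'a) powr (-(N + 1)) * indicator (- ball 0 R) y \<partial>lborel) \<le> C3 * R powr (-1)"
    using power_integral_outside[where 'a='a, of 1] unfolding N_def by auto
  define A where "A = 2 * (1 + C)\<^sup>2 * 2 powr (N + 2 * s)"
  have A0: "A \<ge> 0" by (simp add: A_def)
  define K where "K = A * (b * 2 powr N) + C\<^sup>2 * C3 / 2"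
  show ?thesis
  proof (intro exI[of _ K] conjI allI impI)
    show "K \<ge> 0" using A0 b0 C3(1) by (simp add: K_def)
    fix u g :: "'a \<Rightarrow> real" and x :: 'a and e :: real
    assume u: "square_integrable lborel u" and g: "square_integrable lborel g"
      and lim: "(\<lambda>n. \<integral>x. (difference_op (cut_kern s (1 / real (Suc n))) u x - g x)\<^sup>2 \<partial>lborel) \<longlonglongrightarrow> 0"
      and fin: "integrable lborel (\<lambda>z. (u x - u (x + z))\<^sup>2 * kern (2 * s) z)" and e: "e > 0"
    have [measurable]: "u \<in> borel_measurable borel" "g \<in> borel_measurable borel"
      using u g by (auto intro: square_integrable_lborel_measurable)
    define W where "W z = u x - u (x + z)" for z
    have [measurable]: "W \<in> borel_measurable borel" unfolding W_def by measurable
    define T1 where "T1 z = kern s z * indicator (- ball 0 e) z" for z :: 'a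
    define T where "T z = T1 z + difference_op (kern s) (tent e) z" for z :: 'a
    have [measurable]: "T1 \<in> borel_measurable borel" unfolding T1_def[abs_def] by measurable
    have [measurable]: "T \<in> borel_measurable borel" unfolding T_def[abs_def] by measurable
    have T1b: "0 \<le> T1 z" "T1 z \<le> e powr (-p)" for z
      using kern_outside_le[OF s(1) e, of z] kern_nonneg[of s z] by (auto simp: T1_def p_def N_def)
    have T1i: "integrable lborel T1" unfolding T1_def[abs_def] by (rule kern_integrable_outside[OF s(1) e])
    have T1s: "square_integrable lborel T1" unfolding T1_def[abs_def] by (rule kern_square_integrable_outside[OF s(1) e])
    have v: "square_integrable lborel (\<lambda>z. u (x + z))"
      using square_integrable_shift[OF u, of x] by (simp add: add.commute)
    have WT1: "integrable lborel (\<lambda>z. T1 z * W z)"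
      using square_integrable_mult[OF T1s v] T1i by (simp add: W_def right_diff_distrib)
    note tm = tent_mean_of_limit[OF s u g lim e, of x, folded W_def]
    have "truncated s u e x = (\<integral>z. T1 z * W z \<partial>lborel)"
      unfolding truncated_def by (intro Bochner_Integration.integral_cong) (auto simp: T1_def W_def)
    then have diff: "truncated s u e x - (\<integral>z. tent e z * g (x + z) \<partial>lborel) = (\<integral>z. T z * W z \<partial>lborel)"
      using WT1 tm by (simp add: T_def distrib_right)
    have WT: "integrable lborel (\<lambda>z. T z * W z)" using WT1 tm(2) by (simp add: T_def distrib_right)
    (* R majorises T^2 / (kern (2 s) w), w = min 1 (e / |z|); its integral is bounded independently of e. *)
    define R where "R z = A * e powr (-N) * indicator (ball 0 (2 * e)) z
        + C\<^sup>2 * e * (norm z powr (-(N + 1)) * indicator (- ball 0 (2 * e)) z)" for z :: 'a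
    have [measurable]: "R \<in> borel_measurable borel" unfolding R_def[abs_def] by measurable
    have R0: "R z \<ge> 0" for z using A0 e by (simp add: R_def)
    have Ri: "integrable lborel R"
      unfolding R_def[abs_def] using C3(2)[of "2 * e"] e integrable_indicator_ball[of "0::'a" "2 * e"] by simp
    have RK: "(\<integral>z. R z \<partial>lborel) \<le> K"
    proof -
      have "(\<integral>z. R z \<partial>lborel) = A * e powr (-N) * measure lborel (ball (0::'a) (2 * e))
          + C\<^sup>2 * e * (\<integral>z. norm (z::'a) powr (-(N + 1)) * indicator (- ball 0 (2 * e)) z \<partial>lborel)"
        unfolding R_def using C3(2)[of "2 * e"] e integrable_indicator_ball[of "0::'a" "2 * e"] by simp
      also have "\<dots> \<le> A * e powr (-N) * (b * (2 * e) powr N) + C\<^sup>2 * e * (C3 * (2 * e) powr (-1))"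
        using e A0 measure_ball_powr[of "2 * e" "0::'a"] by (intro add_mono mult_left_mono C3) (auto simp: b_def N_def)
      also have "A * e powr (-N) * (b * (2 * e) powr N) = A * (b * 2 powr N)"
        using e by (simp add: powr_mult powr_minus)
      also have "C\<^sup>2 * e * (C3 * (2 * e) powr (-1)) = C\<^sup>2 * C3 / 2"
        using e by (simp add: powr_minus)
      finally show ?thesis by (simp add: K_def)
    qed
    define w where "w z = min 1 (e / norm z)" for z :: 'a
    have [measurable]: "w \<in> borel_measurable borel" unfolding w_def[abs_def] by measurable
    have w: "0 \<le> w z" "w z \<le> 1" for z using e by (auto simp: w_def)
    have TR: "(T z)\<^sup>2 \<le> R z * (kern (2 * s) z * w z)" if z: "z \<noteq> 0" for z
    proof (cases "norm z < 2 * e")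
      case True
      have nz: "norm z > 0" using z by simp
      have "\<bar>T z\<bar> \<le> (1 + C) * e powr (-p)"
        unfolding T_def using T1b[of z] C(2)[OF e, of z] by (simp add: distrib_right)
      then have "(T z)\<^sup>2 \<le> ((1 + C) * e powr (-p))\<^sup>2" using C(1) by (intro power2_le_iff_abs_le[THEN iffD2]) auto
      also have "\<dots> = (1 + C)\<^sup>2 * (e powr (-p) * e powr (-p))" by (simp add: power2_eq_square)
      also have "e powr (-p) * e powr (-p) = e powr (-N) * e powr (-(N + 2 * s))"
      proof -
        have "-p + -p = -N + -(N + 2 * s)" by (simp add: p_def)
        then show ?thesis by (simp only: powr_add[symmetric])
      qed
      also have "(1 + C)\<^sup>2 * (e powr (-N) * e powr (-(N + 2 * s))) = A * e powr (-N) * ((2 * e) powr (-(N + 2 * s)) * (1/2))"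
      proof -
        have q: "2 powr q * (2 * e) powr (-q) = e powr (-q)" for q :: real
          using e by (simp add: powr_mult powr_minus)
        have "A * e powr (-N) * ((2 * e) powr (-(N + 2 * s)) * (1/2))
            = (1 + C)\<^sup>2 * (e powr (-N) * (2 powr (N + 2 * s) * (2 * e) powr (-(N + 2 * s))))"
          by (simp add: A_def)
        then show ?thesis by (simp only: q)
      qed
      also have "\<dots> \<le> A * e powr (-N) * (kern (2 * s) z * w z)"
      proof (intro mult_left_mono mult_mono)
        show "(2 * e) powr (-(N + 2 * s)) \<le> kern (2 * s) z"
          unfolding kern_def N_def using True nz s N1 by (intro powr_mono2') (auto simp: N_def)
        show "1/2 \<le> w z" using True e nz by (simp add: w_def field_simps)
      qed (use A0 kern_nonneg in auto)
      finally show ?thesis using True by (simp add: R_def)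
    next
      case False
      have nz: "norm z > 0" using z by simp
      have "T1 z = kern s z" using False e by (simp add: T1_def)
      then have "\<bar>T z\<bar> \<le> C * e * norm z powr (-p - 1)" unfolding T_def using C(3)[OF e, of z] False by simp
      then have "(T z)\<^sup>2 \<le> (C * e * norm z powr (-p - 1))\<^sup>2"
        using C(1) e by (intro power2_le_iff_abs_le[THEN iffD2]) auto
      also have "\<dots> = C\<^sup>2 * e * (norm z powr (-p - 1) * norm z powr (-p - 1)) * e" by (simp add: power2_eq_square)
      also have "norm z powr (-p - 1) * norm z powr (-p - 1) = norm z powr (-(N + 1)) * (norm z powr (-(N + 2 * s)) * norm z powr (-1))"
      proof -
        have "-p - 1 + (-p - 1) = -(N + 1) + (-(N + 2 * s) + -1)" by (simp add: p_def)
        then show ?thesis by (simp only: powr_add[symmetric])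
      qed
      also have "C\<^sup>2 * e * (norm z powr (-(N + 1)) * (norm z powr (-(N + 2 * s)) * norm z powr (-1))) * e
          = C\<^sup>2 * e * norm z powr (-(N + 1)) * (kern (2 * s) z * (e / norm z))"
        using nz by (simp add: kern_def N_def powr_minus divide_inverse)
      also have "e / norm z = w z" using False e nz by (simp add: w_def min_def field_simps)
      finally show ?thesis using False by (simp add: R_def)
    qed
    define F where "F z = sqrt ((W z)\<^sup>2 * kern (2 * s) z * w z)" for z
    define G where "G z = sqrt (R z)" for z
    have [measurable]: "F \<in> borel_measurable borel" "G \<in> borel_measurable borel"
      unfolding F_def[abs_def] G_def[abs_def] by measurable
    have Fsq: "(F z)\<^sup>2 = (W z)\<^sup>2 * kern (2 * s) z * w z" for z
      unfolding F_def using kern_nonneg[of "2 * s" z] w(1)[of z] by simp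
    have Gsq: "(G z)\<^sup>2 = R z" for z unfolding G_def using R0 by simp
    have Gs: "square_integrable lborel G" using Ri by (simp add: square_integrable_def Gsq)
    have Fs: "square_integrable lborel F"
      unfolding square_integrable_def Fsq
    proof
      have "integrable lborel (\<lambda>z. w z * ((W z)\<^sup>2 * kern (2 * s) z))"
        by (rule integrable_bounded_mult[OF _ _, of _ _ _ 1]) (use fin w in \<open>auto simp: W_def\<close>)
      then show "integrable lborel (\<lambda>z. (W z)\<^sup>2 * kern (2 * s) z * w z)" by (simp add: mult.commute)
    qed simp
    have "\<bar>\<integral>z. T z * W z \<partial>lborel\<bar> \<le> (\<integral>z. F z * G z \<partial>lborel)"
    proof (rule order_trans[OF integral_abs_bound], rule integral_mono_AE)
      show "AE z in lborel. \<bar>T z * W z\<bar> \<le> F z * G z"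
        using AE_lborel_neq[of 0]
      proof eventually_elim
        case (elim z)
        have "\<bar>T z * W z\<bar> = sqrt ((T z)\<^sup>2 * (W z)\<^sup>2)" by (simp add: real_sqrt_mult abs_mult)
        also have "\<dots> \<le> sqrt ((R z * (kern (2 * s) z * w z)) * (W z)\<^sup>2)"
          using TR[OF elim] by (intro real_sqrt_le_mono mult_right_mono) auto
        also have "\<dots> = F z * G z" unfolding F_def G_def by (simp add: real_sqrt_mult[symmetric] ac_simps)
        finally show ?case .
      qed
    qed (use WT square_integrable_mult[OF Fs Gs] in \<open>auto intro: integrable_abs\<close>)
    then have "(\<integral>z. T z * W z \<partial>lborel)\<^sup>2 \<le> (\<integral>z. F z * G z \<partial>lborel)\<^sup>2"
      by (subst abs_le_square_iff[symmetric]) auto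
    also have "\<dots> \<le> (\<integral>z. (F z)\<^sup>2 \<partial>lborel) * (\<integral>z. (G z)\<^sup>2 \<partial>lborel)"
      by (rule cauchy_schwarz_integral[OF Fs Gs])
    also have "\<dots> \<le> (\<integral>z. (F z)\<^sup>2 \<partial>lborel) * K" using RK unfolding Gsq by (intro mult_left_mono) auto
    finally show "(truncated s u e x - (\<integral>z. tent e z * g (x + z) \<partial>lborel))\<^sup>2
      \<le> K * (\<integral>z. (u x - u (x + z))\<^sup>2 * kern (2 * s) z * min 1 (e / norm z) \<partial>lborel)"
      unfolding diff Fsq by (simp add: W_def w_def mult.commute)
  qed
qed

text \<open>The tent function is at most a multiple of the normalised indicator function of the ball.\<close>

lemma tent_mean_tendsto:
  fixes g :: "'a::euclidean_space \<Rightarrow> real"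
  assumes [measurable]: "g \<in> borel_measurable borel" and sq: "square_integrable lborel g"
    and leb: "\<And>e. e > 0 \<Longrightarrow> \<exists>d>0. \<forall>r. 0 < r \<and> r < d \<longrightarrow>
     (\<integral>\<^sup>+y. ennreal \<bar>g y - g x\<bar> * indicator (ball x r) y \<partial>lborel) \<le> ennreal e * emeasure lborel (ball x r)"
  shows "((\<lambda>e. \<integral>z. tent e z * g (x + z) \<partial>lborel) \<longlongrightarrow> g x) (at_right 0)"
proof -
  define N where "N = real DIM('a)"
  define b where "b = measure lborel (ball (0::'a) 1)"
  have b0: "b > 0" unfolding b_def using content_ball_pos[of 1 "0::'a"] by simp
  have [measurable]: "ball (a::'a) r \<in> sets borel" for a r by auto
  obtain B where B: "B > 0" "\<And>e (z::'a). e > 0 \<Longrightarrow> 0 \<le> tent e z"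
      "\<And>e (z::'a). e > 0 \<Longrightarrow> tent e z \<le> B * e powr (- N)" "\<And>e (z::'a). e > 0 \<Longrightarrow> e \<le> norm z \<Longrightarrow> tent e z = 0"
      "\<And>e. e > 0 \<Longrightarrow> integrable lborel (tent e :: 'a \<Rightarrow> real)" "\<And>e. e > 0 \<Longrightarrow> (\<integral>z. tent e (z::'a) \<partial>lborel) = 1"
    using tent_properties[where 'a='a, folded N_def] by blast
  show ?thesis unfolding tendsto_iff
  proof (intro allI impI)
    fix \<eta> :: real assume \<eta>: "\<eta> > 0"
    define e0 where "e0 = \<eta> / (2 * (B * b))"
    have e0: "e0 > 0" using \<eta> B(1) b0 by (simp add: e0_def)
    obtain d where d: "d > 0" "\<And>r. 0 < r \<Longrightarrow> r < d \<Longrightarrow>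
       (\<integral>\<^sup>+y. ennreal \<bar>g y - g x\<bar> * indicator (ball x r) y \<partial>lborel) \<le> ennreal e0 * emeasure lborel (ball x r)"
      using leb[OF e0] by auto
    have main: "dist (\<integral>z. tent r z * g (x + z) \<partial>lborel) (g x) < \<eta>" if r: "0 < r" "r < d" for r
    proof -
      note ti = B(5)[OF r(1)]
      have ts: "square_integrable lborel (tent r :: 'a \<Rightarrow> real)" by (rule tent_square_integrable[OF r(1)])
      have tg: "integrable lborel (\<lambda>z. tent r z * g (x + z))"
        using square_integrable_mult[OF ts square_integrable_shift[OF sq, of x]] by (simp add: add.commute)
      have tgx: "integrable lborel (\<lambda>z. tent r z * (g (x + z) - g x))"
        using tg ti by (simp add: right_diff_distrib)
      have "(\<integral>z. tent r z * g (x + z) \<partial>lborel) - g x = (\<integral>z. tent r z * (g (x + z) - g x) \<partial>lborel)"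
        using tg ti B(6)[OF r(1)] by (simp add: right_diff_distrib)
      then have "ennreal \<bar>(\<integral>z. tent r z * g (x + z) \<partial>lborel) - g x\<bar> \<le> (\<integral>\<^sup>+z. ennreal (norm (tent r z * (g (x + z) - g x))) \<partial>lborel)"
        using integral_norm_bound_ennreal[OF tgx] by simp
      also have "\<dots> \<le> (\<integral>\<^sup>+z. ennreal (B * r powr (-N)) * (ennreal \<bar>g (x + z) - g x\<bar> * indicator (ball x r) (x + z)) \<partial>lborel)"
      proof (rule nn_integral_mono)
        fix z
        show "ennreal (norm (tent r z * (g (x + z) - g x))) \<le> ennreal (B * r powr (-N)) * (ennreal \<bar>g (x + z) - g x\<bar> * indicator (ball x r) (x + z))"
        proof (cases "norm z < r")
          case True
          have "norm (tent r z * (g (x + z) - g x)) \<le> B * r powr (-N) * \<bar>g (x + z) - g x\<bar>"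
            using B(2,3)[OF r(1), of z] by (simp add: abs_mult mult_right_mono)
          then have "ennreal (norm (tent r z * (g (x + z) - g x))) \<le> ennreal (B * r powr (-N)) * ennreal \<bar>g (x + z) - g x\<bar>"
            using B(1) by (subst ennreal_mult[symmetric]) (auto intro: ennreal_leI)
          then show ?thesis using True by (simp add: dist_norm)
        next
          case False then show ?thesis using B(4)[OF r(1), of z] by simp
        qed
      qed
      also have "\<dots> = ennreal (B * r powr (-N)) * (\<integral>\<^sup>+z. ennreal \<bar>g (x + z) - g x\<bar> * indicator (ball x r) (x + z) \<partial>lborel)"
        by (rule nn_integral_cmult) measurable
      also have "(\<integral>\<^sup>+z. ennreal \<bar>g (x + z) - g x\<bar> * indicator (ball x r) (x + z) \<partial>lborel)
          = (\<integral>\<^sup>+y. ennreal \<bar>g y - g x\<bar> * indicator (ball x r) y \<partial>lborel)"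
        by (rule nn_integral_translate) measurable
      also have "ennreal (B * r powr (-N)) * \<dots> \<le> ennreal (B * r powr (-N)) * (ennreal e0 * ennreal (b * r powr N))"
        using d(2)[OF r] r by (intro mult_left_mono) (auto simp: emeasure_ball_powr b_def N_def)
      also have "\<dots> = ennreal (B * r powr (-N) * (e0 * (b * r powr N)))"
        using B(1) e0 b0 by (simp add: ennreal_mult)
      also have "B * r powr (-N) * (e0 * (b * r powr N)) = \<eta> / 2"
        using r B(1) b0 by (simp add: powr_minus e0_def)
      finally have "\<bar>(\<integral>z. tent r z * g (x + z) \<partial>lborel) - g x\<bar> \<le> \<eta> / 2" using \<eta> by (subst (asm) ennreal_le_iff) auto
      then show ?thesis using \<eta> by (simp add: dist_real_def)
    qed
    show "\<forall>\<^sub>F r in at_right 0. dist (\<integral>z. tent r z * g (x + z) \<partial>lborel) (g x) < \<eta>"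
      unfolding eventually_at_right_field using main d(1) by blast
  qed
qed

text \<open>The limit exists at the Lebesgue points of \<open>g\<close> at which the Gagliardo integral
  \<open>\<integral> (u x - u (x + z))\<^sup>2 |z|\<^sup>-\<^sup>N\<^sup>-\<^sup>2\<^sup>s dz\<close> is finite.\<close>

theorem truncated_AE_tendsto:
  fixes u :: "'a::euclidean_space \<Rightarrow> real"
  assumes s: "0 < s" "s < 1" and u: "square_integrable lborel u"
    and fin: "integrable lborel (\<lambda>z. diff_energy u z * kern (2 * s) z)"
    and c: "\<And>z::'a. z \<noteq> 0 \<Longrightarrow> square_kernel (kern s) z = c * kern (2 * s) z"
  shows "\<exists>g. square_integrable lborel g \<and>
     (\<integral>x. (g x)\<^sup>2 \<partial>lborel) = c / 2 * (\<integral>z. diff_energy u z * kern (2 * s) z \<partial>lborel) \<and>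
     (AE x in lborel. ((\<lambda>e. truncated s u e x) \<longlongrightarrow> g x) (at_right 0))"
proof -
  have [measurable]: "u \<in> borel_measurable borel" using u by (rule square_integrable_lborel_measurable)
  have [measurable]: "ball (a::'a) r \<in> sets borel" for a r by auto
  obtain g where g: "square_integrable lborel g"
     "(\<lambda>n. \<integral>x. (difference_op (cut_kern s (1 / real (Suc n))) u x - g x)\<^sup>2 \<partial>lborel) \<longlonglongrightarrow> 0"
     "(\<integral>x. (g x)\<^sup>2 \<partial>lborel) = c / 2 * (\<integral>z. diff_energy u z * kern (2 * s) z \<partial>lborel)"
    using difference_op_mean_square_limit[OF s u fin c] by blast
  have gm[measurable]: "g \<in> borel_measurable borel" using g(1) by (rule square_integrable_lborel_measurable)
  obtain K where K: "K \<ge> 0" "\<And>x e. integrable lborel (\<lambda>z. (u x - u (x + z))\<^sup>2 * kern (2 * s) z) \<Longrightarrow> e > 0 \<Longrightarrow>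
    (truncated s u e (x::'a) - (\<integral>z. tent e z * g (x + z) \<partial>lborel))\<^sup>2
      \<le> K * (\<integral>z. (u x - u (x + z))\<^sup>2 * kern (2 * s) z * min 1 (e / norm z) \<partial>lborel)"
    using truncated_minus_tent_mean[OF s, where 'a='a] u g(1,2) by blast
  have "(\<integral>\<^sup>+x. ennreal \<bar>g x\<bar> * indicator (ball 0 R) x \<partial>lborel) < \<infinity>" for R
  proof -
    have "(\<integral>\<^sup>+x. ennreal \<bar>g x\<bar> * indicator (ball 0 R) x \<partial>lborel)
        \<le> (\<integral>\<^sup>+x. ennreal ((g x)\<^sup>2) + indicator (ball 0 R) x \<partial>lborel)"
    proof (rule nn_integral_mono)
      fix x
      have "\<bar>g x\<bar> \<le> (g x)\<^sup>2 + 1"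
      proof (cases "\<bar>g x\<bar> \<le> 1")
        case False
        then have "\<bar>g x\<bar> * 1 \<le> \<bar>g x\<bar> * \<bar>g x\<bar>" by (intro mult_left_mono) auto
        then show ?thesis by (simp add: power2_eq_square)
      qed (auto intro: add_increasing)
      then have "ennreal \<bar>g x\<bar> \<le> ennreal ((g x)\<^sup>2) + 1"
        by (metis ennreal_1 ennreal_leI ennreal_plus zero_le_one zero_le_power2)
      then show "ennreal \<bar>g x\<bar> * indicator (ball 0 R) x \<le> ennreal ((g x)\<^sup>2) + indicator (ball 0 R) x"
        by (auto simp: indicator_def)
    qed
    also have "\<dots> = (\<integral>\<^sup>+x. ennreal ((g x)\<^sup>2) \<partial>lborel) + emeasure lborel (ball (0::'a) R)"
      by (subst nn_integral_add, measurable)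
    also have "\<dots> < \<infinity>"
      using g(1) square_integrable_iff_nn_integral[of g lborel] emeasure_bounded_finite[of "ball (0::'a) R"] by auto
    finally show ?thesis .
  qed
  note AE1 = AE_lebesgue_point[OF gm this]
  have "(\<integral>\<^sup>+x. (\<integral>\<^sup>+z. ennreal ((u x - u (x + z))\<^sup>2 * kern (2 * s) z) \<partial>lborel) \<partial>lborel)
      = (\<integral>\<^sup>+z. (\<integral>\<^sup>+x. ennreal ((u x - u (x + z))\<^sup>2 * kern (2 * s) z) \<partial>lborel) \<partial>lborel)"
    by (rule lborel_pair.Fubini'[symmetric]) measurable
  also have "\<dots> = (\<integral>\<^sup>+z. ennreal (diff_energy u z * kern (2 * s) z) \<partial>lborel)"
  proof (rule nn_integral_cong)
    fix z :: 'a
    have "integrable lborel (\<lambda>x. (u x - u (x + z))\<^sup>2)"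
      using square_integrable_diff[OF u square_integrable_shift[OF u, of z]] by (simp add: square_integrable_def)
    then show "(\<integral>\<^sup>+x. ennreal ((u x - u (x + z))\<^sup>2 * kern (2 * s) z) \<partial>lborel) = ennreal (diff_energy u z * kern (2 * s) z)"
      using kern_nonneg[of "2 * s" z] by (subst nn_integral_eq_integral) (auto simp: diff_energy_def)
  qed
  also have "\<dots> < \<infinity>" using fin diff_energy_nonneg[of u] kern_nonneg[of "2 * s" "_::'a"]
    by (subst nn_integral_eq_integral) auto
  finally have "AE x in lborel. (\<integral>\<^sup>+z. ennreal ((u x - u (x + z))\<^sup>2 * kern (2 * s) z) \<partial>lborel) \<noteq> \<infinity>"
    by (intro nn_integral_PInf_AE) auto
  then have AE2: "AE x in lborel. integrable lborel (\<lambda>z. (u x - u (x + z))\<^sup>2 * kern (2 * s) z)"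
    by eventually_elim (rule integrableI_bounded, auto simp: kern_nonneg less_top)
  have "AE x in lborel. ((\<lambda>e. truncated s u e x) \<longlongrightarrow> g x) (at_right 0)"
    using AE1 AE2
  proof eventually_elim
    case (elim x)
    have A: "((\<lambda>e. \<integral>z. tent e z * g (x + z) \<partial>lborel) \<longlongrightarrow> g x) (at_right 0)"
      by (rule tent_mean_tendsto[OF gm g(1)]) (use elim(1) in blast)
    define I where "I e = (\<integral>z. (u x - u (x + z))\<^sup>2 * kern (2 * s) z * min 1 (e / norm z) \<partial>lborel)" for e
    have I: "(I \<longlongrightarrow> 0) (at_right 0)"
      unfolding tendsto_at_iff_sequentially
    proof (intro allI impI)
      fix X :: "nat \<Rightarrow> real" assume X: "\<forall>i. X i \<in> {0<..} - {0}" "X \<longlonglongrightarrow> 0"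
      have "(\<lambda>n. I (X n)) \<longlonglongrightarrow> integral\<^sup>L (lborel :: 'a measure) (\<lambda>_. 0)"
        unfolding I_def
      proof (rule integral_dominated_convergence[OF _ _ elim(2)])
        show "AE z in lborel. norm ((u x - u (x + z))\<^sup>2 * kern (2 * s) z * min 1 (X n / norm z)) \<le> (u x - u (x + z))\<^sup>2 * kern (2 * s) z" for n
        proof (rule AE_I2)
          fix z :: 'a
          have "0 \<le> min 1 (X n / norm z)" "min 1 (X n / norm z) \<le> 1" using X(1) by (auto simp: less_imp_le)
          moreover have "0 \<le> (u x - u (x + z))\<^sup>2 * kern (2 * s) z" by (simp add: kern_nonneg)
          ultimately show "norm ((u x - u (x + z))\<^sup>2 * kern (2 * s) z * min 1 (X n / norm z)) \<le> (u x - u (x + z))\<^sup>2 * kern (2 * s) z"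
            by (subst real_norm_def, subst abs_of_nonneg) (rule mult_nonneg_nonneg, assumption, assumption, rule mult_left_le)
        qed
        show "AE z in lborel. (\<lambda>n. (u x - u (x + z))\<^sup>2 * kern (2 * s) z * min 1 (X n / norm z)) \<longlonglongrightarrow> 0"
          using AE_lborel_neq[of 0]
        proof eventually_elim
          case (elim z)
          have "(\<lambda>n. min 1 (X n / norm z)) \<longlonglongrightarrow> min 1 (0 / norm z)"
            by (intro tendsto_intros X(2)) (use elim in auto)
          then have "(\<lambda>n. (u x - u (x + z))\<^sup>2 * kern (2 * s) z * min 1 (X n / norm z)) \<longlonglongrightarrow> (u x - u (x + z))\<^sup>2 * kern (2 * s) z * min 1 (0 / norm z)"
            by (rule tendsto_mult_left)
          then show ?case by simp
        qed
      qed measurable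
      then show "(I \<circ> X) \<longlonglongrightarrow> 0" by (simp add: o_def)
    qed
    have sq: "((\<lambda>e. (truncated s u e x - (\<integral>z. tent e z * g (x + z) \<partial>lborel))\<^sup>2) \<longlongrightarrow> 0) (at_right 0)"
    proof (rule tendsto_sandwich[OF _ _ tendsto_const])
      show "\<forall>\<^sub>F e in at_right 0. (truncated s u e x - (\<integral>z. tent e z * g (x + z) \<partial>lborel))\<^sup>2 \<le> K * I e"
        unfolding I_def eventually_at_right_field using K(2)[OF elim(2)] by (intro exI[of _ 1]) auto
      show "((\<lambda>e. K * I e) \<longlongrightarrow> 0) (at_right 0)" using tendsto_mult_left[OF I, of K] by simp
    qed auto
    have "((\<lambda>e. truncated s u e x - (\<integral>z. tent e z * g (x + z) \<partial>lborel)) \<longlongrightarrow> 0) (at_right 0)"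
      using tendsto_real_sqrt[OF sq] by (simp add: tendsto_rabs_zero_iff)
    from tendsto_add[OF this A] show "((\<lambda>e. truncated s u e x) \<longlongrightarrow> g x) (at_right 0)" by simp
  qed
  then show ?thesis using g by blast
qed

section \<open>The bilinear form of the half Laplacian\<close>

text \<open>With the square root of the kernel as a factor, the Gagliardo form becomes the \<open>L\<^sup>2\<close> inner product
  of the quotients.\<close>

definition gagliardo_quotient :: "real \<Rightarrow> ('a::euclidean_space \<Rightarrow> real) \<Rightarrow> 'a \<times> 'a \<Rightarrow> real" where
  "gagliardo_quotient s u p = (u (fst p) - u (snd p)) * sqrt (kern (2 * s) (fst p - snd p))"

text \<open>Members of \<open>H\<^sup>s\<close> that are Borel functions. Translations and Fubini's theorem are applied to
  \<open>(x, y) \<mapsto> u (x + y)\<close>, which for a merely Lebesgue measurable \<open>u\<close> need not be measurable for the product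
  \<open>\<sigma>\<close>-algebra; every member of \<open>H\<^sup>s\<close> agrees almost everywhere with a Borel one.\<close>

definition borel_H_s :: "real \<Rightarrow> ('a::euclidean_space \<Rightarrow> real) \<Rightarrow> bool" where
  "borel_H_s s u \<longleftrightarrow> square_integrable lborel u \<and> square_integrable (lborel \<Otimes>\<^sub>M lborel) (gagliardo_quotient s u)"

definition gagliardo_form :: "real \<Rightarrow> ('a::euclidean_space \<Rightarrow> real) \<Rightarrow> ('a \<Rightarrow> real) \<Rightarrow> real" where
  "gagliardo_form s u v = (\<integral>p. gagliardo_quotient s u p * gagliardo_quotient s v p \<partial>(lborel \<Otimes>\<^sub>M lborel))"

lemma kern_eq_inverse: "kern s (z::'a::euclidean_space) = inverse (norm z powr (real DIM('a) + s))"
  unfolding kern_def by (rule powr_minus)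

lemma gagliardo_quotient_measurable[measurable]:
  assumes [measurable]: "u \<in> borel_measurable borel"
  shows "gagliardo_quotient s u \<in> borel_measurable (lborel \<Otimes>\<^sub>M lborel)"
  unfolding gagliardo_quotient_def[abs_def] by measurable

lemma gagliardo_quotient_mult:
  "gagliardo_quotient s u p * gagliardo_quotient s v p
     = (u (fst p) - u (snd p)) * (v (fst p) - v (snd p)) * kern (2 * s) (fst p - snd p)"
proof -
  have "gagliardo_quotient s u p * gagliardo_quotient s v p
      = (u (fst p) - u (snd p)) * (v (fst p) - v (snd p)) * (sqrt (kern (2 * s) (fst p - snd p)))\<^sup>2"
    by (simp add: gagliardo_quotient_def power2_eq_square)
  then show ?thesis by (simp add: kern_nonneg)
qed

lemma borel_H_s_measurable: "borel_H_s s u \<Longrightarrow> u \<in> borel_measurable borel"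
  by (simp add: borel_H_s_def square_integrable_def)

lemma gagliardo_quotient_lincomb:
  "gagliardo_quotient s (\<lambda>x. a * u x + b * v x) p = a * gagliardo_quotient s u p + b * gagliardo_quotient s v p"
proof -
  have "a * u (fst p) + b * v (fst p) - (a * u (snd p) + b * v (snd p))
      = a * (u (fst p) - u (snd p)) + b * (v (fst p) - v (snd p))" by (simp add: algebra_simps)
  then show ?thesis by (simp only: gagliardo_quotient_def distrib_right mult.assoc)
qed

lemma borel_H_s_lincomb:
  assumes "borel_H_s s u" "borel_H_s s v"
  shows "borel_H_s s (\<lambda>x. a * u x + b * v x)"
proof -
  have "gagliardo_quotient s (\<lambda>x. a * u x + b * v x) = (\<lambda>p. a * gagliardo_quotient s u p + b * gagliardo_quotient s v p)"
    by (rule ext) (rule gagliardo_quotient_lincomb)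
  then show ?thesis
    using assms by (simp add: borel_H_s_def square_integrable_add square_integrable_cmult)
qed

lemma gagliardo_form_lincomb:
  assumes "borel_H_s s u" "borel_H_s s v" "borel_H_s s w"
  shows "gagliardo_form s (\<lambda>x. a * u x + b * v x) w = a * gagliardo_form s u w + b * gagliardo_form s v w"
proof -
  have "integrable (lborel \<Otimes>\<^sub>M lborel) (\<lambda>p. gagliardo_quotient s u p * gagliardo_quotient s w p)"
    "integrable (lborel \<Otimes>\<^sub>M lborel) (\<lambda>p. gagliardo_quotient s v p * gagliardo_quotient s w p)"
    using assms by (auto simp: borel_H_s_def intro!: square_integrable_mult)
  then show ?thesis
    by (simp add: gagliardo_form_def gagliardo_quotient_lincomb distrib_right mult.assoc)
qed

lemma gagliardo_form_commute: "gagliardo_form s u v = gagliardo_form s v u"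
  by (simp add: gagliardo_form_def mult.commute)

lemma borel_H_s_contraction:
  assumes u: "borel_H_s s u" and [measurable]: "v \<in> borel_measurable borel"
    and "\<And>x. \<bar>v x\<bar> \<le> \<bar>u x\<bar>" and d: "\<And>x y. \<bar>v x - v y\<bar> \<le> \<bar>u x - u y\<bar>"
  shows "borel_H_s s v"
  unfolding borel_H_s_def
proof
  show "square_integrable lborel v"
    by (rule square_integrable_bound[of lborel u]) (use assms in \<open>auto simp: borel_H_s_def\<close>)
  have gq: "\<bar>gagliardo_quotient s v p\<bar> \<le> \<bar>gagliardo_quotient s u p\<bar>" for p
    unfolding gagliardo_quotient_def abs_mult by (intro mult_right_mono d) auto
  show "square_integrable (lborel \<Otimes>\<^sub>M lborel) (gagliardo_quotient s v)"
    by (rule square_integrable_bound[of _ "gagliardo_quotient s u"]) (use u gq in \<open>auto simp: borel_H_s_def\<close>)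
qed

lemma borel_H_s_pos_part:
  assumes u: "borel_H_s s u" and "K \<ge> 0"
  shows "borel_H_s s (\<lambda>x. max 0 (u x - K))"
proof (rule borel_H_s_contraction[OF u])
  have [measurable]: "u \<in> borel_measurable borel" using u by (rule borel_H_s_measurable)
  show "(\<lambda>x. max 0 (u x - K)) \<in> borel_measurable borel" by measurable
qed (use assms in auto)

lemma nn_integral_gagliardo:
  fixes u :: "'a::euclidean_space \<Rightarrow> real"
  assumes [measurable]: "u \<in> borel_measurable borel"
  shows "(\<integral>\<^sup>+p. ennreal ((gagliardo_quotient s u p)\<^sup>2) \<partial>(lborel \<Otimes>\<^sub>M lborel))
      = (\<integral>\<^sup>+x. (\<integral>\<^sup>+y. ennreal ((u x - u y)\<^sup>2 * kern (2 * s) (x - y)) \<partial>lborel) \<partial>lborel)"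
    and "(\<integral>\<^sup>+p. ennreal ((gagliardo_quotient s u p)\<^sup>2) \<partial>(lborel \<Otimes>\<^sub>M lborel))
      = (\<integral>\<^sup>+z. (\<integral>\<^sup>+x. ennreal ((u x - u (x + z))\<^sup>2 * kern (2 * s) z) \<partial>lborel) \<partial>lborel)"
proof -
  have sq: "(gagliardo_quotient s u (x, y))\<^sup>2 = (u x - u y)\<^sup>2 * kern (2 * s) (x - y)" for x y
    using gagliardo_quotient_mult[of s u "(x, y)" u] by (simp add: power2_eq_square)
  have "(\<integral>\<^sup>+p. ennreal ((gagliardo_quotient s u p)\<^sup>2) \<partial>(lborel \<Otimes>\<^sub>M lborel))
      = (\<integral>\<^sup>+x. (\<integral>\<^sup>+y. ennreal ((gagliardo_quotient s u (x, y))\<^sup>2) \<partial>lborel) \<partial>lborel)"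
    by (rule lborel.nn_integral_fst[symmetric]) measurable
  then show 1: "(\<integral>\<^sup>+p. ennreal ((gagliardo_quotient s u p)\<^sup>2) \<partial>(lborel \<Otimes>\<^sub>M lborel))
      = (\<integral>\<^sup>+x. (\<integral>\<^sup>+y. ennreal ((u x - u y)\<^sup>2 * kern (2 * s) (x - y)) \<partial>lborel) \<partial>lborel)" by (simp add: sq)
  also have "\<dots> = (\<integral>\<^sup>+x. (\<integral>\<^sup>+z. ennreal ((u x - u (x + z))\<^sup>2 * kern (2 * s) z) \<partial>lborel) \<partial>lborel)"
  proof (rule nn_integral_cong)
    fix x :: 'a
    have "(\<integral>\<^sup>+y. ennreal ((u x - u y)\<^sup>2 * kern (2 * s) (x - y)) \<partial>lborel)
        = (\<integral>\<^sup>+z. ennreal ((u x - u (x + z))\<^sup>2 * kern (2 * s) (x - (x + z))) \<partial>lborel)"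
      by (rule nn_integral_translate[symmetric]) measurable
    then show "(\<integral>\<^sup>+y. ennreal ((u x - u y)\<^sup>2 * kern (2 * s) (x - y)) \<partial>lborel)
        = (\<integral>\<^sup>+z. ennreal ((u x - u (x + z))\<^sup>2 * kern (2 * s) z) \<partial>lborel)" by (simp add: kern_def)
  qed
  also have "\<dots> = (\<integral>\<^sup>+z. (\<integral>\<^sup>+x. ennreal ((u x - u (x + z))\<^sup>2 * kern (2 * s) z) \<partial>lborel) \<partial>lborel)"
    by (rule lborel_pair.Fubini'[symmetric]) measurable
  finally show "(\<integral>\<^sup>+p. ennreal ((gagliardo_quotient s u p)\<^sup>2) \<partial>(lborel \<Otimes>\<^sub>M lborel))
      = (\<integral>\<^sup>+z. (\<integral>\<^sup>+x. ennreal ((u x - u (x + z))\<^sup>2 * kern (2 * s) z) \<partial>lborel) \<partial>lborel)" .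
qed

lemma borel_H_s_diff_energy:
  fixes u :: "'a::euclidean_space \<Rightarrow> real"
  assumes u: "borel_H_s s u"
  shows "integrable lborel (\<lambda>z. diff_energy u z * kern (2 * s) z)"
    and "(\<integral>z. diff_energy u z * kern (2 * s) z \<partial>lborel) = gagliardo_form s u u"
proof -
  have [measurable]: "u \<in> borel_measurable borel" using u by (rule borel_H_s_measurable)
  have u2: "square_integrable lborel u" and q: "square_integrable (lborel \<Otimes>\<^sub>M lborel) (gagliardo_quotient s u)"
    using u by (auto simp: borel_H_s_def)
  have "(\<integral>\<^sup>+z. (\<integral>\<^sup>+x. ennreal ((u x - u (x + z))\<^sup>2 * kern (2 * s) z) \<partial>lborel) \<partial>lborel)
      = (\<integral>\<^sup>+z. ennreal (diff_energy u z * kern (2 * s) z) \<partial>lborel)"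
  proof (rule nn_integral_cong)
    fix z :: 'a
    have "integrable lborel (\<lambda>x. (u x - u (x + z))\<^sup>2)"
      using square_integrable_diff[OF u2 square_integrable_shift[OF u2, of z]] by (simp add: square_integrable_def)
    then show "(\<integral>\<^sup>+x. ennreal ((u x - u (x + z))\<^sup>2 * kern (2 * s) z) \<partial>lborel) = ennreal (diff_energy u z * kern (2 * s) z)"
      using kern_nonneg[of "2 * s" z] by (subst nn_integral_eq_integral) (auto simp: diff_energy_def)
  qed
  moreover have "(\<integral>\<^sup>+p. ennreal ((gagliardo_quotient s u p)\<^sup>2) \<partial>(lborel \<Otimes>\<^sub>M lborel)) = ennreal (gagliardo_form s u u)"
    using q by (subst nn_integral_eq_integral) (auto simp: square_integrable_def gagliardo_form_def power2_eq_square)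
  ultimately have eq: "(\<integral>\<^sup>+z. ennreal (diff_energy u z * kern (2 * s) z) \<partial>lborel) = ennreal (gagliardo_form s u u)"
    by (simp add: nn_integral_gagliardo(2))
  show int: "integrable lborel (\<lambda>z. diff_energy u z * kern (2 * s) z)"
  proof (rule integrableI_bounded)
    have "norm (diff_energy u z * kern (2 * s) z) = diff_energy u z * kern (2 * s) z" for z
      using diff_energy_nonneg[of u z] kern_nonneg[of "2 * s" z] by simp
    then show "(\<integral>\<^sup>+z. ennreal (norm (diff_energy u z * kern (2 * s) z)) \<partial>lborel) < \<infinity>" by (simp add: eq)
  qed measurable
  have "ennreal (\<integral>z. diff_energy u z * kern (2 * s) z \<partial>lborel) = ennreal (gagliardo_form s u u)"
    using eq diff_energy_nonneg[of u] kern_nonneg[of "2 * s" "_::'a"] int by (subst (asm) nn_integral_eq_integral) auto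
  moreover have "gagliardo_form s u u \<ge> 0" by (simp add: gagliardo_form_def)
  moreover have "(\<integral>z. diff_energy u z * kern (2 * s) z \<partial>lborel) \<ge> 0"
    by (intro integral_nonneg_AE AE_I2) (simp add: diff_energy_nonneg kern_nonneg)
  ultimately show "(\<integral>z. diff_energy u z * kern (2 * s) z \<partial>lborel) = gagliardo_form s u u" by simp
qed

lemma H_s_iff_borel:
  fixes u u' :: "'a::euclidean_space \<Rightarrow> real"
  assumes uL: "u \<in> borel_measurable lebesgue" and ae: "AE x in lborel. u x = u' x"
    and [measurable]: "u' \<in> borel_measurable borel"
  shows "u \<in> H_s s \<longleftrightarrow> borel_H_s s u'"
proof -
  have "(\<integral>\<^sup>+x. ennreal ((u x)\<^sup>2) \<partial>lebesgue) = (\<integral>\<^sup>+x. ennreal ((u' x)\<^sup>2) \<partial>lborel)"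
    unfolding nn_integral_completion using ae by (intro nn_integral_cong_AE) (auto elim!: eventually_mono)
  moreover have "(\<lambda>x. (u x)\<^sup>2) \<in> borel_measurable lebesgue" using uL by measurable
  ultimately have 1: "integrable lebesgue (\<lambda>x. (u x)\<^sup>2) \<longleftrightarrow> square_integrable lborel u'"
    using square_integrable_iff_nn_integral[of u' lborel] by (simp add: integrable_iff_bounded)
  have "(\<integral>\<^sup>+ x. (\<integral>\<^sup>+ y. ennreal ((u x - u y)\<^sup>2 / norm (x - y) powr (real DIM('a) + 2 * s)) \<partial>lebesgue) \<partial>lebesgue)
      = (\<integral>\<^sup>+x. (\<integral>\<^sup>+y. ennreal ((u' x - u' y)\<^sup>2 * kern (2 * s) (x - y)) \<partial>lborel) \<partial>lborel)"
    unfolding nn_integral_completion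
  proof (rule nn_integral_cong_AE)
    show "AE x in lborel. (\<integral>\<^sup>+ y. ennreal ((u x - u y)\<^sup>2 / norm (x - y) powr (real DIM('a) + 2 * s)) \<partial>lborel)
        = (\<integral>\<^sup>+y. ennreal ((u' x - u' y)\<^sup>2 * kern (2 * s) (x - y)) \<partial>lborel)"
      using ae
    proof eventually_elim
      case (elim x)
      show ?case
        by (rule nn_integral_cong_AE) (use ae elim in \<open>auto simp: kern_eq_inverse divide_inverse elim!: eventually_mono\<close>)
    qed
  qed
  then have 2: "(\<integral>\<^sup>+ x. (\<integral>\<^sup>+ y. ennreal ((u x - u y)\<^sup>2 / norm (x - y) powr (real DIM('a) + 2 * s)) \<partial>lebesgue) \<partial>lebesgue) < \<infinity>
      \<longleftrightarrow> square_integrable (lborel \<Otimes>\<^sub>M lborel) (gagliardo_quotient s u')"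
    by (subst square_integrable_iff_nn_integral) (simp_all add: nn_integral_gagliardo(1))
  show ?thesis unfolding H_s_def borel_H_s_def mem_Collect_eq using uL 1 2 by blast
qed

lemma H_s_borel_representative:
  assumes "u \<in> H_s s"
  obtains u' where "borel_H_s s u'" "AE x in lborel. u x = u' x"
proof -
  have uL: "u \<in> borel_measurable lebesgue" using assms by (simp add: H_s_def)
  then obtain u' where u': "u' \<in> borel_measurable lborel" "AE x in lborel. u x = u' x"
    using completion_ex_borel_measurable_real by blast
  then have "borel_H_s s u'" using H_s_iff_borel[OF uL u'(2)] assms by simp
  then show thesis using that u'(2) by blast
qed

lemma frac_laplacian_half_eq:
  fixes u u' :: "'a::euclidean_space \<Rightarrow> real"
  assumes uL: "u \<in> borel_measurable lebesgue" and ae: "AE x in lborel. u x = u' x"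
    and [measurable]: "u' \<in> borel_measurable borel" and x: "u x = u' x"
    and lim: "((\<lambda>e. truncated s u' e x) \<longlongrightarrow> l) (at_right 0)"
  shows "frac_laplacian (s / 2) u x = frac_const TYPE('a) (s / 2) * l"
proof -
  have [measurable]: "ball (a::'a) r \<in> sets borel" for a r by auto
  have "(LINT y:(- ball x e)|lebesgue. (u x - u y) / norm (x - y) powr (real DIM('a) + 2 * (s / 2))) = truncated s u' e x" for e
  proof -
    define f where "f y = (u' x - u' y) * kern s (x - y) * indicator (- ball x e) y" for y
    have [measurable]: "f \<in> borel_measurable borel" unfolding f_def[abs_def] by measurable
    have "(LINT y:(- ball x e)|lebesgue. (u x - u y) / norm (x - y) powr (real DIM('a) + 2 * (s / 2))) = (\<integral>y. f y \<partial>lebesgue)"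
      unfolding set_lebesgue_integral_def
    proof (rule integral_cong_AE)
      show "f \<in> borel_measurable lebesgue" by (rule measurable_completion) simp
      have nm: "(\<lambda>y. norm (x - y) powr (real DIM('a) + 2 * (s / 2))) \<in> borel_measurable lebesgue"
        by (rule measurable_completion) measurable
      have "- ball x e \<in> sets lebesgue" by simp
      with nm uL show "(\<lambda>y. indicator (- ball x e) y *\<^sub>R ((u x - u y) / norm (x - y) powr (real DIM('a) + 2 * (s / 2)))) \<in> borel_measurable lebesgue"
        by measurable
      show "AE y in lebesgue. indicator (- ball x e) y *\<^sub>R ((u x - u y) / norm (x - y) powr (real DIM('a) + 2 * (s / 2))) = f y"
        using ae unfolding AE_completion_iff
      proof eventually_elim
        case (elim y)
        have e: "real DIM('a) + 2 * (s / 2) = real DIM('a) + s" by simp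
        show ?case unfolding e unfolding f_def kern_eq_inverse x elim real_scaleR_def
          unfolding divide_inverse by (simp only: mult.commute)
      qed
    qed
    also have "\<dots> = (\<integral>y. f y \<partial>lborel)" by (rule integral_completion) simp
    also have "\<dots> = (\<integral>z. f (x + z) \<partial>lborel)" by (rule integral_lborel_translate[symmetric]) simp
    also have "\<dots> = truncated s u' e x" unfolding truncated_def
      by (intro Bochner_Integration.integral_cong) (auto simp: f_def kern_def indicator_def dist_norm)
    finally show ?thesis .
  qed
  then have "frac_laplacian (s / 2) u x = frac_const TYPE('a) (s / 2) * Lim (at_right 0) (\<lambda>e. truncated s u' e x)"
    by (simp add: frac_laplacian_def)
  also have "Lim (at_right 0) (\<lambda>e. truncated s u' e x) = l" by (rule tendsto_Lim[OF _ lim]) simp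
  finally show ?thesis .
qed

lemma truncated_lincomb:
  fixes u v :: "'a::euclidean_space \<Rightarrow> real"
  assumes s: "s > 0" and e: "e > 0" and u: "square_integrable lborel u" and v: "square_integrable lborel v"
  shows "truncated s (\<lambda>x. a * u x + b * v x) e x = a * truncated s u e x + b * truncated s v e x"
proof -
  define T1 where "T1 z = kern s z * indicator (- ball 0 e) z" for z :: 'a
  have T1i: "integrable lborel T1" unfolding T1_def[abs_def] by (rule kern_integrable_outside[OF s e])
  have T1s: "square_integrable lborel T1" unfolding T1_def[abs_def] by (rule kern_square_integrable_outside[OF s e])
  have i: "integrable lborel (\<lambda>z. (w x - w (x + z)) * T1 z)" if w: "square_integrable lborel w" for w
  proof -
    have "square_integrable lborel (\<lambda>z. w (x + z))"
      using square_integrable_shift[OF w, of x] by (simp add: add.commute)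
    from square_integrable_mult[OF this T1s] show ?thesis using T1i by (simp add: left_diff_distrib)
  qed
  have tr: "truncated s w e x = (\<integral>z. (w x - w (x + z)) * T1 z \<partial>lborel)" for w
    by (simp add: truncated_def T1_def mult.assoc)
  have "truncated s (\<lambda>x. a * u x + b * v x) e x = (\<integral>z. a * ((u x - u (x + z)) * T1 z) + b * ((v x - v (x + z)) * T1 z) \<partial>lborel)"
    unfolding tr by (intro Bochner_Integration.integral_cong) (auto simp: algebra_simps)
  also have "\<dots> = a * truncated s u e x + b * truncated s v e x"
    unfolding tr using i[OF u] i[OF v] by simp
  finally show ?thesis .
qed

lemma borel_measurable_lebesgue_cong_AE:
  fixes f g :: "'a::euclidean_space \<Rightarrow> real"
  assumes g: "g \<in> borel_measurable lebesgue" and ae: "AE x in lebesgue. f x = g x"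
  shows "f \<in> borel_measurable lebesgue"
proof (rule measurableI)
  have ae': "AE x in lborel. f x = g x" using ae by (simp add: AE_completion_iff)
  have P: "Measurable.pred lebesgue (\<lambda>x. f x \<noteq> g x \<and> f x \<in> A)" "Measurable.pred lebesgue (\<lambda>x. f x \<noteq> g x)" for A
    using ae' by (auto intro!: sets_completion_AE elim!: eventually_mono)
  fix A :: "real set" assume [measurable]: "A \<in> sets borel"
  have [measurable]: "Measurable.pred lebesgue (\<lambda>x. g x \<in> A)" using g by measurable
  have "Measurable.pred lebesgue (\<lambda>x. (g x \<in> A \<and> \<not> f x \<noteq> g x) \<or> (f x \<noteq> g x \<and> f x \<in> A))"
    using P(1)[of A] P(2) by measurable
  moreover have "(\<lambda>x. (g x \<in> A \<and> \<not> f x \<noteq> g x) \<or> (f x \<noteq> g x \<and> f x \<in> A)) = (\<lambda>x. f x \<in> A)" by auto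
  ultimately show "f -` A \<inter> space lebesgue \<in> sets lebesgue" by (simp add: pred_def vimage_def Int_def)
qed simp

text \<open>On a complete measure space functions that agree almost everywhere are measurable simultaneously,
  and the integral of a function that is not measurable is zero by convention.\<close>

lemma integral_lebesgue_cong_AE:
  fixes f g :: "'a::euclidean_space \<Rightarrow> real"
  assumes ae: "AE x in lebesgue. f x = g x"
  shows "(LINT x|lebesgue. f x) = (LINT x|lebesgue. g x)"
proof -
  have ae': "AE x in lebesgue. g x = f x" using ae by eventually_elim simp
  show ?thesis
  proof (cases "g \<in> borel_measurable lebesgue")
    case True
    then show ?thesis using borel_measurable_lebesgue_cong_AE[OF True ae] ae by (intro integral_cong_AE)
  next
    case False
    then have "f \<notin> borel_measurable lebesgue" using borel_measurable_lebesgue_cong_AE[OF _ ae'] by blast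
    then have "\<not> integrable lebesgue f" "\<not> integrable lebesgue g"
      using False by (auto dest: borel_measurable_integrable)
    then show ?thesis by (simp add: not_integrable_integral_eq)
  qed
qed

text \<open>The form is evaluated on Borel representatives, for which its integrand is measurable on the
  product.\<close>

definition half_form_constant :: "real \<Rightarrow> 'a::euclidean_space itself \<Rightarrow> real \<Rightarrow> bool" where
  "half_form_constant s _ \<kappa> \<longleftrightarrow> (\<forall>(u::'a \<Rightarrow> real) v u' v'.
     u \<in> H_s s \<longrightarrow> v \<in> H_s s \<longrightarrow> borel_H_s s u' \<longrightarrow> borel_H_s s v' \<longrightarrow>
     (AE x in lborel. u x = u' x) \<longrightarrow> (AE x in lborel. v x = v' x) \<longrightarrow>
     (LINT x|lebesgue. frac_laplacian (s / 2) u x * frac_laplacian (s / 2) v x) = \<kappa> * gagliardo_form s u' v')"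

text \<open>The energy identity of the mean-square limit is polarised; the limits are additive because the
  truncated integrals are.\<close>

theorem frac_laplacian_half_form:
  assumes s: "0 < s" "s < 1"
  shows "\<exists>\<kappa>. half_form_constant s TYPE('a::euclidean_space) \<kappa>"
proof -
  obtain c where c: "\<And>z::'a. z \<noteq> 0 \<Longrightarrow> square_kernel (kern s) z = c * kern (2 * s) z"
    using square_kernel_kern[of s, where 'a='a] by blast
  define F where "F = frac_const TYPE('a) (s / 2)"
  have lim: "\<exists>g. square_integrable lborel g \<and> (\<integral>x. (g x)\<^sup>2 \<partial>lborel) = c / 2 * gagliardo_form s u u \<and>
     (AE x in lborel. ((\<lambda>e. truncated s u e x) \<longlongrightarrow> g x) (at_right 0))" if u: "borel_H_s s u" for u :: "'a \<Rightarrow> real"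
    using truncated_AE_tendsto[OF s _ borel_H_s_diff_energy(1)[OF u] c] u borel_H_s_diff_energy(2)[OF u]
    by (auto simp: borel_H_s_def)
  have "half_form_constant s TYPE('a) (F\<^sup>2 * (c / 2))"
    unfolding half_form_constant_def
  proof (intro allI impI)
    fix u v u' v' :: "'a \<Rightarrow> real"
    assume u: "u \<in> H_s s" and v: "v \<in> H_s s" and u': "borel_H_s s u'" and v': "borel_H_s s v'"
      and ae: "AE x in lborel. u x = u' x" "AE x in lborel. v x = v' x"
    have uL: "u \<in> borel_measurable lebesgue" "v \<in> borel_measurable lebesgue" using u v by (auto simp: H_s_def)
    have [measurable]: "u' \<in> borel_measurable borel" "v' \<in> borel_measurable borel"
      using u' v' by (auto intro: borel_H_s_measurable)
    define w where "w = (\<lambda>x. 1 * u' x + 1 * v' x)"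
    have w: "borel_H_s s w" unfolding w_def by (rule borel_H_s_lincomb[OF u' v'])
    obtain g where g: "square_integrable lborel g" "(\<integral>x. (g x)\<^sup>2 \<partial>lborel) = c / 2 * gagliardo_form s u' u'"
      "AE x in lborel. ((\<lambda>e. truncated s u' e x) \<longlongrightarrow> g x) (at_right 0)" using lim[OF u'] by blast
    obtain h where h: "square_integrable lborel h" "(\<integral>x. (h x)\<^sup>2 \<partial>lborel) = c / 2 * gagliardo_form s v' v'"
      "AE x in lborel. ((\<lambda>e. truncated s v' e x) \<longlongrightarrow> h x) (at_right 0)" using lim[OF v'] by blast
    obtain k where k: "square_integrable lborel k" "(\<integral>x. (k x)\<^sup>2 \<partial>lborel) = c / 2 * gagliardo_form s w w"
      "AE x in lborel. ((\<lambda>e. truncated s w e x) \<longlongrightarrow> k x) (at_right 0)" using lim[OF w] by blast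
    have [measurable]: "g \<in> borel_measurable borel" "h \<in> borel_measurable borel" "k \<in> borel_measurable borel"
      using g(1) h(1) k(1) by (auto intro: square_integrable_lborel_measurable)
    have "AE x in lborel. k x = g x + h x"
      using g(3) h(3) k(3)
    proof eventually_elim
      case (elim x)
      have "((\<lambda>e. 1 * truncated s u' e x + 1 * truncated s v' e x) \<longlongrightarrow> 1 * g x + 1 * h x) (at_right 0)"
        by (intro tendsto_intros elim)
      moreover have "\<forall>\<^sub>F e in at_right 0. 1 * truncated s u' e x + 1 * truncated s v' e x = truncated s w e x"
        unfolding eventually_at_right_field w_def using u' v' s
        by (intro exI[of _ 1]) (auto simp: borel_H_s_def truncated_lincomb[of s _ u' v' 1 1, simplified])
      ultimately have "((\<lambda>e. truncated s w e x) \<longlongrightarrow> 1 * g x + 1 * h x) (at_right 0)"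
        by (rule Lim_transform_eventually)
      then show ?case using tendsto_unique[OF _ elim(3)] by simp
    qed
    then have "(\<integral>x. (k x)\<^sup>2 \<partial>lborel) = (\<integral>x. (g x + h x)\<^sup>2 \<partial>lborel)"
      by (intro integral_cong_AE) (auto elim!: eventually_mono)
    also have "\<dots> = (\<integral>x. (g x)\<^sup>2 + (h x)\<^sup>2 + 2 * (g x * h x) \<partial>lborel)"
      by (intro Bochner_Integration.integral_cong) (auto simp: power2_sum)
    also have "\<dots> = (\<integral>x. (g x)\<^sup>2 \<partial>lborel) + (\<integral>x. (h x)\<^sup>2 \<partial>lborel) + 2 * (\<integral>x. g x * h x \<partial>lborel)"
      using g(1) h(1) square_integrable_mult[OF g(1) h(1)] by (simp add: square_integrable_def)
    finally have "2 * (\<integral>x. g x * h x \<partial>lborel)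
        = c / 2 * (gagliardo_form s w w - gagliardo_form s u' u' - gagliardo_form s v' v')"
      using g(2) h(2) k(2) by (simp only: right_diff_distrib)
    also have "gagliardo_form s w w = gagliardo_form s u' w + gagliardo_form s v' w"
      using gagliardo_form_lincomb[OF u' v' w, of 1 1, folded w_def] by simp
    also have "gagliardo_form s u' w = gagliardo_form s u' u' + gagliardo_form s v' u'"
      using gagliardo_form_lincomb[OF u' v' u', of 1 1, folded w_def] gagliardo_form_commute[of s u' w] by simp
    also have "gagliardo_form s v' w = gagliardo_form s u' v' + gagliardo_form s v' v'"
      using gagliardo_form_lincomb[OF u' v' v', of 1 1, folded w_def] gagliardo_form_commute[of s v' w] by simp
    finally have gh: "(\<integral>x. g x * h x \<partial>lborel) = c / 2 * gagliardo_form s u' v'"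
      by (simp add: gagliardo_form_commute[of s v' u'])
    have "AE x in lborel. frac_laplacian (s / 2) u x = F * g x"
      using ae(1) g(3) by eventually_elim (simp add: F_def frac_laplacian_half_eq[OF uL(1) ae(1)])
    moreover have "AE x in lborel. frac_laplacian (s / 2) v x = F * h x"
      using ae(2) h(3) by eventually_elim (simp add: F_def frac_laplacian_half_eq[OF uL(2) ae(2)])
    ultimately have aeD: "AE x in lborel. frac_laplacian (s / 2) u x * frac_laplacian (s / 2) v x = F\<^sup>2 * (g x * h x)"
      by eventually_elim (simp add: power2_eq_square)
    show "(LINT x|lebesgue. frac_laplacian (s / 2) u x * frac_laplacian (s / 2) v x) = F\<^sup>2 * (c / 2) * gagliardo_form s u' v'"
    proof -
      have "(LINT x|lebesgue. frac_laplacian (s / 2) u x * frac_laplacian (s / 2) v x) = (LINT x|lebesgue. F\<^sup>2 * (g x * h x))"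
        by (rule integral_lebesgue_cong_AE) (use aeD in \<open>simp add: AE_completion_iff\<close>)
      also have "\<dots> = (LINT x|lborel. F\<^sup>2 * (g x * h x))" by (rule integral_completion) measurable
      finally show ?thesis using gh by simp
    qed
  qed
  then show ?thesis by blast
qed

section \<open>Estimates for eigenfunctions\<close>

text \<open>The weak eigenvalue equation, expressed through the Gagliardo form and Borel functions.\<close>

definition form_eigenfunction ::
  "real \<Rightarrow> real \<Rightarrow> 'a::euclidean_space set \<Rightarrow> real \<Rightarrow> ('a \<Rightarrow> real) \<Rightarrow> bool" where
  "form_eigenfunction s \<kappa> \<Omega> \<Lambda> u \<longleftrightarrow> borel_H_s s u \<and> (AE x in lborel. x \<notin> \<Omega> \<longrightarrow> u x = 0) \<and>
     (\<forall>v. borel_H_s s v \<longrightarrow> (AE x in lborel. x \<notin> \<Omega> \<longrightarrow> v x = 0) \<longrightarrow>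
        \<kappa> * gagliardo_form s u v = \<Lambda> * (\<integral>x. u x * v x \<partial>lborel))"

lemma gagliardo_form_nonneg: "gagliardo_form s u u \<ge> 0"
  by (simp add: gagliardo_form_def)

text \<open>When \<open>w\<close> is a nondecreasing function of \<open>u\<close>, the integrand of the form is nonnegative, so any part of the
  domain of integration may be discarded: for each \<open>x\<close> only the points \<open>y \<in> S x\<close> are kept.\<close>

lemma gagliardo_form_lower_bound:
  fixes u w :: "'a::euclidean_space \<Rightarrow> real"
  assumes u: "borel_H_s s u" and w: "borel_H_s s w"
    and mono: "\<And>x y. (u x - u y) * (w x - w y) \<ge> 0"
    and a[measurable]: "a \<in> borel_measurable borel" and a0: "\<And>x. a x \<ge> 0"
    and S: "\<And>x. S x \<in> sets borel" and low: "\<And>x y. y \<in> S x \<Longrightarrow> a x \<le> (u x - u y) * (w x - w y) * kern (2 * s) (x - y)"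
    and m: "m \<ge> 0" "AE x in lborel. a x > 0 \<longrightarrow> ennreal m \<le> emeasure lborel (S x)"
    and ai: "integrable lborel a"
  shows "(\<integral>x. a x \<partial>lborel) * m \<le> gagliardo_form s u w"
proof -
  have [measurable]: "u \<in> borel_measurable borel" "w \<in> borel_measurable borel"
    using u w by (auto intro: borel_H_s_measurable)
  define Q where "Q p = gagliardo_quotient s u p * gagliardo_quotient s w p" for p
  have Qeq: "Q p = (u (fst p) - u (snd p)) * (w (fst p) - w (snd p)) * kern (2 * s) (fst p - snd p)" for p
    by (simp add: Q_def gagliardo_quotient_mult)
  have Q0: "Q p \<ge> 0" for p unfolding Qeq by (intro mult_nonneg_nonneg mono kern_nonneg)
  have Qi: "integrable (lborel \<Otimes>\<^sub>M lborel) Q"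
    unfolding Q_def[abs_def] using u w by (intro square_integrable_mult) (auto simp: borel_H_s_def)
  have [measurable]: "Q \<in> borel_measurable (lborel \<Otimes>\<^sub>M lborel)" using Qi by (rule borel_measurable_integrable)
  have F0: "gagliardo_form s u w \<ge> 0"
    unfolding gagliardo_form_def Q_def[symmetric] using Q0 by (intro integral_nonneg_AE) auto
  have "ennreal ((\<integral>x. a x \<partial>lborel) * m) = ennreal (\<integral>x. a x \<partial>lborel) * ennreal m"
    using m(1) a0 by (intro ennreal_mult) (auto intro: integral_nonneg_AE)
  also have "ennreal (\<integral>x. a x \<partial>lborel) = (\<integral>\<^sup>+x. ennreal (a x) \<partial>lborel)"
    using ai a0 by (intro nn_integral_eq_integral[symmetric]) auto
  also have "\<dots> * ennreal m = (\<integral>\<^sup>+x. ennreal (a x) * ennreal m \<partial>lborel)"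
    by (rule nn_integral_multc[symmetric]) measurable
  also have "\<dots> \<le> (\<integral>\<^sup>+x. (\<integral>\<^sup>+y. ennreal (Q (x, y)) \<partial>lborel) \<partial>lborel)"
  proof (rule nn_integral_mono_AE)
    show "AE x in lborel. ennreal (a x) * ennreal m \<le> (\<integral>\<^sup>+y. ennreal (Q (x, y)) \<partial>lborel)"
      using m(2)
    proof eventually_elim
      case (elim x)
      show ?case
      proof (cases "a x > 0")
        case True
        then have "ennreal (a x) * ennreal m \<le> ennreal (a x) * emeasure lborel (S x)"
          using elim by (intro mult_left_mono) auto
        also have "\<dots> = (\<integral>\<^sup>+y. ennreal (a x) * indicator (S x) y \<partial>lborel)"
          using S[of x] by (subst nn_integral_cmult_indicator) auto
        also have "\<dots> \<le> (\<integral>\<^sup>+y. ennreal (Q (x, y)) \<partial>lborel)"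
          using low by (intro nn_integral_mono) (auto simp: indicator_def Qeq intro!: ennreal_leI)
        finally show ?thesis .
      qed (use a0[of x] in auto)
    qed
  qed
  also have "\<dots> = (\<integral>\<^sup>+p. ennreal (Q p) \<partial>(lborel \<Otimes>\<^sub>M lborel))"
    by (rule lborel.nn_integral_fst) measurable
  also have "\<dots> = ennreal (gagliardo_form s u w)"
    unfolding gagliardo_form_def Q_def[symmetric] using Qi Q0 by (intro nn_integral_eq_integral) auto
  finally show ?thesis using F0 by (simp add: ennreal_le_iff)
qed

text \<open>A single truncation suffices, because the form is nonlocal: where \<open>u > K\<close>, the points of a small
  ball with \<open>u \<le> K / 2\<close>, which are at least half of it once \<open>K\<close> is large, contribute a multiple of
  \<open>R powr (- 2 * s)\<close> of \<open>w\<^sup>2 + K w / 2\<close>, \<open>w = max 0 (u - K)\<close>. For small \<open>R\<close> this exceeds the right-hand side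
  \<open>\<Lambda> \<integral> u w\<close> of the equation tested with \<open>w\<close>, unless \<open>w\<close> vanishes.\<close>

lemma form_eigenfunction_bounded_above:
  fixes u :: "'a::euclidean_space \<Rightarrow> real"
  assumes s: "0 < s" and \<kappa>: "\<kappa> > 0" and eig: "form_eigenfunction s \<kappa> \<Omega> \<Lambda> u"
  shows "\<exists>K>0. AE x in lborel. u x \<le> K"
proof -
  have u: "borel_H_s s u" and u0: "AE x in lborel. x \<notin> \<Omega> \<longrightarrow> u x = 0"
    and test: "\<And>v. borel_H_s s v \<Longrightarrow> (AE x in lborel. x \<notin> \<Omega> \<longrightarrow> v x = 0) \<Longrightarrow>
        \<kappa> * gagliardo_form s u v = \<Lambda> * (\<integral>x. u x * v x \<partial>lborel)"
    using eig by (auto simp: form_eigenfunction_def)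
  have [measurable]: "u \<in> borel_measurable borel" using u by (rule borel_H_s_measurable)
  have usq: "square_integrable lborel u" using u by (simp add: borel_H_s_def)
  define N where "N = real DIM('a)"
  define b where "b = measure lborel (ball (0::'a) 1)"
  have b: "b > 0" unfolding b_def using content_ball_pos[of 1 "0::'a"] by simp
  (* X is the value of R powr (- 2 * s) at which the lower bound for the form has the factor 2 |Lambda| + 1. *)
  define X where "X = 2 * (2 * \<bar>\<Lambda>\<bar> + 1) / (\<kappa> * b)"
  have X: "X > 0" using \<kappa> b by (simp add: X_def add_nonneg_pos)
  define R where "R = X powr (- 1 / (2 * s))"
  have R: "R > 0" using X by (simp add: R_def)
  have RX: "R powr (- (2 * s)) = X" using X s by (simp add: R_def powr_powr)
  define m where "m = b * R powr N / 2"
  have m: "m > 0" using b R by (simp add: m_def)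
  define U where "U = (\<integral>x. (u x)\<^sup>2 \<partial>lborel)"
  have U: "U \<ge> 0" by (simp add: U_def)
  (* By Chebyshev's inequality {u > K / 2} has at most the volume m of half the ball of radius R. *)
  define K where "K = 2 * sqrt (U / m + 1)"
  have K: "K > 0" using U m by (simp add: K_def add_nonneg_pos)
  have Ksq: "(K / 2)\<^sup>2 = U / m + 1" using U m by (simp add: K_def)
  define w where "w x = max 0 (u x - K)" for x
  have w: "borel_H_s s w" unfolding w_def[abs_def] using borel_H_s_pos_part[OF u] K by simp
  have [measurable]: "w \<in> borel_measurable borel" using w by (rule borel_H_s_measurable)
  have wsq: "square_integrable lborel w" using w by (simp add: borel_H_s_def)
  have w0: "AE x in lborel. x \<notin> \<Omega> \<longrightarrow> w x = 0" using u0 by eventually_elim (use K in \<open>auto simp: w_def\<close>)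
  define S where "S x = ball x R \<inter> {y. u y \<le> K / 2}" for x
  have [measurable]: "S x \<in> sets borel" for x unfolding S_def by (intro sets.Int) auto
  have big: "emeasure lborel {y. u y > K / 2} \<le> ennreal m"
  proof -
    have "ennreal ((K / 2)\<^sup>2) * emeasure lborel {y. u y > K / 2} = (\<integral>\<^sup>+y. ennreal ((K / 2)\<^sup>2) * indicator {y. u y > K / 2} y \<partial>lborel)"
      by (subst nn_integral_cmult_indicator) auto
    also have "\<dots> \<le> (\<integral>\<^sup>+y. ennreal ((u y)\<^sup>2) \<partial>lborel)"
      using K by (intro nn_integral_mono) (auto simp: indicator_def intro!: ennreal_leI power_mono)
    also have "\<dots> = ennreal U"
      unfolding U_def using usq by (intro nn_integral_eq_integral) (auto simp: square_integrable_def)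
    finally have le: "ennreal ((K / 2)\<^sup>2) * emeasure lborel {y. u y > K / 2} \<le> ennreal U" .
    have pos: "(K / 2)\<^sup>2 > 0" using K by simp
    have "emeasure lborel {y. u y > K / 2} = ennreal (1 / (K / 2)\<^sup>2) * (ennreal ((K / 2)\<^sup>2) * emeasure lborel {y. u y > K / 2})"
      using pos by (simp add: mult.assoc[symmetric] ennreal_mult[symmetric])
    also have "\<dots> \<le> ennreal (1 / (K / 2)\<^sup>2) * ennreal U" by (intro mult_left_mono le) auto
    also have "\<dots> = ennreal (U / (K / 2)\<^sup>2)" using U by (simp add: ennreal_mult[symmetric])
    also have "\<dots> \<le> ennreal m"
    proof (rule ennreal_leI)
      have "U \<le> m * (U / m + 1)" using m by (simp add: field_simps)
      then show "U / (K / 2)\<^sup>2 \<le> m" unfolding Ksq using U m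
        by (subst pos_divide_le_eq) (auto simp: add_nonneg_pos)
    qed
    finally show ?thesis .
  qed
  have Sm: "ennreal m \<le> emeasure lborel (S x)" for x
  proof -
    have "ennreal (m + m) = emeasure lborel (ball x R)"
      using R by (simp add: emeasure_ball_powr m_def b_def N_def)
    also have "\<dots> \<le> emeasure lborel (S x \<union> {y. u y > K / 2})"
      by (rule emeasure_mono) (auto simp: S_def)
    also have "\<dots> \<le> emeasure lborel (S x) + emeasure lborel {y. u y > K / 2}"
      by (rule emeasure_subadditive) auto
    also have "\<dots> \<le> emeasure lborel (S x) + ennreal m" using big by (rule add_left_mono)
    finally have "ennreal (m + m) \<le> emeasure lborel (S x) + ennreal m" .
    moreover have "ennreal (m + m) = ennreal m + ennreal m" using m by (intro ennreal_plus) auto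
    ultimately show ?thesis by (simp only: add.commute[of "emeasure lborel (S x)"] ennreal_add_left_cancel_le ennreal_neq_top) simp
  qed
  define q where "q = R powr (-(N + 2 * s))"
  have q: "q > 0" using R by (simp add: q_def)
  define a where "a x = q * (w x * (w x + K / 2))" for x
  have wK: "u x * w x = w x * w x + K * w x" for x by (auto simp: w_def max_def algebra_simps)
  have uw: "integrable lborel (\<lambda>x. u x * w x)" by (rule square_integrable_mult[OF usq wsq])
  have ww: "integrable lborel (\<lambda>x. w x * w x)" by (rule square_integrable_mult[OF wsq wsq])
  have "integrable lborel (\<lambda>x. K * w x)"
    using Bochner_Integration.integrable_diff[OF uw ww] by (simp add: wK)
  then have wi: "integrable lborel w" using K by simp
  define I where "I = (\<integral>x. w x * (w x + K / 2) \<partial>lborel)"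
  have Ii: "integrable lborel (\<lambda>x. w x * (w x + K / 2))" using ww wi by (simp add: distrib_left)
  have wnn: "w x \<ge> 0" for x by (simp add: w_def)
  have Inn: "I \<ge> 0" unfolding I_def using wnn K by (intro integral_nonneg_AE) auto
  have "(\<integral>x. a x \<partial>lborel) * m \<le> gagliardo_form s u w"
  proof (rule gagliardo_form_lower_bound[OF u w])
    show "(u x - u y) * (w x - w y) \<ge> 0" for x y
      by (cases "u x \<le> u y") (auto simp: w_def intro: mult_nonneg_nonneg mult_nonpos_nonpos)
    show "a \<in> borel_measurable borel" unfolding a_def[abs_def] by measurable
    show "a x \<ge> 0" for x using q wnn[of x] K by (simp add: a_def)
    show "integrable lborel a" unfolding a_def[abs_def] using Ii by simp
    show "a x \<le> (u x - u y) * (w x - w y) * kern (2 * s) (x - y)" if y: "y \<in> S x" for x y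
    proof (cases "w x > 0")
      case True
      then have ux: "u x = w x + K" by (simp add: w_def max_def split: if_splits)
      have uy: "u y \<le> K / 2" "dist x y < R" using y by (auto simp: S_def)
      then have wy: "w y = 0" using K by (simp add: w_def)
      have "x \<noteq> y" using ux uy K True by auto
      then have "q \<le> kern (2 * s) (x - y)"
        unfolding q_def kern_def N_def using uy(2) s by (intro powr_mono2') (auto simp: dist_norm)
      moreover have "w x * (w x + K / 2) \<le> (u x - u y) * (w x - w y)"
        using True ux uy wy by (simp add: mult.commute)
      moreover have "0 \<le> w x * (w x + K / 2)" using True K by simp
      ultimately have "(w x * (w x + K / 2)) * q \<le> (u x - u y) * (w x - w y) * kern (2 * s) (x - y)"
        using less_imp_le[OF q] by (metis mult_mono')
      then show ?thesis by (simp add: a_def mult.commute)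
    next
      case False
      then have "w x = 0" using wnn[of x] by simp
      moreover have "(u x - u y) * (w x - w y) \<ge> 0"
        by (cases "u x \<le> u y") (auto simp: w_def intro: mult_nonneg_nonneg mult_nonpos_nonpos)
      ultimately show ?thesis
        using mult_nonneg_nonneg[OF _ kern_nonneg[of "2 * s" "x - y"], of "(u x - u y) * (w x - w y)"] by (simp add: a_def)
    qed
  qed (use m Sm in auto)
  then have "\<kappa> * (q * I * m) \<le> \<kappa> * gagliardo_form s u w"
    using \<kappa> by (intro mult_left_mono) (auto simp: a_def I_def)
  also have "\<dots> = \<Lambda> * (\<integral>x. u x * w x \<partial>lborel)" by (rule test[OF w w0])
  also have "\<dots> \<le> \<bar>\<Lambda>\<bar> * (2 * I)"
  proof -
    have "0 \<le> (\<integral>x. u x * w x \<partial>lborel)" unfolding wK using wnn K by (intro integral_nonneg_AE) auto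
    moreover have "(\<integral>x. u x * w x \<partial>lborel) \<le> (\<integral>x. 2 * (w x * (w x + K / 2)) \<partial>lborel)"
      using uw Ii by (rule integral_mono[OF _ integrable_mult_right]) (simp add: wK algebra_simps)
    ultimately show ?thesis unfolding I_def
      using mult_mono[OF abs_ge_self[of \<Lambda>], of "\<integral>x. u x * w x \<partial>lborel" "\<integral>x. 2 * (w x * (w x + K / 2)) \<partial>lborel"] by simp
  qed
  finally have le: "\<kappa> * (q * m) * I \<le> 2 * \<bar>\<Lambda>\<bar> * I" by (simp add: ac_simps)
  have "\<kappa> * (q * m) = 2 * \<bar>\<Lambda>\<bar> + 1"
  proof -
    have "q * R powr N = R powr (- (2 * s))"
      unfolding q_def powr_add[symmetric] by simp
    then have "q * m = b / 2 * X" by (simp add: m_def RX[symmetric])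
    then show ?thesis using \<kappa> b by (simp add: X_def)
  qed
  then have "I \<le> 0" using le by (simp add: distrib_right)
  then have "I = 0" using Inn by simp
  then have "AE x in lborel. w x * (w x + K / 2) = 0"
    unfolding I_def using Ii wnn K by (subst (asm) integral_nonneg_eq_0_iff_AE) auto
  then have "AE x in lborel. u x \<le> K"
  proof eventually_elim
    case (elim x)
    then have "w x = 0" using wnn[of x] K by auto
    then show ?case by (simp add: w_def max_def split: if_splits)
  qed
  then show ?thesis using K by blast
qed

lemma form_eigenfunction_cmult:
  assumes "form_eigenfunction s \<kappa> \<Omega> \<Lambda> u"
  shows "form_eigenfunction s \<kappa> \<Omega> \<Lambda> (\<lambda>x. c * u x)"
proof -
  have u: "borel_H_s s u" using assms by (simp add: form_eigenfunction_def)
  have "borel_H_s s (\<lambda>x. c * u x)" using borel_H_s_lincomb[OF u u, of c 0] by simp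
  moreover have "gagliardo_form s (\<lambda>x. c * u x) v = c * gagliardo_form s u v" if "borel_H_s s v" for v
    using gagliardo_form_lincomb[OF u u that, of c 0] by simp
  ultimately show ?thesis using assms
    by (auto simp: form_eigenfunction_def mult.assoc mult.left_commute[of _ c] elim!: eventually_mono)
qed

text \<open>The comparison is again nonlocal. Where \<open>w = u - K \<phi>\<close> is positive it is joined by the kernel to a
  fixed set of positive measure on which \<open>w \<le> - K \<delta> / 2\<close>; this gives a term of order
  \<open>K \<integral> max 0 w\<close>, which for large \<open>K\<close> outweighs the right-hand side, at most \<open>|\<Lambda>| M \<integral> max 0 w\<close>.\<close>

lemma form_eigenfunction_le_first:
  fixes u \<phi> :: "'a::euclidean_space \<Rightarrow> real"
  assumes s: "0 < s" and \<kappa>: "\<kappa> > 0" and eig: "form_eigenfunction s \<kappa> \<Omega> \<Lambda> u"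
    and eig1: "form_eigenfunction s \<kappa> \<Omega> \<Lambda>1 \<phi>" and pos: "AE x in lborel. x \<in> \<Omega> \<longrightarrow> \<phi> x > 0"
    and \<Omega>: "open \<Omega>" "bounded \<Omega>" "\<Omega> \<noteq> {}"
    and M: "M > 0" "AE x in lborel. \<bar>u x\<bar> \<le> M"
  shows "\<exists>K>0. AE x in lborel. u x \<le> K * \<phi> x"
proof -
  have [measurable]: "\<Omega> \<in> sets borel" using \<Omega>(1) by auto
  have u: "borel_H_s s u" and u0: "AE x in lborel. x \<notin> \<Omega> \<longrightarrow> u x = 0"
    and test: "\<And>v. borel_H_s s v \<Longrightarrow> (AE x in lborel. x \<notin> \<Omega> \<longrightarrow> v x = 0) \<Longrightarrow>
        \<kappa> * gagliardo_form s u v = \<Lambda> * (\<integral>x. u x * v x \<partial>lborel)"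
    using eig by (auto simp: form_eigenfunction_def)
  have \<phi>: "borel_H_s s \<phi>" and \<phi>0: "AE x in lborel. x \<notin> \<Omega> \<longrightarrow> \<phi> x = 0"
    and test1: "\<And>v. borel_H_s s v \<Longrightarrow> (AE x in lborel. x \<notin> \<Omega> \<longrightarrow> v x = 0) \<Longrightarrow>
        \<kappa> * gagliardo_form s \<phi> v = \<Lambda>1 * (\<integral>x. \<phi> x * v x \<partial>lborel)"
    using eig1 by (auto simp: form_eigenfunction_def)
  have [measurable]: "u \<in> borel_measurable borel" "\<phi> \<in> borel_measurable borel"
    using u \<phi> by (auto intro: borel_H_s_measurable)
  have usq: "square_integrable lborel u" and \<phi>sq: "square_integrable lborel \<phi>"
    using u \<phi> by (auto simp: borel_H_s_def)
  have \<Omega>pos: "emeasure lborel \<Omega> \<noteq> 0"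
  proof
    assume "emeasure lborel \<Omega> = 0"
    then have "negligible \<Omega>" by (simp add: negligible_iff_null_sets null_sets_def)
    then show False using open_not_negligible[OF \<Omega>(1,3)] by simp
  qed
  have \<Omega>fin: "emeasure lborel \<Omega> < \<infinity>" using emeasure_bounded_finite[OF \<Omega>(2)] .
  have \<phi>nn: "AE x in lborel. \<phi> x \<ge> 0" using pos \<phi>0 by eventually_elim force
  have \<Lambda>1: "\<Lambda>1 \<ge> 0"
  proof (rule ccontr)
    assume neg: "\<not> \<Lambda>1 \<ge> 0"
    have "0 \<le> \<Lambda>1 * (\<integral>x. \<phi> x * \<phi> x \<partial>lborel)"
      using test1[OF \<phi> \<phi>0] \<kappa> gagliardo_form_nonneg[of s \<phi>] by (metis less_imp_le mult_nonneg_nonneg)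
    then have "(\<integral>x. \<phi> x * \<phi> x \<partial>lborel) \<le> 0" using neg by (simp add: zero_le_mult_iff)
    moreover have "(\<integral>x. \<phi> x * \<phi> x \<partial>lborel) \<ge> 0" by (intro integral_nonneg_AE) auto
    ultimately have "AE x in lborel. \<phi> x * \<phi> x = 0"
      using square_integrable_mult[OF \<phi>sq \<phi>sq] by (subst integral_nonneg_eq_0_iff_AE[symmetric]) auto
    then have "AE x in lborel. x \<notin> \<Omega>" using pos by eventually_elim auto
    then show False using \<Omega>pos by (subst (asm) AE_iff_measurable[of \<Omega>]) auto
  qed
  (* For some n the set E n has positive measure; it is the distant set on which w is very negative. *)
  define E where "E n = {x \<in> \<Omega>. \<phi> x > 1 / real (Suc n) \<and> \<bar>u x\<bar> \<le> M}" for n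
  have [measurable]: "E n \<in> sets borel" for n unfolding E_def by measurable
  have "\<exists>n. emeasure lborel (E n) \<noteq> 0"
  proof (rule ccontr)
    assume "\<not> ?thesis"
    then have "\<And>n. AE x in lborel. x \<notin> E n" by (intro AE_not_in) (auto simp: null_sets_def)
    then have "AE x in lborel. \<forall>n. x \<notin> E n" by (simp add: AE_all_countable)
    then have "AE x in lborel. x \<notin> \<Omega>"
      using pos M(2)
    proof eventually_elim
      case (elim x)
      show ?case
      proof
        assume x: "x \<in> \<Omega>"
        then obtain n where "1 / real (Suc n) < \<phi> x" using elim(2) reals_Archimedean[of "\<phi> x"] by (auto simp: divide_inverse)
        then show False using elim x by (auto simp: E_def)
      qed
    qed
    then show False using \<Omega>pos by (subst (asm) AE_iff_measurable[of \<Omega>]) auto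
  qed
  then obtain n where n: "emeasure lborel (E n) \<noteq> 0" by blast
  define \<delta> where "\<delta> = 1 / real (Suc n)"
  have \<delta>: "\<delta> > 0" by (simp add: \<delta>_def)
  have Efin: "emeasure lborel (E n) < \<infinity>"
    using \<Omega>fin emeasure_mono[of "E n" \<Omega> lborel] by (auto simp: E_def intro: le_less_trans)
  define m where "m = measure lborel (E n)"
  have Em: "emeasure lborel (E n) = ennreal m" using Efin by (simp add: m_def emeasure_eq_ennreal_measure)
  have m: "m > 0" using n Em by (simp add: m_def zero_less_measure_iff)
  obtain D where D: "D > 0" "\<And>x y. x \<in> \<Omega> \<Longrightarrow> y \<in> \<Omega> \<Longrightarrow> norm (x - y) \<le> D"
  proof -
    obtain B where B: "B > 0" "\<And>x. x \<in> \<Omega> \<Longrightarrow> norm x \<le> B" using \<Omega>(2) by (auto simp: bounded_pos)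
    have "norm (x - y) \<le> 2 * B" if "x \<in> \<Omega>" "y \<in> \<Omega>" for x y
      using B(2)[OF that(1)] B(2)[OF that(2)] norm_triangle_ineq4[of x y] by linarith
    then show ?thesis using that[of "2 * B"] B(1) by auto
  qed
  define q where "q = D powr (-(real DIM('a) + 2 * s))"
  have q: "q > 0" using D by (simp add: q_def)
  define c where "c = \<delta> / 2 * q * m"
  have c: "c > 0" using \<delta> q m by (simp add: c_def)
  (* The first summand makes w at most - K delta / 2 on E n, the second beats the right-hand side. *)
  define K where "K = 2 * M / \<delta> + (\<bar>\<Lambda>\<bar> * M + 1) / (\<kappa> * c)"
  have K: "K > 0" using M \<delta> \<kappa> c unfolding K_def by (intro add_pos_nonneg) auto
  have K1: "M - K * \<delta> \<le> - (K * \<delta> / 2)"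
  proof -
    have "2 * M / \<delta> \<le> K" using M \<kappa> c by (simp add: K_def)
    then have "2 * M \<le> K * \<delta>" using \<delta> by (simp add: pos_divide_le_eq)
    then show ?thesis by simp
  qed
  have K2: "\<bar>\<Lambda>\<bar> * M < \<kappa> * (K * c)"
  proof -
    have "(\<bar>\<Lambda>\<bar> * M + 1) / (\<kappa> * c) \<le> K" using M \<delta> by (simp add: K_def)
    then have "\<bar>\<Lambda>\<bar> * M + 1 \<le> K * (\<kappa> * c)" using \<kappa> c by (simp add: pos_divide_le_eq)
    then show ?thesis by (simp add: ac_simps)
  qed
  define w where "w = (\<lambda>x. 1 * u x + (- K) * \<phi> x)"
  have w: "borel_H_s s w" unfolding w_def by (rule borel_H_s_lincomb[OF u \<phi>])
  have [measurable]: "w \<in> borel_measurable borel" using w by (rule borel_H_s_measurable)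
  define p where "p x = max 0 (w x)" for x
  have p: "borel_H_s s p" using borel_H_s_pos_part[OF w, of 0] by (simp add: p_def[abs_def])
  have [measurable]: "p \<in> borel_measurable borel" using p by (rule borel_H_s_measurable)
  have psq: "square_integrable lborel p" using p by (simp add: borel_H_s_def)
  have pnn: "p x \<ge> 0" for x by (simp add: p_def)
  have p0: "AE x in lborel. x \<notin> \<Omega> \<longrightarrow> p x = 0" using u0 \<phi>0 by eventually_elim (auto simp: p_def w_def)
  have pi: "integrable lborel p"
  proof -
    have "square_integrable lborel (indicator \<Omega> :: 'a \<Rightarrow> real)"
    proof -
      have "(\<lambda>x. (indicator \<Omega> x :: real)\<^sup>2) = indicator \<Omega>" by (auto simp: indicator_def)
      then show ?thesis using \<Omega>fin by (simp add: square_integrable_def integrable_real_indicator)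
    qed
    then have "integrable lborel (\<lambda>x. indicator \<Omega> x * p x)" using psq by (rule square_integrable_mult)
    then show ?thesis
      by (rule integrable_cong_AE_imp) (use p0 in \<open>auto simp: indicator_def elim!: eventually_mono\<close>)
  qed
  define I where "I = (\<integral>x. p x \<partial>lborel)"
  have Inn: "I \<ge> 0" unfolding I_def using pnn by (intro integral_nonneg_AE) auto
  define a where "a x = K * \<delta> / 2 * q * p x" for x
  define S where "S x = (if x \<in> \<Omega> then E n else {})" for x
  have "(\<integral>x. a x \<partial>lborel) * m \<le> gagliardo_form s w p"
  proof (rule gagliardo_form_lower_bound[OF w p])
    show mono: "(w x - w y) * (p x - p y) \<ge> 0" for x y
      by (cases "w x \<le> w y") (auto simp: p_def intro: mult_nonneg_nonneg mult_nonpos_nonpos)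
    show "a \<in> borel_measurable borel" unfolding a_def[abs_def] by measurable
    show "a x \<ge> 0" for x using q pnn[of x] K \<delta> by (simp add: a_def)
    show "integrable lborel a" unfolding a_def[abs_def] using pi by simp
    show "S x \<in> sets borel" for x by (simp add: S_def)
    show "a x \<le> (w x - w y) * (p x - p y) * kern (2 * s) (x - y)" if y: "y \<in> S x" for x y
    proof (cases "p x > 0")
      case True
      then have wx: "w x = p x" by (simp add: p_def max_def split: if_splits)
      have xy: "x \<in> \<Omega>" "y \<in> \<Omega>" "\<phi> y > \<delta>" "\<bar>u y\<bar> \<le> M"
        using y by (auto simp: S_def E_def \<delta>_def split: if_splits)
      have "K * \<delta> \<le> K * \<phi> y" using K xy(3) by (intro mult_left_mono) auto
      then have "w y \<le> M - K * \<delta>" using xy(4) by (simp add: w_def)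
      then have wy: "w y \<le> - (K * \<delta> / 2)" using K1 by linarith
      have Kd: "K * \<delta> > 0" using K \<delta> by simp
      have py: "p y = 0" using wy Kd by (simp add: p_def)
      have "x \<noteq> y" using True py by auto
      then have "q \<le> kern (2 * s) (x - y)"
        unfolding q_def kern_def using D(2)[OF xy(1,2)] s by (intro powr_mono2') auto
      moreover have "K * \<delta> / 2 * p x \<le> (w x - w y) * (p x - p y)"
        unfolding py wx using True wy by (simp add: mult_right_mono)
      moreover have "0 \<le> K * \<delta> / 2 * p x" using Kd True by simp
      ultimately have "(K * \<delta> / 2 * p x) * q \<le> (w x - w y) * (p x - p y) * kern (2 * s) (x - y)"
        using less_imp_le[OF q] by (metis mult_mono')
      then show ?thesis by (simp add: a_def ac_simps)
    next
      case False
      then have "p x = 0" using pnn[of x] by simp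
      then show ?thesis using mult_nonneg_nonneg[OF mono[of x y] kern_nonneg[of "2 * s" "x - y"]] by (simp add: a_def)
    qed
    show "AE x in lborel. a x > 0 \<longrightarrow> ennreal m \<le> emeasure lborel (S x)"
      using p0 by eventually_elim (auto simp: a_def S_def Em)
  qed (use m in auto)
  then have "\<kappa> * (K * \<delta> / 2 * q * I * m) \<le> \<kappa> * gagliardo_form s w p"
    using \<kappa> by (intro mult_left_mono) (auto simp: a_def I_def)
  also have "\<dots> = \<kappa> * gagliardo_form s u p - K * (\<kappa> * gagliardo_form s \<phi> p)"
    unfolding w_def gagliardo_form_lincomb[OF u \<phi> p] by (simp add: algebra_simps)
  also have "\<dots> = \<Lambda> * (\<integral>x. u x * p x \<partial>lborel) - K * (\<Lambda>1 * (\<integral>x. \<phi> x * p x \<partial>lborel))"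
    by (simp only: test[OF p p0] test1[OF p p0])
  also have "\<dots> \<le> \<bar>\<Lambda>\<bar> * (M * I)"
  proof -
    have "0 \<le> (\<integral>x. \<phi> x * p x \<partial>lborel)"
      using \<phi>nn pnn by (intro integral_nonneg_AE) (auto elim!: eventually_mono)
    then have 1: "0 \<le> K * (\<Lambda>1 * (\<integral>x. \<phi> x * p x \<partial>lborel))" using K \<Lambda>1 by simp
    have "\<bar>\<integral>x. u x * p x \<partial>lborel\<bar> \<le> (\<integral>x. M * p x \<partial>lborel)"
    proof (rule order_trans[OF integral_abs_bound], rule integral_mono_AE)
      show "integrable lborel (\<lambda>x. \<bar>u x * p x\<bar>)" by (intro integrable_abs square_integrable_mult usq psq)
      show "AE x in lborel. \<bar>u x * p x\<bar> \<le> M * p x"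
        using M(2) by eventually_elim (use pnn in \<open>auto simp: abs_mult intro: mult_right_mono\<close>)
    qed (use pi in simp)
    then have "\<bar>\<Lambda>\<bar> * \<bar>\<integral>x. u x * p x \<partial>lborel\<bar> \<le> \<bar>\<Lambda>\<bar> * (M * I)" by (intro mult_left_mono) (auto simp: I_def)
    then have "\<Lambda> * (\<integral>x. u x * p x \<partial>lborel) \<le> \<bar>\<Lambda>\<bar> * (M * I)" unfolding abs_mult[symmetric] by linarith
    then show ?thesis using 1 by linarith
  qed
  finally have "(\<kappa> * (K * c) - \<bar>\<Lambda>\<bar> * M) * I \<le> 0" by (simp add: c_def algebra_simps)
  then have "I \<le> 0" using K2 by (simp add: mult_le_0_iff)
  then have "I = 0" using Inn by simp
  then have "AE x in lborel. p x = 0"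
    unfolding I_def using pi pnn by (subst (asm) integral_nonneg_eq_0_iff_AE) auto
  then have "AE x in lborel. u x \<le> K * \<phi> x"
    by eventually_elim (simp add: p_def w_def max_def split: if_splits)
  then show ?thesis using K by blast
qed

theorem form_eigenfunction_abs_le_first:
  fixes u \<phi> :: "'a::euclidean_space \<Rightarrow> real"
  assumes s: "0 < s" and \<kappa>: "\<kappa> > 0" and eig: "form_eigenfunction s \<kappa> \<Omega> \<Lambda> u"
    and eig1: "form_eigenfunction s \<kappa> \<Omega> \<Lambda>1 \<phi>" and pos: "AE x in lborel. x \<in> \<Omega> \<longrightarrow> \<phi> x > 0"
    and \<Omega>: "open \<Omega>" "bounded \<Omega>" "\<Omega> \<noteq> {}"
  shows "\<exists>K>0. AE x in lborel. x \<in> \<Omega> \<longrightarrow> \<bar>u x\<bar> \<le> K * \<phi> x"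
proof -
  have eig': "form_eigenfunction s \<kappa> \<Omega> \<Lambda> (\<lambda>x. - u x)"
    using form_eigenfunction_cmult[OF eig, of "-1"] by simp
  obtain M1 where M1: "M1 > 0" "AE x in lborel. u x \<le> M1"
    using form_eigenfunction_bounded_above[OF s \<kappa> eig] by blast
  obtain M2 where M2: "M2 > 0" "AE x in lborel. - u x \<le> M2"
    using form_eigenfunction_bounded_above[OF s \<kappa> eig'] by blast
  define M where "M = max M1 M2"
  have M: "M > 0" "AE x in lborel. \<bar>u x\<bar> \<le> M"
    using M1 M2 by (auto simp: M_def elim: eventually_elim2)
  obtain K1 where K1: "K1 > 0" "AE x in lborel. u x \<le> K1 * \<phi> x"
    using form_eigenfunction_le_first[OF s \<kappa> eig eig1 pos \<Omega> M] by blast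
  obtain K2 where K2: "K2 > 0" "AE x in lborel. - u x \<le> K2 * \<phi> x"
    using form_eigenfunction_le_first[OF s \<kappa> eig' eig1 pos \<Omega> M(1)] M(2) by auto
  have "AE x in lborel. x \<in> \<Omega> \<longrightarrow> \<bar>u x\<bar> \<le> (K1 + K2) * \<phi> x"
    using K1(2) K2(2) pos
  proof eventually_elim
    case (elim x)
    show ?case
    proof
      assume "x \<in> \<Omega>"
      then have "K1 * \<phi> x \<ge> 0" "K2 * \<phi> x \<ge> 0" using elim K1 K2 by auto
      then show "\<bar>u x\<bar> \<le> (K1 + K2) * \<phi> x" using elim by (simp add: distrib_right abs_le_iff)
    qed
  qed
  then show ?thesis using K1 K2 by (intro exI[of _ "K1 + K2"]) auto
qed

section \<open>Linear combinations of weak solutions\<close>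

lemma weak_solution_cong:
  assumes "weak_solution s \<Omega> h u" and ae: "AE x in lebesgue. x \<in> \<Omega> \<longrightarrow> h x = k x"
  shows "weak_solution s \<Omega> k u"
proof -
  have "(LINT x:\<Omega>|lebesgue. h x * \<phi> x) = (LINT x:\<Omega>|lebesgue. k x * \<phi> x)" for \<phi>
    unfolding set_lebesgue_integral_def
    by (rule integral_lebesgue_cong_AE) (use ae in \<open>auto simp: indicator_def elim!: eventually_mono\<close>)
  then show ?thesis using assms(1) by (simp add: weak_solution_def)
qed

lemma half_form_constantD:
  fixes u v :: "'a::euclidean_space \<Rightarrow> real"
  assumes "half_form_constant s TYPE('a) \<kappa>" "u \<in> H_s s" "v \<in> H_s s" "borel_H_s s u'" "borel_H_s s v'"
    "AE x in lborel. u x = u' x" "AE x in lborel. v x = v' x"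
  shows "(LINT x|lebesgue. frac_laplacian (s / 2) u x * frac_laplacian (s / 2) v x) = \<kappa> * gagliardo_form s u' v'"
  using assms unfolding half_form_constant_def by blast

lemma H_s_lincomb:
  fixes u v :: "'a::euclidean_space \<Rightarrow> real"
  assumes u: "u \<in> H_s s" and v: "v \<in> H_s s"
  shows "(\<lambda>x. a * u x + b * v x) \<in> H_s s"
proof -
  obtain u' where u': "borel_H_s s u'" "AE x in lborel. u x = u' x" using H_s_borel_representative[OF u] .
  obtain v' where v': "borel_H_s s v'" "AE x in lborel. v x = v' x" using H_s_borel_representative[OF v] .
  have m: "(\<lambda>x. a * u x + b * v x) \<in> borel_measurable lebesgue"
    using u v by (intro borel_measurable_add borel_measurable_times) (auto simp: H_s_def)
  have ae: "AE x in lborel. a * u x + b * v x = a * u' x + b * v' x"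
    using u'(2) v'(2) by eventually_elim simp
  have B: "borel_H_s s (\<lambda>x. a * u' x + b * v' x)" by (rule borel_H_s_lincomb[OF u'(1) v'(1)])
  show ?thesis using H_s_iff_borel[OF m ae borel_H_s_measurable[OF B]] B by simp
qed

lemma X0_s_lincomb:
  assumes "u \<in> X0_s s \<Omega>" "v \<in> X0_s s \<Omega>"
  shows "(\<lambda>x. a * u x + b * v x) \<in> X0_s s \<Omega>"
proof -
  have "AE x in lebesgue. x \<notin> \<Omega> \<longrightarrow> u x = 0" "AE x in lebesgue. x \<notin> \<Omega> \<longrightarrow> v x = 0"
    using assms by (auto simp: X0_s_def)
  then have "AE x in lebesgue. x \<notin> \<Omega> \<longrightarrow> a * u x + b * v x = 0" by eventually_elim auto
  moreover have "(\<lambda>x. a * u x + b * v x) \<in> H_s s" using assms by (intro H_s_lincomb) (auto simp: X0_s_def)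
  ultimately show ?thesis by (simp add: X0_s_def)
qed

lemma borel_H_s_in_X0_s:
  assumes v: "borel_H_s s v" and "AE x in lborel. x \<notin> \<Omega> \<longrightarrow> v x = 0"
  shows "v \<in> X0_s s \<Omega>"
proof -
  have m: "v \<in> borel_measurable borel" using v by (rule borel_H_s_measurable)
  then have "v \<in> borel_measurable lebesgue" by (intro measurable_completion) simp
  then have "v \<in> H_s s" using H_s_iff_borel[OF _ _ m] v by auto
  then show ?thesis using assms(2) by (simp add: X0_s_def AE_completion_iff)
qed

lemma weak_solution_lincomb:
  fixes u v h k :: "'a::euclidean_space \<Rightarrow> real"
  assumes \<kappa>: "half_form_constant s TYPE('a) \<kappa>"
    and u: "weak_solution s \<Omega> h u" and v: "weak_solution s \<Omega> k v"
    and h: "square_integrable lebesgue (\<lambda>x. indicator \<Omega> x * h x)"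
    and k: "square_integrable lebesgue (\<lambda>x. indicator \<Omega> x * k x)"
  shows "weak_solution s \<Omega> (\<lambda>x. a * h x + b * k x) (\<lambda>x. a * u x + b * v x)"
  unfolding weak_solution_def
proof (intro conjI ballI)
  have uX: "u \<in> X0_s s \<Omega>" and vX: "v \<in> X0_s s \<Omega>" using u v by (auto simp: weak_solution_def)
  show X: "(\<lambda>x. a * u x + b * v x) \<in> X0_s s \<Omega>" by (rule X0_s_lincomb[OF uX vX])
  fix \<phi> assume \<phi>: "\<phi> \<in> X0_s s \<Omega>"
  have H: "u \<in> H_s s" "v \<in> H_s s" "\<phi> \<in> H_s s" "(\<lambda>x. a * u x + b * v x) \<in> H_s s"
    using uX vX \<phi> X by (auto simp: X0_s_def)
  obtain u' where u': "borel_H_s s u'" "AE x in lborel. u x = u' x" using H_s_borel_representative[OF H(1)] .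
  obtain v' where v': "borel_H_s s v'" "AE x in lborel. v x = v' x" using H_s_borel_representative[OF H(2)] .
  obtain \<phi>' where \<phi>': "borel_H_s s \<phi>'" "AE x in lborel. \<phi> x = \<phi>' x" using H_s_borel_representative[OF H(3)] .
  have ae: "AE x in lborel. a * u x + b * v x = a * u' x + b * v' x"
    using u'(2) v'(2) by eventually_elim simp
  have \<phi>s: "square_integrable lebesgue \<phi>" using H(3) by (simp add: H_s_def square_integrable_def)
  have "(LINT x|lebesgue. frac_laplacian (s / 2) (\<lambda>x. a * u x + b * v x) x * frac_laplacian (s / 2) \<phi> x)
      = \<kappa> * gagliardo_form s (\<lambda>x. a * u' x + b * v' x) \<phi>'"
    by (rule half_form_constantD[OF \<kappa> H(4,3) borel_H_s_lincomb[OF u'(1) v'(1)] \<phi>'(1) ae \<phi>'(2)])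
  also have "\<dots> = a * (\<kappa> * gagliardo_form s u' \<phi>') + b * (\<kappa> * gagliardo_form s v' \<phi>')"
    by (simp add: gagliardo_form_lincomb[OF u'(1) v'(1) \<phi>'(1)] algebra_simps)
  also have "\<kappa> * gagliardo_form s u' \<phi>' = (LINT x:\<Omega>|lebesgue. h x * \<phi> x)"
    using half_form_constantD[OF \<kappa> H(1,3) u'(1) \<phi>'(1) u'(2) \<phi>'(2)] u \<phi> by (simp add: weak_solution_def)
  also have "\<kappa> * gagliardo_form s v' \<phi>' = (LINT x:\<Omega>|lebesgue. k x * \<phi> x)"
    using half_form_constantD[OF \<kappa> H(2,3) v'(1) \<phi>'(1) v'(2) \<phi>'(2)] v \<phi> by (simp add: weak_solution_def)
  also have "a * (LINT x:\<Omega>|lebesgue. h x * \<phi> x) + b * (LINT x:\<Omega>|lebesgue. k x * \<phi> x)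
      = (LINT x:\<Omega>|lebesgue. (a * h x + b * k x) * \<phi> x)"
  proof -
    have i: "integrable lebesgue (\<lambda>x. indicator \<Omega> x * h x * \<phi> x)" "integrable lebesgue (\<lambda>x. indicator \<Omega> x * k x * \<phi> x)"
      using square_integrable_mult[OF h \<phi>s] square_integrable_mult[OF k \<phi>s] by auto
    have "(LINT x:\<Omega>|lebesgue. (a * h x + b * k x) * \<phi> x)
        = (LINT x|lebesgue. a * (indicator \<Omega> x * h x * \<phi> x) + b * (indicator \<Omega> x * k x * \<phi> x))"
      unfolding set_lebesgue_integral_def
      by (intro Bochner_Integration.integral_cong) (auto simp: algebra_simps)
    also have "\<dots> = a * (LINT x|lebesgue. indicator \<Omega> x * h x * \<phi> x) + b * (LINT x|lebesgue. indicator \<Omega> x * k x * \<phi> x)"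
      using i by simp
    finally show ?thesis by (simp add: set_lebesgue_integral_def mult.assoc)
  qed
  finally show "(LINT x|lebesgue. frac_laplacian (s / 2) (\<lambda>x. a * u x + b * v x) x * frac_laplacian (s / 2) \<phi> x)
      = (LINT x:\<Omega>|lebesgue. (a * h x + b * k x) * \<phi> x)" .
qed

lemma eigenspace_form_eigenfunction:
  fixes w w' :: "'a::euclidean_space \<Rightarrow> real"
  assumes \<kappa>: "half_form_constant s TYPE('a) \<kappa>" and w: "w \<in> eigenspace s \<Omega> \<Lambda>"
    and w': "borel_H_s s w'" "AE x in lborel. w x = w' x"
  shows "form_eigenfunction s \<kappa> \<Omega> \<Lambda> w'"
  unfolding form_eigenfunction_def
proof (intro conjI allI impI w'(1))
  have ws: "weak_solution s \<Omega> (\<lambda>x. \<Lambda> * w x) w" using w by (simp add: eigenspace_def)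
  then have wX: "w \<in> X0_s s \<Omega>" by (simp add: weak_solution_def)
  then have "AE x in lborel. x \<notin> \<Omega> \<longrightarrow> w x = 0" by (simp add: X0_s_def AE_completion_iff)
  then show "AE x in lborel. x \<notin> \<Omega> \<longrightarrow> w' x = 0" using w'(2) by eventually_elim auto
  fix v assume v: "borel_H_s s v" "AE x in lborel. x \<notin> \<Omega> \<longrightarrow> v x = 0"
  have vX: "v \<in> X0_s s \<Omega>" by (rule borel_H_s_in_X0_s[OF v])
  have [measurable]: "v \<in> borel_measurable borel" "w' \<in> borel_measurable borel"
    using v w' by (auto intro: borel_H_s_measurable)
  have "\<kappa> * gagliardo_form s w' v = (LINT x|lebesgue. frac_laplacian (s / 2) w x * frac_laplacian (s / 2) v x)"
    using \<kappa> wX vX w' v unfolding half_form_constant_def X0_s_def by simp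
  also have "\<dots> = (LINT x:\<Omega>|lebesgue. \<Lambda> * w x * v x)" using ws vX by (simp add: weak_solution_def)
  also have "\<dots> = (LINT x|lebesgue. \<Lambda> * (w' x * v x))"
    unfolding set_lebesgue_integral_def
  proof (rule integral_lebesgue_cong_AE)
    have "AE x in lborel. indicator \<Omega> x *\<^sub>R (\<Lambda> * w x * v x) = \<Lambda> * (w' x * v x)"
      using w'(2) v(2) by eventually_elim (auto simp: indicator_def)
    then show "AE x in lebesgue. indicator \<Omega> x *\<^sub>R (\<Lambda> * w x * v x) = \<Lambda> * (w' x * v x)"
      by (simp add: AE_completion_iff)
  qed
  also have "\<dots> = (LINT x|lborel. \<Lambda> * (w' x * v x))" by (rule integral_completion) measurable
  finally show "\<kappa> * gagliardo_form s w' v = \<Lambda> * (\<integral>x. w' x * v x \<partial>lborel)" by simp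
qed

text \<open>The divergence of the sequence makes the set of indices with the same eigenvalue finite; otherwise its
  cardinality would be zero by convention and would not yield an eigenfunction.\<close>

lemma eigenvalue_sequence_eigenfunction:
  fixes \<Omega> :: "'a::euclidean_space set"
  assumes seq: "eigenvalue_sequence s \<Omega> lam" and k: "1 \<le> k"
  shows "\<exists>\<psi>\<in>eigenspace s \<Omega> (lam k). \<not> (AE x in lebesgue. \<psi> x = 0)"
proof -
  have "eventually (\<lambda>j. lam j > lam k) sequentially"
    using seq by (simp add: eigenvalue_sequence_def filterlim_at_top_dense)
  then obtain n where n: "\<And>j. j \<ge> n \<Longrightarrow> lam j > lam k" by (auto simp: eventually_sequentially)
  have "{j. 1 \<le> j \<and> lam j = lam k} \<subseteq> {..<n}" using n by (force simp: not_less[symmetric])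
  then have "finite {j. 1 \<le> j \<and> lam j = lam k}" by (rule finite_subset) simp
  moreover have "k \<in> {j. 1 \<le> j \<and> lam j = lam k}" using k by simp
  ultimately have "1 \<le> card {j. 1 \<le> j \<and> lam j = lam k}"
    by (metis One_nat_def Suc_leI card_gt_0_iff empty_iff)
  then obtain e where e: "\<forall>i<1. e i \<in> eigenspace s \<Omega> (lam k)" "ae_independent 1 e"
    using seq unfolding eigenvalue_sequence_def by blast
  have "\<not> (AE x in lebesgue. e 0 x = 0)"
  proof
    assume "AE x in lebesgue. e 0 x = 0"
    then show False using e(2)[unfolded ae_independent_def, rule_format, of "\<lambda>_. 1" 0] by simp
  qed
  then show ?thesis using e(1) by auto
qed

text \<open>The eigenvalues are unbounded, so one of them is positive; testing its equation with the
  eigenfunction itself gives a positive value on the right and a nonnegative form on the left.\<close>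

lemma half_form_constant_pos:
  fixes \<Omega> :: "'a::euclidean_space set"
  assumes \<kappa>: "half_form_constant s TYPE('a) \<kappa>" and seq: "eigenvalue_sequence s \<Omega> lam"
  shows "\<kappa> > 0"
proof -
  have "eventually (\<lambda>j. lam j > 0) sequentially"
    using seq by (simp add: eigenvalue_sequence_def filterlim_at_top_dense)
  then have "eventually (\<lambda>j. lam j > 0 \<and> 1 \<le> j) sequentially"
    using eventually_ge_at_top[of 1] by eventually_elim auto
  then obtain j where j: "lam j > 0" "1 \<le> j" by (auto simp: eventually_sequentially)
  obtain w where w: "w \<in> eigenspace s \<Omega> (lam j)" "\<not> (AE x in lebesgue. w x = 0)"
    using eigenvalue_sequence_eigenfunction[OF seq j(2)] by blast
  have "w \<in> H_s s" using w(1) by (simp add: eigenspace_def weak_solution_def X0_s_def)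
  then obtain w' where w': "borel_H_s s w'" "AE x in lborel. w x = w' x" by (rule H_s_borel_representative)
  have eig: "form_eigenfunction s \<kappa> \<Omega> (lam j) w'" by (rule eigenspace_form_eigenfunction[OF \<kappa> w(1) w'])
  then have eq: "\<kappa> * gagliardo_form s w' w' = lam j * (\<integral>x. w' x * w' x \<partial>lborel)"
    by (auto simp: form_eigenfunction_def)
  have i: "integrable lborel (\<lambda>x. w' x * w' x)"
    using w'(1) by (intro square_integrable_mult) (auto simp: borel_H_s_def)
  have "(\<integral>x. w' x * w' x \<partial>lborel) \<noteq> 0"
  proof
    assume "(\<integral>x. w' x * w' x \<partial>lborel) = 0"
    then have "AE x in lborel. w' x * w' x = 0" using i by (subst (asm) integral_nonneg_eq_0_iff_AE) auto
    then have "AE x in lborel. w x = 0" using w'(2) by eventually_elim auto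
    then show False using w(2) by (simp add: AE_completion_iff)
  qed
  moreover have "(\<integral>x. w' x * w' x \<partial>lborel) \<ge> 0" by (intro integral_nonneg_AE) auto
  ultimately have "(\<integral>x. w' x * w' x \<partial>lborel) > 0" by linarith
  then have "\<kappa> * gagliardo_form s w' w' > 0" unfolding eq using j(1) by (rule mult_pos_pos[rotated])
  then show ?thesis using gagliardo_form_nonneg[of s w'] by (auto simp: zero_less_mult_iff)
qed

section \<open>The second solution\<close>

lemma in_L_square_integrable:
  fixes \<Omega> :: "'a::euclidean_space set"
  assumes f: "in_L q \<Omega> f" and q: "q \<ge> 2" and \<Omega>: "\<Omega> \<in> sets borel" "bounded \<Omega>"
  shows "square_integrable lebesgue (\<lambda>x. indicator \<Omega> x * f x)"
  unfolding square_integrable_def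
proof
  show m: "(\<lambda>x. indicator \<Omega> x * f x) \<in> borel_measurable lebesgue"
    using f by (simp add: in_L_def set_borel_measurable_def)
  have 1: "integrable lebesgue (\<lambda>x. indicator \<Omega> x * \<bar>f x\<bar> powr q)"
    using f by (simp add: in_L_def set_integrable_def)
  have 2: "integrable lebesgue (indicator \<Omega> :: 'a \<Rightarrow> real)"
    using emeasure_bounded_finite[OF \<Omega>(2)] \<Omega>(1) by (intro integrable_real_indicator) auto
  show "integrable lebesgue (\<lambda>x. (indicator \<Omega> x * f x)\<^sup>2)"
  proof (rule Bochner_Integration.integrable_bound)
    show "integrable lebesgue (\<lambda>x. indicator \<Omega> x * \<bar>f x\<bar> powr q + indicator \<Omega> x)" using 1 2 by simp
    show "(\<lambda>x. (indicator \<Omega> x * f x)\<^sup>2) \<in> borel_measurable lebesgue" using m by measurable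
    have "(f x)\<^sup>2 \<le> \<bar>f x\<bar> powr q + 1" for x
    proof (cases "\<bar>f x\<bar> \<ge> 1")
      case True
      have "(f x)\<^sup>2 = \<bar>f x\<bar> powr 2" using True by (simp add: powr_numeral)
      also have "\<dots> \<le> \<bar>f x\<bar> powr q" using True q by (rule_tac powr_mono) auto
      finally show ?thesis by simp
    next
      case False
      then have "(f x)\<^sup>2 \<le> 1" by (simp add: abs_square_le_1)
      then show ?thesis by (simp add: add_increasing)
    qed
    then show "AE x in lebesgue. norm ((indicator \<Omega> x * f x)\<^sup>2) \<le> norm (indicator \<Omega> x * \<bar>f x\<bar> powr q + indicator \<Omega> x)"
      by (intro AE_I2) (auto simp: indicator_def)
  qed
qed

lemma X0_s_square_integrable:
  fixes \<Omega> :: "'a::euclidean_space set"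
  assumes u: "u \<in> X0_s s \<Omega>" and \<Omega>: "\<Omega> \<in> sets borel"
  shows "square_integrable lebesgue (\<lambda>x. indicator \<Omega> x * u x)"
proof (rule square_integrable_bound)
  show us: "square_integrable lebesgue u" using u by (simp add: X0_s_def H_s_def square_integrable_def)
  have "(indicator \<Omega> :: 'a \<Rightarrow> real) \<in> borel_measurable lebesgue" using \<Omega> by (intro borel_measurable_indicator) auto
  then show "(\<lambda>x. indicator \<Omega> x * u x) \<in> borel_measurable lebesgue" using us by measurable
  show "AE x in lebesgue. \<bar>indicator \<Omega> x * u x\<bar> \<le> \<bar>u x\<bar>" by (intro AE_I2) (auto simp: indicator_def)
qed

lemma small_perturbation:
  fixes A A' B B' d d' :: real
  assumes "A < B" "A' < B'"
  shows "\<exists>\<delta>>0. A + \<delta> * d < B \<and> A' + \<delta> * d' < B'"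
proof -
  have key: "A + \<delta> * d < B" if "0 < \<delta>" "\<delta> \<le> (B - A) / (\<bar>d\<bar> + 1)" "A < B" for \<delta> A B d :: real
  proof -
    have "\<delta> * d \<le> \<delta> * \<bar>d\<bar>" using that by (intro mult_left_mono) auto
    moreover have "\<delta> * (\<bar>d\<bar> + 1) \<le> B - A" using that by (simp add: pos_le_divide_eq)
    ultimately have "\<delta> * d \<le> B - A - \<delta>" by (simp only: distrib_left mult_1_right)
    then show ?thesis using that(1) by linarith
  qed
  define \<delta> where "\<delta> = min ((B - A) / (\<bar>d\<bar> + 1)) ((B' - A') / (\<bar>d'\<bar> + 1))"
  have "\<delta> > 0" using assms by (simp add: \<delta>_def)
  then show ?thesis using key[of \<delta> B A d] key[of \<delta> B' A' d'] assms
    by (intro exI[of _ \<delta>]) (auto simp: \<delta>_def)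
qed

lemma sym_mat2_eigenvector:
  assumes "matrix_eigenvalue (sym_mat2 a b c) \<mu>"
  obtains p1 p2 where "p1 \<noteq> 0 \<or> p2 \<noteq> 0" "a * p1 + b * p2 = \<mu> * p1" "b * p1 + c * p2 = \<mu> * p2"
proof -
  obtain v :: "real^2" where v: "v \<noteq> 0" "sym_mat2 a b c *v v = \<mu> *\<^sub>R v"
    using assms by (auto simp: matrix_eigenvalue_def)
  have "v $ 1 \<noteq> 0 \<or> v $ 2 \<noteq> 0" using v(1) by (auto simp: vec_eq_iff forall_2)
  moreover have "a * v $ 1 + b * v $ 2 = \<mu> * v $ 1 \<and> b * v $ 1 + c * v $ 2 = \<mu> * v $ 2"
    using v(2) by (simp add: vec_eq_iff forall_2 matrix_vector_mult_def sum_2 sym_mat2_def)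
  ultimately show thesis using that by blast
qed

text \<open>Where both components are negative the superlinear terms vanish, so that the system is the
  linear one there.\<close>

lemma system_solution_negative_iff:
  fixes \<Omega> :: "'a::euclidean_space set"
  assumes neg: "AE x in lebesgue. x \<in> \<Omega> \<longrightarrow> u x < 0 \<and> v x < 0"
  shows "system_solution s \<Omega> a b c \<alpha> \<beta> \<xi>1 \<xi>2 \<phi>1 f1 g1 t r u v \<longleftrightarrow>
     weak_solution s \<Omega> (\<lambda>x. a * u x + b * v x + t * \<phi>1 x + f1 x) u \<and>
     weak_solution s \<Omega> (\<lambda>x. b * u x + c * v x + r * \<phi>1 x + g1 x) v"
proof -
  have 1: "AE x in lebesgue. x \<in> \<Omega> \<longrightarrow>
      a * u x + b * v x + \<alpha> / (\<alpha> + \<beta>) * pos_part (u x) powr (\<alpha> - 1) * pos_part (v x) powr \<beta>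
          + \<xi>1 * pos_part (u x) powr (\<alpha> + \<beta> - 1) + t * \<phi>1 x + f1 x = a * u x + b * v x + t * \<phi>1 x + f1 x"
    using neg by eventually_elim (auto simp: pos_part_def)
  have 2: "AE x in lebesgue. x \<in> \<Omega> \<longrightarrow>
      b * u x + c * v x + \<beta> / (\<alpha> + \<beta>) * pos_part (u x) powr \<alpha> * pos_part (v x) powr (\<beta> - 1)
          + \<xi>2 * pos_part (v x) powr (\<alpha> + \<beta> - 1) + r * \<phi>1 x + g1 x = b * u x + c * v x + r * \<phi>1 x + g1 x"
    using neg by eventually_elim (auto simp: pos_part_def)
  have sym: "AE x in lebesgue. x \<in> \<Omega> \<longrightarrow> k x = h x" if "AE x in lebesgue. x \<in> \<Omega> \<longrightarrow> h x = k x" for h k :: "'a \<Rightarrow> real"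
    using that by eventually_elim auto
  show ?thesis
    unfolding system_solution_def
    using weak_solution_cong[OF _ 1] weak_solution_cong[OF _ sym[OF 1]]
      weak_solution_cong[OF _ 2] weak_solution_cong[OF _ sym[OF 2]] by blast
qed

text \<open>If \<open>h\<close> is the linear right-hand side for \<open>u\<close>, then moving \<open>u\<close> along the first eigenfunction and
  along \<open>\<psi>\<close> changes it by \<open>- \<delta> \<Lambda>1 \<phi> + \<epsilon> \<Lambda> \<psi>\<close>.\<close>

lemma weak_solution_shift:
  fixes u \<phi> \<psi> h :: "'a::euclidean_space \<Rightarrow> real"
  assumes \<kappa>: "half_form_constant s TYPE('a) \<kappa>" and \<Omega>: "\<Omega> \<in> sets borel"
    and u: "weak_solution s \<Omega> h u" and h: "square_integrable lebesgue (\<lambda>x. indicator \<Omega> x * h x)"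
    and \<phi>: "\<phi> \<in> eigenspace s \<Omega> \<Lambda>1" and \<psi>: "\<psi> \<in> eigenspace s \<Omega> \<Lambda>"
    and k: "\<And>x. k x = h x - \<delta> * (\<Lambda>1 * \<phi> x) + \<epsilon> * (\<Lambda> * \<psi> x)"
  shows "weak_solution s \<Omega> k (\<lambda>x. u x - \<delta> * \<phi> x + \<epsilon> * \<psi> x)"
proof -
  have ws: "weak_solution s \<Omega> (\<lambda>x. \<Lambda>1 * \<phi> x) \<phi>" "weak_solution s \<Omega> (\<lambda>x. \<Lambda> * \<psi> x) \<psi>"
    using \<phi> \<psi> by (auto simp: eigenspace_def)
  then have X: "\<phi> \<in> X0_s s \<Omega>" "\<psi> \<in> X0_s s \<Omega>" by (auto simp: weak_solution_def)
  have sq: "square_integrable lebesgue (\<lambda>x. indicator \<Omega> x * (c * w x))" if "w \<in> X0_s s \<Omega>" for c w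
    using square_integrable_cmult[OF X0_s_square_integrable[OF that \<Omega>], of c] by (simp add: mult.left_commute)
  have 1: "weak_solution s \<Omega> (\<lambda>x. 1 * h x + (- \<delta>) * (\<Lambda>1 * \<phi> x)) (\<lambda>x. 1 * u x + (- \<delta>) * \<phi> x)"
    by (rule weak_solution_lincomb[OF \<kappa> u ws(1) h sq[OF X(1)]])
  have s1: "square_integrable lebesgue (\<lambda>x. indicator \<Omega> x * (1 * h x + (- \<delta>) * (\<Lambda>1 * \<phi> x)))"
    using square_integrable_add[OF h sq[OF X(1), of "- \<delta> * \<Lambda>1"]] by (simp add: distrib_left right_diff_distrib mult.assoc)
  have "weak_solution s \<Omega> (\<lambda>x. 1 * (1 * h x + (- \<delta>) * (\<Lambda>1 * \<phi> x)) + \<epsilon> * (\<Lambda> * \<psi> x))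
      (\<lambda>x. 1 * (1 * u x + (- \<delta>) * \<phi> x) + \<epsilon> * \<psi> x)"
    by (rule weak_solution_lincomb[OF \<kappa> 1 ws(2) s1 sq[OF X(2)]])
  moreover have "(\<lambda>x. 1 * (1 * h x + (- \<delta>) * (\<Lambda>1 * \<phi> x)) + \<epsilon> * (\<Lambda> * \<psi> x)) = k" by (rule ext) (simp add: k)
  ultimately show ?thesis by simp
qed

theorem theorem1p3:
  fixes \<Omega> :: "'a::euclidean_space set"
    and s \<xi>1 \<xi>2 \<alpha> \<beta> a b c \<mu>1 \<mu>2 q \<eta> \<theta> :: real
    and lam :: "nat \<Rightarrow> real" and k :: nat
    and \<phi>1 f1 g1 :: "'a \<Rightarrow> real"
    and uT vT :: "real \<times> real \<Rightarrow> 'a \<Rightarrow> real"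
  assumes "0 < s" and "s < 1"
    and "bounded_smooth_domain \<Omega>"
    and "real DIM('a) > 6 * s"
    and "\<xi>1 > 0" and "\<xi>2 > 0"
    and "\<alpha> > 1" and "\<beta> > 1"
    and "\<alpha> + \<beta> = 2 * real DIM('a) / (real DIM('a) - 2 * s)"
    and "eigenvalue_sequence s \<Omega> lam"
    and "positive_first_eigenfunction s \<Omega> lam \<phi>1"
    and "{\<mu>. matrix_eigenvalue (sym_mat2 a b c) \<mu>} = {\<mu>1, \<mu>2}"
    and "k > 1"
    and "lam k = \<mu>1" and "\<mu>1 \<le> \<mu>2" and "\<mu>2 < lam (k + 1)"
    and "q > real DIM('a) / (2 * s)"
    and "in_L q \<Omega> f1" and "in_L q \<Omega> g1"
    and "(LINT x:\<Omega>|lebesgue. f1 x * \<phi>1 x) = 0"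
    and "(LINT x:\<Omega>|lebesgue. g1 x * \<phi>1 x) = 0"
    and "orthogonal_to_kernel s \<Omega> (lam k) f1 g1"
    and "\<eta> < 0" and "\<theta> < 0"
    and "\<forall>(t, r) \<in> parameter_region (lam 1) a b c \<eta> \<theta>.
           system_solution s \<Omega> a b c \<alpha> \<beta> \<xi>1 \<xi>2 \<phi>1 f1 g1 t r (uT (t, r)) (vT (t, r)) \<and>
           (AE x in lebesgue. x \<in> \<Omega> \<longrightarrow> uT (t, r) x < 0 \<and> vT (t, r) x < 0)"
  shows "\<forall>(t, r) \<in> parameter_region (lam 1) a b c \<eta> \<theta>.
           \<exists>u v. system_solution s \<Omega> a b c \<alpha> \<beta> \<xi>1 \<xi>2 \<phi>1 f1 g1 t r u v \<and>
             \<not> (AE x in lebesgue. u x = uT (t, r) x \<and> v x = vT (t, r) x)"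
proof -
  have s: "0 < s" "s < 1" using assms(1,2) .
  have \<Omega>: "open \<Omega>" "bounded \<Omega>" "\<Omega> \<noteq> {}" using assms(3) by (auto simp: bounded_smooth_domain_def)
  have \<Omega>b: "\<Omega> \<in> sets borel" using \<Omega>(1) by auto
  (* N > 6 s gives q > 3, so that f1 and g1 are square integrable on the bounded domain. *)
  have "q \<ge> 2"
  proof -
    have "real DIM('a) / (2 * s) > 3" using assms(1,4) by (simp add: pos_less_divide_eq)
    then show ?thesis using assms(17) by simp
  qed
  then have f1: "square_integrable lebesgue (\<lambda>x. indicator \<Omega> x * f1 x)"
    and g1: "square_integrable lebesgue (\<lambda>x. indicator \<Omega> x * g1 x)"
    using in_L_square_integrable[OF assms(18) _ \<Omega>b \<Omega>(2)] in_L_square_integrable[OF assms(19) _ \<Omega>b \<Omega>(2)] by auto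
  obtain \<kappa> where \<kappa>: "half_form_constant s TYPE('a) \<kappa>"
    using frac_laplacian_half_form[OF s] by blast
  have \<kappa>pos: "\<kappa> > 0" by (rule half_form_constant_pos[OF \<kappa> assms(10)])
  have \<phi>e: "\<phi>1 \<in> eigenspace s \<Omega> (lam 1)" and \<phi>p: "AE x in lebesgue. x \<in> \<Omega> \<longrightarrow> \<phi>1 x > 0"
    using assms(11) by (auto simp: positive_first_eigenfunction_def)
  obtain \<psi> where \<psi>: "\<psi> \<in> eigenspace s \<Omega> (lam k)" "\<not> (AE x in lebesgue. \<psi> x = 0)"
    using eigenvalue_sequence_eigenfunction[OF assms(10), of k] assms(13) by auto
  have "matrix_eigenvalue (sym_mat2 a b c) (lam k)" using assms(12,14) by auto
  then obtain p1 p2 where p: "p1 \<noteq> 0 \<or> p2 \<noteq> 0" "a * p1 + b * p2 = lam k * p1" "b * p1 + c * p2 = lam k * p2"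
    by (rule sym_mat2_eigenvector)
  have X: "\<phi>1 \<in> X0_s s \<Omega>" "\<psi> \<in> X0_s s \<Omega>" using \<phi>e \<psi>(1) by (auto simp: eigenspace_def weak_solution_def)
  obtain M where M: "M > 0" "AE x in lebesgue. x \<in> \<Omega> \<longrightarrow> \<bar>\<psi> x\<bar> \<le> M * \<phi>1 x"
  proof -
    have H: "\<phi>1 \<in> H_s s" "\<psi> \<in> H_s s" using X by (auto simp: X0_s_def)
    obtain \<phi>' where \<phi>': "borel_H_s s \<phi>'" "AE x in lborel. \<phi>1 x = \<phi>' x" using H_s_borel_representative[OF H(1)] .
    obtain \<psi>' where \<psi>': "borel_H_s s \<psi>'" "AE x in lborel. \<psi> x = \<psi>' x" using H_s_borel_representative[OF H(2)] .
    have pos: "AE x in lborel. x \<in> \<Omega> \<longrightarrow> \<phi>' x > 0"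
      using \<phi>p \<phi>'(2) unfolding AE_completion_iff by eventually_elim auto
    obtain M where M: "M > 0" "AE x in lborel. x \<in> \<Omega> \<longrightarrow> \<bar>\<psi>' x\<bar> \<le> M * \<phi>' x"
      using form_eigenfunction_abs_le_first[OF s(1) \<kappa>pos eigenspace_form_eigenfunction[OF \<kappa> \<psi>(1) \<psi>']
        eigenspace_form_eigenfunction[OF \<kappa> \<phi>e \<phi>'] pos \<Omega>] by blast
    have "AE x in lborel. x \<in> \<Omega> \<longrightarrow> \<bar>\<psi> x\<bar> \<le> M * \<phi>1 x"
      using M(2) \<phi>'(2) \<psi>'(2) by eventually_elim auto
    then show ?thesis using that[OF M(1)] by (simp add: AE_completion_iff)
  qed
  show ?thesis
  proof clarify
    fix t r assume tr: "(t, r) \<in> parameter_region (lam 1) a b c \<eta> \<theta>"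
    let ?d = "det (mat (lam 1) - sym_mat2 a b c)"
    (* (w1, w2) = (lam 1 I - A) (1, 1): subtracting delta phi1 from both components compensates this shift of T. *)
    define w1 w2 where "w1 = lam 1 - a - b" and "w2 = lam 1 - b - c"
    have "b * r + (lam 1 - c) * t < \<eta> * ?d" "(lam 1 - a) * r + b * t < \<theta> * ?d"
      using tr by (auto simp: parameter_region_def)
    then obtain \<delta> where \<delta>: "\<delta> > 0"
      "b * r + (lam 1 - c) * t + \<delta> * (b * w2 + (lam 1 - c) * w1) < \<eta> * ?d"
      "(lam 1 - a) * r + b * t + \<delta> * ((lam 1 - a) * w2 + b * w1) < \<theta> * ?d"
      using small_perturbation by blast
    define t' r' where "t' = t + \<delta> * w1" and "r' = r + \<delta> * w2"
    have tr': "(t', r') \<in> parameter_region (lam 1) a b c \<eta> \<theta>"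
      using \<delta>(2,3) by (simp add: parameter_region_def t'_def r'_def algebra_simps)
    define u v where "u = uT (t', r')" and "v = vT (t', r')"
    have sys: "system_solution s \<Omega> a b c \<alpha> \<beta> \<xi>1 \<xi>2 \<phi>1 f1 g1 t' r' u v"
      and neg: "AE x in lebesgue. x \<in> \<Omega> \<longrightarrow> u x < 0 \<and> v x < 0"
      using assms(25) tr' unfolding u_def v_def by blast+
    define h1 where "h1 x = a * u x + b * v x + t' * \<phi>1 x + f1 x" for x
    define h2 where "h2 x = b * u x + c * v x + r' * \<phi>1 x + g1 x" for x
    have ws: "weak_solution s \<Omega> h1 u" "weak_solution s \<Omega> h2 v"
      using sys system_solution_negative_iff[OF neg] by (auto simp: h1_def[abs_def] h2_def[abs_def])
    have uvX: "u \<in> X0_s s \<Omega>" "v \<in> X0_s s \<Omega>" using ws by (auto simp: weak_solution_def)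
    have sq: "square_integrable lebesgue (\<lambda>x. indicator \<Omega> x * (c1 * u x + c2 * v x + c3 * \<phi>1 x + f x))"
      if f: "square_integrable lebesgue (\<lambda>x. indicator \<Omega> x * f x)" for c1 c2 c3 f
    proof -
      have i: "square_integrable lebesgue (\<lambda>x. c * (indicator \<Omega> x * w x))" if "w \<in> X0_s s \<Omega>" for c w
        by (rule square_integrable_cmult[OF X0_s_square_integrable[OF that \<Omega>b]])
      have "square_integrable lebesgue (\<lambda>x. c1 * (indicator \<Omega> x * u x) + c2 * (indicator \<Omega> x * v x)
          + c3 * (indicator \<Omega> x * \<phi>1 x) + indicator \<Omega> x * f x)"
        by (intro square_integrable_add[OF square_integrable_add[OF square_integrable_add]] i uvX X f)
      then show ?thesis by (simp add: distrib_left mult.left_commute)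
    qed
    (* Up to this size the resonant term is absorbed by delta phi1 in both components. *)
    define \<epsilon>0 where "\<epsilon>0 = \<delta> / (M * (\<bar>p1\<bar> + \<bar>p2\<bar>))"
    have pp: "\<bar>p1\<bar> + \<bar>p2\<bar> > 0" using p(1) by auto
    have \<epsilon>0: "\<epsilon>0 > 0" using \<delta>(1) M(1) pp by (simp add: \<epsilon>0_def)
    define U where "U \<epsilon> x = u x - \<delta> * \<phi>1 x + (\<epsilon> * p1) * \<psi> x" for \<epsilon> x
    define V where "V \<epsilon> x = v x - \<delta> * \<phi>1 x + (\<epsilon> * p2) * \<psi> x" for \<epsilon> x
    have sol: "system_solution s \<Omega> a b c \<alpha> \<beta> \<xi>1 \<xi>2 \<phi>1 f1 g1 t r (U \<epsilon>) (V \<epsilon>)" if \<epsilon>: "0 \<le> \<epsilon>" "\<epsilon> \<le> \<epsilon>0" for \<epsilon>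
    proof -
      have small: "\<epsilon> * pi * y \<le> \<delta> * f" if "\<bar>pi\<bar> \<le> \<bar>p1\<bar> + \<bar>p2\<bar>" "\<bar>y\<bar> \<le> M * f" for pi y f
      proof -
        have "\<epsilon> * pi * y \<le> \<bar>\<epsilon> * pi * y\<bar>" by simp
        also have "\<dots> = \<epsilon> * (\<bar>pi\<bar> * \<bar>y\<bar>)" using \<epsilon> by (simp add: abs_mult)
        also have "\<dots> \<le> \<epsilon>0 * ((\<bar>p1\<bar> + \<bar>p2\<bar>) * (M * f))"
        proof -
          have "\<bar>pi\<bar> * \<bar>y\<bar> \<le> (\<bar>p1\<bar> + \<bar>p2\<bar>) * (M * f)" using that by (intro mult_mono') auto
          then show ?thesis using \<epsilon> by (rule_tac mult_mono') auto
        qed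
        also have "\<dots> = \<delta> * f" using M(1) pp by (simp add: \<epsilon>0_def)
        finally show ?thesis .
      qed
      have "AE x in lebesgue. x \<in> \<Omega> \<longrightarrow> U \<epsilon> x < 0 \<and> V \<epsilon> x < 0"
        using neg M(2)
      proof eventually_elim
        case (elim x)
        show ?case
        proof
          assume "x \<in> \<Omega>"
          then show "U \<epsilon> x < 0 \<and> V \<epsilon> x < 0"
            using elim small[of p1 "\<psi> x" "\<phi>1 x"] small[of p2 "\<psi> x" "\<phi>1 x"] by (auto simp: U_def V_def)
        qed
      qed
      note iff = system_solution_negative_iff[OF this]
      have "weak_solution s \<Omega> (\<lambda>x. a * U \<epsilon> x + b * V \<epsilon> x + t * \<phi>1 x + f1 x) (\<lambda>x. u x - \<delta> * \<phi>1 x + (\<epsilon> * p1) * \<psi> x)"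
      proof (rule weak_solution_shift[OF \<kappa> \<Omega>b ws(1) _ \<phi>e \<psi>(1)])
        show "square_integrable lebesgue (\<lambda>x. indicator \<Omega> x * h1 x)" unfolding h1_def by (rule sq[OF f1])
        fix x
        have "\<epsilon> * (a * p1 + b * p2) * \<psi> x = \<epsilon> * (lam k * p1) * \<psi> x" by (simp only: p(2))
        then show "a * U \<epsilon> x + b * V \<epsilon> x + t * \<phi>1 x + f1 x
            = h1 x - \<delta> * (lam 1 * \<phi>1 x) + \<epsilon> * p1 * (lam k * \<psi> x)"
          by (simp add: U_def V_def h1_def t'_def w1_def algebra_simps)
      qed
      moreover have "weak_solution s \<Omega> (\<lambda>x. b * U \<epsilon> x + c * V \<epsilon> x + r * \<phi>1 x + g1 x) (\<lambda>x. v x - \<delta> * \<phi>1 x + (\<epsilon> * p2) * \<psi> x)"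
      proof (rule weak_solution_shift[OF \<kappa> \<Omega>b ws(2) _ \<phi>e \<psi>(1)])
        show "square_integrable lebesgue (\<lambda>x. indicator \<Omega> x * h2 x)" unfolding h2_def by (rule sq[OF g1])
        fix x
        have "\<epsilon> * (b * p1 + c * p2) * \<psi> x = \<epsilon> * (lam k * p2) * \<psi> x" by (simp only: p(3))
        then show "b * U \<epsilon> x + c * V \<epsilon> x + r * \<phi>1 x + g1 x
            = h2 x - \<delta> * (lam 1 * \<phi>1 x) + \<epsilon> * p2 * (lam k * \<psi> x)"
          by (simp add: U_def V_def h2_def r'_def w2_def algebra_simps)
      qed
      ultimately show ?thesis unfolding iff by (simp add: U_def[abs_def] V_def[abs_def])
    qed
    (* The given solution may be one of the two, but not both, since their difference is a nonzero multiple of psi p. *)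
    have "\<not> (AE x in lebesgue. U 0 x = uT (t, r) x \<and> V 0 x = vT (t, r) x)
        \<or> \<not> (AE x in lebesgue. U \<epsilon>0 x = uT (t, r) x \<and> V \<epsilon>0 x = vT (t, r) x)"
    proof (rule ccontr)
      assume "\<not> ?thesis"
      then have "AE x in lebesgue. U 0 x = uT (t, r) x \<and> V 0 x = vT (t, r) x"
        "AE x in lebesgue. U \<epsilon>0 x = uT (t, r) x \<and> V \<epsilon>0 x = vT (t, r) x" by blast+
      then have "AE x in lebesgue. \<psi> x = 0"
        by eventually_elim (use \<epsilon>0 p(1) in \<open>auto simp: U_def V_def\<close>)
      then show False using \<psi>(2) by simp
    qed
    then show "\<exists>u v. system_solution s \<Omega> a b c \<alpha> \<beta> \<xi>1 \<xi>2 \<phi>1 f1 g1 t r u v \<and>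
             \<not> (AE x in lebesgue. u x = uT (t, r) x \<and> v x = vT (t, r) x)"
      using sol[of 0] sol[of \<epsilon>0] \<epsilon>0 by (meson less_imp_le order_refl)
  qed
qed

end
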